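(* Let $\mathcal T=\mathbb Z^l$ or $\mathcal T=\mathbb R^l$ and let $X(t)$, $t\in\mathcal T$, be a stationary $\mathbb R^d$-valued random process (with càdlàg sample paths if $\mathcal T=\mathbb R^l$). Suppose $X\in\widetilde{\mathcal R}_\alpha(a_n,\mathcal B_0,\nu_Z)$ with $a_n=n^{1/\alpha}$, $\alpha>0$, where $\nu_Z$ is a tail measure with representer $Z$ and $\mathbb E\{\|Z(0)\|^\alpha\}=1$, and suppose $\|X(0)\|$ is a unit $\alpha$-Fréchet random variable, i.e. has distribution function $e^{-x^{-\alpha}}$, $x>0$. If $\mathcal T=\mathbb R^l$, assume in addition that for some $k>0$ the quantity $$I_{k,n}=\mathbb E\Big\{\frac1{\int_{[-k,k]^l}\mathbf 1(\|X(s)\|>a_n)\,\lambda(ds)}\ \Big|\ \|X(0)\|>a_n\Big\}$$ is bounded for all $n$ large. Then, with $M_n=\sup_{t\in[0,n]^l\cap\mathcal T}\|X(t)\|$, for all $x>0$ $$\limsup_{n\to\infty}\mathbb P\{M_n>a_n^lx\}\le\theta_Yx^{-\alpha},\qquad\theta_Y=\mathbb E\Big\{\frac1{\int_{\mathcal T}\mathbf 1(\|Y(t)\|>1)\,\lambda(dt)}\Big\}\in[0,\infty),$$ where $Y=Y^{[0]}$ is the local tail process of $\nu_Z$ at $0$.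
   Context: $\lambda$ is the counting measure if $\mathcal T=\mathbb Z^l$ and Lebesgue measure if $\mathcal T=\mathbb R^l$; $1/\infty=0$. $\|\cdot\|$ is a norm on $\mathbb R^d$. $\mathrm D=D(\mathcal T,\mathbb R^d)$ is the space of all functions (with the topology of pointwise convergence) if $\mathcal T=\mathbb Z^l$; if $\mathcal T=\mathbb R^l$ it is the space of generalised càdlàg functions (all $2^l$ quadrant limits exist at each point and $f$ is continuous from the upper-right closed quadrant) with the Skorohod $J_1$ topology: $f_n\to f$ iff there are time changes $\tau_n$ of $\mathbb R^l$, acting componentwise by strictly increasing continuous bijections $\tau_{ni}$ of $\mathbb R$ with finite slope norm $\sup_{s\neq t}|\ln((\tau_{ni}(t)-\tau_{ni}(s))/(t-s))|$, with $\sup_s|\tau_{ni}(s)-s|\to0$ and $\sup_{t\in[-N,N]}\|f_n(\tau_n(t))-f(t)\|\to0$ for all $N\in\mathbb N^l$. Both are Polish. $\mathcal Q$ is a countable dense subset of $\mathcal T$. $\mathcal B_0$ consists of the sets $A\subset\mathrm D\setminus\{0\}$ for which there are a hypercube $K_A$ and $\varepsilon_A>0$ with $\sup_{t\in K_A\cap\mathcal T}\|f(t)\|>\varepsilon_A$ for all $f\in A$. $\mathcal B_0$-vague convergence of Borel measures on $\mathrm D\setminus\{0\}$ that are finite on Borel sets in $\mathcal B_0$ means convergence of integrals of bounded continuous functions with support in $\mathcal B_0$. $X\in\widetilde{\mathcal R}_\alpha(a_n,\mathcal B_0,\nu_Z)$ means that $\nu_Z$ is finite on Borel sets in $\mathcal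 B_0$ and $n\mathbb P\{a_n^{-1}X\in\cdot\}$ converges $\mathcal B_0$-vaguely to $\nu_Z$ as $n\to\infty$. Tail measure with representer $Z$: $Z$ is a $\mathrm D$-valued random element with $\mathbb E\{\|Z(h)\|^\alpha\}<\infty$ for all $h$, $\mathbb P\{Z\neq0\}=1$, and $\nu_Z(A)=\mathbb E\{\int_0^\infty\mathbf 1(zZ\in A)\alpha z^{-\alpha-1}dz\}$. Since $\mathbb E\{\|Z(0)\|^\alpha\}=1$, the local tail process $Y=Y^{[0]}$ has law $A\mapsto\nu_Z(\{f\in A:\|f(0)\|>1\})=\mathbb E\{\|Z(0)\|^\alpha\mathbf 1(RZ/\|Z(0)\|\in A)\}$ with $R$ independent of $Z$ and $\mathbb P\{R>t\}=t^{-\alpha}$, $t\ge1$. *)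

theory Defs
  imports "HOL-Probability.Probability"
begin

definition is_norm :: "(real^'d \<Rightarrow> real) \<Rightarrow> bool" where
  "is_norm nrm \<longleftrightarrow>
     (\<forall>x. nrm x = 0 \<longleftrightarrow> x = 0) \<and>
     (\<forall>c x. nrm (c *\<^sub>R x) = \<bar>c\<bar> * nrm x) \<and>
     (\<forall>x y. nrm (x + y) \<le> nrm x + nrm y)"


section \<open>Index sets\<close>

text \<open>
  The index set \<open>T\<close> is a subset of \<open>\<real>\<^sup>l\<close>: either the integer lattice or everything. The dimension
  is \<open>l = CARD('l) \<ge> 1\<close>, so the two cases are different sets and can be told apart by \<open>T = UNIV\<close>.
  A function on \<open>T\<close> is represented by its extension by \<open>0\<close> to \<open>\<real>\<^sup>l\<close>; the zero function of
  \<open>T\<close> is then \<open>\<lambda>_. 0\<close> in both cases.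
\<close>

definition int_lattice :: "(real^'l) set" where
  "int_lattice = {t. \<forall>i. t $ i \<in> \<int>}"

definition index_measure :: "(real^'l) set \<Rightarrow> (real^'l) measure" where
  "index_measure T = (if T = UNIV then lborel else count_space T)"


section \<open>The path space\<close>

text \<open>One of the \<open>2\<^sup>l\<close> quadrants at \<open>t\<close>; \<open>S\<close> is the set of coordinates approached strictly from the left.\<close>

definition quadrant :: "real^'l \<Rightarrow> 'l set \<Rightarrow> (real^'l) set" where
  "quadrant t S = {s. \<forall>i. if i \<in> S then s $ i < t $ i else t $ i \<le> s $ i}"

definition cadlag :: "(real^'l \<Rightarrow> real^'d) \<Rightarrow> bool" where
  "cadlag f \<longleftrightarrow>
     (\<forall>t. (\<forall>S. \<exists>L. (f \<longlongrightarrow> L) (at t within quadrant t S)) \<and>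
          continuous (at t within quadrant t {}) f)"

definition path_space :: "(real^'l) set \<Rightarrow> (real^'l \<Rightarrow> real^'d) set" where
  "path_space T = {f. (\<forall>t. t \<notin> T \<longrightarrow> f t = 0) \<and> (T = UNIV \<longrightarrow> cadlag f)}"

definition time_change1 :: "(real \<Rightarrow> real) \<Rightarrow> bool" where
  "time_change1 \<tau> \<longleftrightarrow>
     strict_mono \<tau> \<and> continuous_on UNIV \<tau> \<and> bij \<tau> \<and>
     bdd_above {\<bar>ln ((\<tau> t - \<tau> s) / (t - s))\<bar> | s t. s \<noteq> t}"

definition J1_converges ::
    "(real^'d \<Rightarrow> real) \<Rightarrow> (nat \<Rightarrow> real^'l \<Rightarrow> real^'d) \<Rightarrow> (real^'l \<Rightarrow> real^'d) \<Rightarrow> bool" where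
  "J1_converges nrm fs f \<longleftrightarrow>
     (\<exists>\<tau> :: nat \<Rightarrow> 'l \<Rightarrow> real \<Rightarrow> real.
        (\<forall>n i. time_change1 (\<tau> n i)) \<and>
        (\<forall>i. uniform_limit UNIV (\<lambda>n s. \<tau> n i s) (\<lambda>s. s) sequentially) \<and>
        (\<forall>N :: nat^'l.
           uniform_limit (cbox (\<chi> i. - real (N $ i)) (\<chi> i. real (N $ i)))
             (\<lambda>n t. nrm (fs n (\<chi> i. \<tau> n i (t $ i)) - f t)) (\<lambda>_. 0) sequentially))"

text \<open>
  The Skorohod topology is metrizable, hence determined by its convergent sequences: its open sets
  are the sequentially open ones.
\<close>

definition J1_open ::
    "(real^'d \<Rightarrow> real) \<Rightarrow> (real^'l \<Rightarrow> real^'d) set \<Rightarrow> bool" where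
  "J1_open nrm U \<longleftrightarrow> U \<subseteq> path_space UNIV \<and>
     (\<forall>f\<in>U. \<forall>fs. (\<forall>n. fs n \<in> path_space UNIV) \<longrightarrow> J1_converges nrm fs f \<longrightarrow>
        (\<forall>\<^sub>F n in sequentially. fs n \<in> U))"

definition J1_topology :: "(real^'d \<Rightarrow> real) \<Rightarrow> (real^'l \<Rightarrow> real^'d) topology" where
  "J1_topology nrm = topology (J1_open nrm)"

lemma istopology_J1_open:
  fixes nrm :: "real^'d \<Rightarrow> real"
  shows "istopology (J1_open nrm :: (real^'l \<Rightarrow> real^'d) set \<Rightarrow> bool)"
  unfolding istopology_def
proof (intro conjI allI impI)
  fix U V :: "(real^'l \<Rightarrow> real^'d) set"
  assume "J1_open nrm U" "J1_open nrm V"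
  then show "J1_open nrm (U \<inter> V)"
    unfolding J1_open_def by (auto intro: eventually_conj)
next
  fix \<U> :: "(real^'l \<Rightarrow> real^'d) set set"
  assume "\<forall>U\<in>\<U>. J1_open nrm U"
  then show "J1_open nrm (\<Union>\<U>)"
    unfolding J1_open_def by (fastforce elim: eventually_mono)
qed

lemma openin_J1_topology: "openin (J1_topology nrm) U \<longleftrightarrow> J1_open nrm U"
  unfolding J1_topology_def by (simp add: istopology_J1_open)

lemma topspace_J1_topology: "topspace (J1_topology nrm) = path_space UNIV"
proof -
  have "J1_open nrm (path_space UNIV)"
    by (simp add: J1_open_def)
  then show ?thesis
    unfolding topspace_def openin_J1_topology by (auto simp: J1_open_def)
qed

text \<open>
  In the lattice case the topology is that of pointwise convergence, i.e. the one induced by the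
  product topology, which is the library topology on functions.
\<close>

definition path_topology ::
    "(real^'d \<Rightarrow> real) \<Rightarrow> (real^'l) set \<Rightarrow> (real^'l \<Rightarrow> real^'d) topology" where
  "path_topology nrm T = (if T = UNIV then J1_topology nrm else top_of_set (path_space T))"

definition punctured_topology ::
    "(real^'d \<Rightarrow> real) \<Rightarrow> (real^'l) set \<Rightarrow> (real^'l \<Rightarrow> real^'d) topology" where
  "punctured_topology nrm T = subtopology (path_topology nrm T) (path_space T - {\<lambda>_. 0})"

lemma topspace_path_topology: "topspace (path_topology nrm T) = path_space T"
  by (simp add: path_topology_def topspace_J1_topology)

lemma topspace_punctured_topology:
  "topspace (punctured_topology nrm T) = path_space T - {\<lambda>_. 0}"
  by (auto simp: punctured_topology_def topspace_path_topology)

definition borel_of :: "'a topology \<Rightarrow> 'a measure" where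
  "borel_of X = sigma (topspace X) {U. openin X U}"

lemma space_borel_of: "space (borel_of X) = topspace X"
  by (simp add: borel_of_def space_measure_of_conv)

lemma sets_borel_of: "sets (borel_of X) = sigma_sets (topspace X) {U. openin X U}"
  unfolding borel_of_def by (rule sets_measure_of) (auto dest: openin_subset)


section \<open>Boundedness and vague convergence\<close>

text \<open>\<open>\<B>\<^sub>0\<close>; the supremum is taken in \<open>ennreal\<close>, so that it is \<open>0\<close> if \<open>K \<inter> T\<close> is empty.\<close>

definition bounded_sets ::
    "(real^'d \<Rightarrow> real) \<Rightarrow> (real^'l) set \<Rightarrow> (real^'l \<Rightarrow> real^'d) set set" where
  "bounded_sets nrm T = {A. A \<subseteq> path_space T - {\<lambda>_. 0} \<and>
     (\<exists>a r \<epsilon>. r > 0 \<and> \<epsilon> > 0 \<and>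
        (\<forall>f\<in>A. (SUP t \<in> cbox a (\<chi> i. a $ i + r) \<inter> T. ennreal (nrm (f t))) > ennreal \<epsilon>))}"

definition locally_finite ::
    "(real^'d \<Rightarrow> real) \<Rightarrow> (real^'l) set \<Rightarrow> (real^'l \<Rightarrow> real^'d) measure \<Rightarrow> bool" where
  "locally_finite nrm T \<mu> \<longleftrightarrow> (\<forall>A \<in> sets \<mu> \<inter> bounded_sets nrm T. emeasure \<mu> A < \<infinity>)"

definition vaguely_converges ::
    "(real^'d \<Rightarrow> real) \<Rightarrow> (real^'l) set \<Rightarrow>
     (nat \<Rightarrow> (real^'l \<Rightarrow> real^'d) measure) \<Rightarrow> (real^'l \<Rightarrow> real^'d) measure \<Rightarrow> bool" where
  "vaguely_converges nrm T \<mu> \<nu> \<longleftrightarrow>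
     (\<forall>h :: (real^'l \<Rightarrow> real^'d) \<Rightarrow> real.
        continuous_map (punctured_topology nrm T) euclideanreal h \<longrightarrow>
        bounded (h ` (path_space T - {\<lambda>_. 0})) \<longrightarrow>
        punctured_topology nrm T closure_of {f \<in> path_space T - {\<lambda>_. 0}. h f \<noteq> 0}
          \<in> bounded_sets nrm T \<longrightarrow>
        (\<lambda>n. \<integral>f. h f \<partial>\<mu> n) \<longlonglongrightarrow> (\<integral>f. h f \<partial>\<nu>))"

definition path_random_element ::
    "(real^'d \<Rightarrow> real) \<Rightarrow> (real^'l) set \<Rightarrow> 'w measure \<Rightarrow> ('w \<Rightarrow> real^'l \<Rightarrow> real^'d) \<Rightarrow> bool" where
  "path_random_element nrm T M X \<longleftrightarrow>
     prob_space M \<and> X \<in> M \<rightarrow>\<^sub>M borel_of (path_topology nrm T)"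

definition scaled_law ::
    "(real^'d \<Rightarrow> real) \<Rightarrow> (real^'l) set \<Rightarrow> 'w measure \<Rightarrow> ('w \<Rightarrow> real^'l \<Rightarrow> real^'d) \<Rightarrow>
     (nat \<Rightarrow> real) \<Rightarrow> nat \<Rightarrow> (real^'l \<Rightarrow> real^'d) measure" where
  "scaled_law nrm T M X a n =
     scale_measure (of_nat n)
       (restrict_space
          (distr M (borel_of (path_topology nrm T)) (\<lambda>\<omega> t. inverse (a n) *\<^sub>R X \<omega> t))
          (path_space T - {\<lambda>_. 0}))"

definition regularly_varying ::
    "(real^'d \<Rightarrow> real) \<Rightarrow> (real^'l) set \<Rightarrow> 'w measure \<Rightarrow> ('w \<Rightarrow> real^'l \<Rightarrow> real^'d) \<Rightarrow>
     (nat \<Rightarrow> real) \<Rightarrow> (real^'l \<Rightarrow> real^'d) measure \<Rightarrow> bool" where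
  "regularly_varying nrm T M X a \<nu> \<longleftrightarrow>
     path_random_element nrm T M X \<and>
     sets \<nu> = sets (borel_of (punctured_topology nrm T)) \<and>
     locally_finite nrm T \<nu> \<and>
     vaguely_converges nrm T (scaled_law nrm T M X a) \<nu>"


section \<open>Tail measures, local tail process, stationarity\<close>

definition tail_measure_representer ::
    "(real^'d \<Rightarrow> real) \<Rightarrow> (real^'l) set \<Rightarrow> real \<Rightarrow>
     (real^'l \<Rightarrow> real^'d) measure \<Rightarrow> 'z measure \<Rightarrow> ('z \<Rightarrow> real^'l \<Rightarrow> real^'d) \<Rightarrow> bool" where
  "tail_measure_representer nrm T \<alpha> \<nu> P Z \<longleftrightarrow>
     path_random_element nrm T P Z \<and>
     (\<forall>h\<in>T. (\<integral>\<^sup>+\<omega>. ennreal (nrm (Z \<omega> h) powr \<alpha>) \<partial>P) < \<infinity>) \<and>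
     (AE \<omega> in P. Z \<omega> \<noteq> (\<lambda>_. 0)) \<and>
     sets \<nu> = sets (borel_of (punctured_topology nrm T)) \<and>
     (\<forall>A \<in> sets \<nu>. emeasure \<nu> A =
        (\<integral>\<^sup>+\<omega>. (\<integral>\<^sup>+z\<in>{0<..}. indicator A (\<lambda>t. z *\<^sub>R Z \<omega> t) * ennreal (\<alpha> * z powr (- \<alpha> - 1)) \<partial>lborel) \<partial>P))"

definition local_tail_process ::
    "(real^'d \<Rightarrow> real) \<Rightarrow> (real^'l) set \<Rightarrow> (real^'l \<Rightarrow> real^'d) measure \<Rightarrow>
     'y measure \<Rightarrow> ('y \<Rightarrow> real^'l \<Rightarrow> real^'d) \<Rightarrow> bool" where
  "local_tail_process nrm T \<nu> N Y \<longleftrightarrow>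
     path_random_element nrm T N Y \<and>
     (\<forall>A \<in> sets (borel_of (path_topology nrm T)).
        emeasure N (Y -` A \<inter> space N) = emeasure \<nu> {f \<in> A. nrm (f 0) > 1})"

definition stationary_process ::
    "(real^'l) set \<Rightarrow> 'w measure \<Rightarrow> ('w \<Rightarrow> real^'l \<Rightarrow> real^'d) \<Rightarrow> bool" where
  "stationary_process T M X \<longleftrightarrow>
     (\<forall>t\<in>T. (\<lambda>\<omega>. X \<omega> t) \<in> borel_measurable M) \<and>
     (\<forall>J h. finite J \<longrightarrow> J \<subseteq> T \<longrightarrow> h \<in> T \<longrightarrow>
        distr M (\<Pi>\<^sub>M t\<in>J. borel) (\<lambda>\<omega>. \<lambda>t\<in>J. X \<omega> (t + h)) =
        distr M (\<Pi>\<^sub>M t\<in>J. borel) (\<lambda>\<omega>. \<lambda>t\<in>J. X \<omega> t))"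


section \<open>The functionals\<close>

text \<open>Values are in \<open>ennreal\<close>, where \<open>1 / \<infinity> = 0\<close> and \<open>1 / 0 = \<infinity>\<close>.\<close>

definition occupation ::
    "(real^'d \<Rightarrow> real) \<Rightarrow> (real^'l) set \<Rightarrow> (real^'l) set \<Rightarrow> real \<Rightarrow> (real^'l \<Rightarrow> real^'d) \<Rightarrow> ennreal" where
  "occupation nrm T K u f = (\<integral>\<^sup>+t\<in>K. indicator {s. nrm (f s) > u} t \<partial>index_measure T)"

definition theta ::
    "(real^'d \<Rightarrow> real) \<Rightarrow> (real^'l) set \<Rightarrow> 'y measure \<Rightarrow> ('y \<Rightarrow> real^'l \<Rightarrow> real^'d) \<Rightarrow> ennreal" where
  "theta nrm T N Y = (\<integral>\<^sup>+\<omega>. 1 / occupation nrm T T 1 (Y \<omega>) \<partial>N)"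

text \<open>\<open>uniform_measure M B\<close> is the conditional probability given the event \<open>B\<close>.\<close>

definition I_cond ::
    "(real^'d \<Rightarrow> real) \<Rightarrow> (real^'l) set \<Rightarrow> 'w measure \<Rightarrow> ('w \<Rightarrow> real^'l \<Rightarrow> real^'d) \<Rightarrow>
     (nat \<Rightarrow> real) \<Rightarrow> real \<Rightarrow> nat \<Rightarrow> ennreal" where
  "I_cond nrm T M X a k n =
     (\<integral>\<^sup>+\<omega>. 1 / occupation nrm T (cbox (\<chi> i. - k) (\<chi> i. k)) (a n) (X \<omega>)
        \<partial>uniform_measure M {\<omega> \<in> space M. nrm (X \<omega> 0) > a n})"

definition path_max ::
    "(real^'d \<Rightarrow> real) \<Rightarrow> (real^'l) set \<Rightarrow> nat \<Rightarrow> (real^'l \<Rightarrow> real^'d) \<Rightarrow> ennreal" where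
  "path_max nrm T n f = (SUP t \<in> cbox 0 (\<chi> i. real n) \<inter> T. ennreal (nrm (f t)))"

end

theory Submission
  imports Defs
begin

text \<open>
  Write \<open>\<rho>\<close> for the amplitude \<open>\<parallel>X\<parallel> / a\<^sub>m\<close> of the rescaled process and \<open>\<lambda>\<close> for the index measure. Take
  \<open>c\<close> slightly above \<open>1\<close> and let \<open>m\<close> be the integer part of \<open>n\<^sup>l (x / c)\<^sup>\<alpha>\<close>, so that \<open>c a\<^sub>m \<le> a\<^sub>n\<^sup>l x\<close> and a
  maximum above \<open>a\<^sub>n\<^sup>l x\<close> forces \<open>\<rho>\<close> to exceed \<open>c\<close> somewhere in \<open>[0,n]\<^sup>l\<close>. Let \<open>w\<close> be a continuous
  function that rises from \<open>0\<close> at \<open>1\<close> to \<open>1\<close> at \<open>c\<close>, and put \<open>W(K) = \<integral>\<^sub>K w(\<rho>(s)) \<lambda>(ds)\<close>. If \<open>D\<close> is a window slightly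
  larger than \<open>[0,n]\<^sup>l\<close>, then on the event in question \<open>W(D) > 0\<close> by right continuity, and therefore
  \<open>1 = \<integral>\<^sub>D w(\<rho>(t)) / W(D) \<lambda>(dt)\<close>. For \<open>t\<close> away from the boundary of \<open>D\<close> the denominator is at least
  \<open>W(t + [-j,j]\<^sup>l)\<close>, so that by stationarity the expectation of the integral is at most about
  \<open>n\<^sup>l E{w(\<rho>(0)) / W([-j,j]\<^sup>l)}\<close>. Here \<open>n\<^sup>l / m\<close> tends to \<open>(c / x)\<^sup>\<alpha>\<close>, and \<open>m E{\<dots>}\<close> tends to the integral of the
  same functional with respect to \<open>\<nu>\<close> by vague convergence. Letting \<open>c \<rightarrow> 1\<close> and \<open>j \<rightarrow> \<infinity>\<close> turns that
  integral into \<open>\<integral> 1(\<parallel>f(0)\<parallel> > 1) / \<integral>\<^sub>T 1(\<parallel>f(s)\<parallel> > 1) \<lambda>(ds) d\<nu>(f)\<close>, which is \<open>\<theta>\<^sub>Y\<close> by the definition of the local tail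
  process (\<open>theta_eq_cluster\<close>).

  Two points need care. First, \<open>1 / W\<close> is unbounded. It is replaced by \<open>1 / max \<eta> W\<close>, which is harmless unless some
  unit cell contains an exceedance of \<open>c\<close> although \<open>W \<le> \<eta>\<close> on a neighbourhood of it (\<open>pathwise_bound\<close>). There are
  about \<open>n\<^sup>l\<close> cells, each with the same probability of this event, and \<open>m\<close> times that probability is asymptotically at
  most the \<open>\<nu>\<close>-measure of a set of paths that decreases to the empty set as \<open>c \<rightarrow> 1\<close> and then \<open>\<eta> \<rightarrow> 0\<close>
  (\<open>thin_tendsto\<close>, \<open>thin_limit_vanishes\<close>): a path that exceeds \<open>1\<close> somewhere does so on a set of positive measure. The cap
  also makes the boundary of the window negligible, because there the integrand is at most \<open>w(\<rho>(t)) / \<eta>\<close>.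

  Second, vague convergence speaks about continuous functionals, while neither the evaluation at \<open>0\<close> nor the supremum
  over a cube is continuous for the Skorohod topology. Integrals \<open>\<integral>\<^sub>K w(\<parallel>f(s)\<parallel>) \<lambda>(ds)\<close> are continuous, because
  a cadlag path has a negligible set of discontinuities (\<open>cadlag_discontinuities_negligible\<close>), and so is a supremum
  smoothed at the boundary of the cube (\<open>peak_continuous\<close>). Evaluation at \<open>0\<close> is replaced by an average over
  \<open>[0,1/(k+1)]\<^sup>l\<close>: stationarity allows one to introduce the average before the limit in \<open>m\<close>, and right continuity
  removes it under \<open>\<nu>\<close> (\<open>avg_ratio_limit\<close>).

  Finiteness of \<open>\<theta>\<^sub>Y\<close> comes from the same computation on a single cube, read backwards: \<open>\<lambda>([0,1]\<^sup>l) E{w(\<rho>(0)) / W([-1,1]\<^sup>l)}\<close>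
  is at most the probability of an exceedance in \<open>[0,1]\<^sup>l\<close>, and \<open>m\<close> times the latter stays bounded because \<open>\<nu>\<close> is
  finite on \<open>\<B>\<^sub>0\<close> (\<open>cluster_finite\<close>).

  The lattice and the continuous case are treated together: the index measure is viewed as a Borel measure on
  \<open>\<real>\<^sup>l\<close>, and, apart from the continuity of functionals, the estimates rest on one regularity property of paths: the amplitude on \<open>T \<inter> [t, t + \<epsilon>]\<close> is close to
  its value at \<open>t\<close> for small \<open>\<epsilon>\<close> (\<open>amp_right_continuous\<close>); on the lattice that set is just \<open>{t}\<close> if \<open>\<epsilon> < 1\<close>.
\<close>

section \<open>Norms on \<open>\<real>\<^sup>d\<close>\<close>

lemma is_norm_zero: "is_norm nrm \<Longrightarrow> nrm 0 = 0"
  by (simp add: is_norm_def)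

lemma is_norm_minus: "is_norm nrm \<Longrightarrow> nrm (- x) = nrm x"
  by (metis (no_types, opaque_lifting) abs_minus_cancel abs_one is_norm_def mult_1 scaleR_minus1_left)

lemma is_norm_nonneg: assumes "is_norm nrm" shows "0 \<le> nrm x"
proof -
  have "nrm (x + - x) \<le> nrm x + nrm (- x)" using assms unfolding is_norm_def by blast
  then show ?thesis using is_norm_minus[OF assms, of x] is_norm_zero[OF assms] by simp
qed

lemma is_norm_diff: assumes "is_norm nrm" shows "\<bar>nrm x - nrm y\<bar> \<le> nrm (x - y)"
proof -
  have "nrm (y + (x - y)) \<le> nrm y + nrm (x - y)" "nrm (x + (y - x)) \<le> nrm x + nrm (y - x)"
    using assms unfolding is_norm_def by blast+
  moreover have "nrm (y - x) = nrm (x - y)" using is_norm_minus[OF assms, of "x - y"] by simp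
  ultimately show ?thesis by (simp add: abs_le_iff)
qed

lemma is_norm_sum:
  assumes "is_norm nrm" "finite A" shows "nrm (\<Sum>i\<in>A. f i) \<le> (\<Sum>i\<in>A. nrm (f i))"
  using assms(2)
proof (induction A rule: finite_induct)
  case empty then show ?case by (simp add: is_norm_zero[OF assms(1)])
next
  case (insert x F)
  have "nrm (f x + sum f F) \<le> nrm (f x) + nrm (sum f F)" using assms(1) by (simp add: is_norm_def)
  with insert show ?case by simp
qed

lemma is_norm_continuous:
  fixes nrm :: "real^'d \<Rightarrow> real"
  assumes "is_norm nrm" shows "continuous_on A nrm"
proof -
  define C where "C = (\<Sum>i\<in>UNIV. nrm (axis i (1::real)))"
  have bound: "nrm x \<le> C * norm x" for x
  proof -
    have "nrm x = nrm (\<Sum>i\<in>UNIV. (x $ i) *\<^sub>R axis i 1)"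
      using basis_expansion[of x] by (simp add: scalar_mult_eq_scaleR)
    also have "\<dots> \<le> (\<Sum>i\<in>UNIV. nrm ((x $ i) *\<^sub>R axis i 1))"
      by (rule is_norm_sum[OF assms]) simp
    also have "\<dots> = (\<Sum>i\<in>UNIV. \<bar>x $ i\<bar> * nrm (axis i 1))"
      using assms by (simp add: is_norm_def)
    also have "\<dots> \<le> (\<Sum>i\<in>UNIV. norm x * nrm (axis i 1))"
      by (intro sum_mono mult_right_mono component_le_norm_cart is_norm_nonneg[OF assms])
    finally show ?thesis by (simp add: C_def sum_distrib_left mult.commute)
  qed
  have "C \<ge> 0" unfolding C_def by (intro sum_nonneg is_norm_nonneg[OF assms])
  have "C-lipschitz_on A nrm"
  proof (rule lipschitz_onI)
    fix x y show "dist (nrm x) (nrm y) \<le> C * dist x y"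
      using is_norm_diff[OF assms, of x y] bound[of "x - y"] by (simp add: dist_norm)
  qed (fact \<open>C \<ge> 0\<close>)
  then show ?thesis by (rule lipschitz_on_continuous_on)
qed

section \<open>Amplitudes of paths\<close>

locale path_setting =
  fixes nrm :: "real^'d \<Rightarrow> real" and T :: "(real^'l) set"
  assumes nrm: "is_norm nrm" and T_cases: "T = int_lattice \<or> T = UNIV"
begin

definition amp :: "(real^'l \<Rightarrow> real^'d) \<Rightarrow> real^'l \<Rightarrow> real" where
  "amp f t = nrm (f t)"

text \<open>
  The cubes \<open>[t, t + \<epsilon>]\<close> with lower left corner \<open>t\<close>: the sets on which a path is controlled by its value at \<open>t\<close>.
\<close>

definition corner :: "real^'l \<Rightarrow> real \<Rightarrow> (real^'l) set" where
  "corner t \<epsilon> = cbox t (t + (\<chi> i. \<epsilon>))"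

lemma mem_corner: "s \<in> corner t \<epsilon> \<longleftrightarrow> (\<forall>i. t $ i \<le> s $ i \<and> s $ i \<le> t $ i + \<epsilon>)"
  by (simp add: corner_def mem_box_cart)

lemma amp_nonneg: "0 \<le> amp f t"
  by (simp add: amp_def is_norm_nonneg nrm)

lemma amp_off: "f \<in> path_space T \<Longrightarrow> t \<notin> T \<Longrightarrow> amp f t = 0"
  by (simp add: amp_def path_space_def is_norm_zero nrm)

lemma T_add: "s \<in> T \<Longrightarrow> t \<in> T \<Longrightarrow> s + t \<in> T"
  and T_diff: "s \<in> T \<Longrightarrow> t \<in> T \<Longrightarrow> s - t \<in> T"
  and T_zero: "0 \<in> T"
  using T_cases by (auto simp: int_lattice_def)

lemma lattice_corner:
  assumes "T \<noteq> UNIV" "s \<in> T" "t \<in> T" "s \<in> corner t \<epsilon>" "\<epsilon> < 1" shows "s = t"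
proof -
  have "s $ i = t $ i" for i
  proof -
    have "s $ i \<in> \<int>" "t $ i \<in> \<int>" using assms T_cases by (auto simp: int_lattice_def)
    then obtain a b where "s $ i = of_int a" "t $ i = of_int b" by (auto elim!: Ints_cases)
    moreover have "t $ i \<le> s $ i" "s $ i < t $ i + 1"
      using assms by (auto simp: mem_corner intro: le_less_trans)
    ultimately have "a \<le> b \<and> b \<le> a" by auto
    then show ?thesis using \<open>s $ i = of_int a\<close> \<open>t $ i = of_int b\<close> by simp
  qed
  then show ?thesis by (simp add: vec_eq_iff)
qed

lemma norm_corner: "s \<in> corner t \<epsilon> \<Longrightarrow> norm (s - t) \<le> real CARD('l) * \<epsilon>"
proof -
  assume s: "s \<in> corner t \<epsilon>"
  have "norm (s - t) \<le> (\<Sum>i\<in>UNIV. \<bar>(s - t) $ i\<bar>)" by (rule norm_le_l1_cart)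
  also have "\<dots> \<le> (\<Sum>i\<in>(UNIV::'l set). \<epsilon>)"
  proof (rule sum_mono)
    fix i show "\<bar>(s - t) $ i\<bar> \<le> \<epsilon>" using s by (auto simp: mem_corner abs_le_iff algebra_simps)
  qed
  finally show ?thesis by simp
qed

lemma amp_right_continuous:
  assumes f: "f \<in> path_space T" and t: "t \<in> T" and e: "e > 0"
  obtains \<epsilon> where "\<epsilon> > 0" "\<And>s. s \<in> T \<Longrightarrow> s \<in> corner t \<epsilon> \<Longrightarrow> \<bar>amp f s - amp f t\<bar> < e"
proof (cases "T = UNIV")
  case True
  then have "continuous (at t within quadrant t {}) f"
    using f by (simp add: path_space_def cadlag_def)
  moreover have "isCont nrm (f t)"
    using is_norm_continuous[OF nrm, of UNIV] by (simp add: continuous_on_eq_continuous_at)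
  ultimately have "continuous (at t within quadrant t {}) (\<lambda>s. nrm (f s))"
    by (rule continuous_within_compose3[rotated])
  then obtain d where d: "d > 0" "\<And>s. s \<in> quadrant t {} \<Longrightarrow> dist s t < d \<Longrightarrow> dist (nrm (f s)) (nrm (f t)) < e"
    using e unfolding continuous_within_eps_delta by blast
  define \<epsilon> where "\<epsilon> = d / (2 * CARD('l))"
  have "\<epsilon> > 0" using d(1) by (simp add: \<epsilon>_def)
  moreover have "\<bar>amp f s - amp f t\<bar> < e" if "s \<in> corner t \<epsilon>" for s
  proof -
    have "dist s t \<le> d / 2" using norm_corner[OF that] by (simp add: \<epsilon>_def dist_norm)
    moreover have "s \<in> quadrant t {}" using that by (simp add: mem_corner quadrant_def)
    ultimately show ?thesis using d by (simp add: amp_def dist_real_def)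
  qed
  ultimately show ?thesis using that by blast
next
  case False
  show ?thesis
  proof (rule that[of "1/2"])
    fix s assume "s \<in> T" "s \<in> corner t (1/2)"
    then have "s = t" using lattice_corner[OF False _ t] by simp
    then show "\<bar>amp f s - amp f t\<bar> < e" using e by simp
  qed simp
qed

lemma amp_tendsto_corner:
  assumes f: "f \<in> path_space T" and t: "t \<in> T"
    and s: "\<And>k. s k \<in> T" "\<And>k. s k \<in> corner t (d k)" and d: "d \<longlonglongrightarrow> 0"
  shows "(\<lambda>k. amp f (s k)) \<longlonglongrightarrow> amp f t"
proof (rule LIMSEQ_I)
  fix e :: real assume "e > 0"
  then obtain \<epsilon> where \<epsilon>: "\<epsilon> > 0" "\<And>s. s \<in> T \<Longrightarrow> s \<in> corner t \<epsilon> \<Longrightarrow> \<bar>amp f s - amp f t\<bar> < e"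
    using amp_right_continuous[OF f t] by metis
  have "eventually (\<lambda>k. d k < \<epsilon>) sequentially" using order_tendstoD(2)[OF d \<epsilon>(1)] .
  then obtain n0 where n0: "\<And>k. k \<ge> n0 \<Longrightarrow> d k < \<epsilon>" by (auto simp: eventually_sequentially)
  have "norm (amp f (s k) - amp f t) < e" if "k \<ge> n0" for k
  proof -
    have "s k $ i \<le> t $ i + d k" for i using s(2)[of k] by (simp add: mem_corner)
    then have "s k $ i \<le> t $ i + \<epsilon>" for i using n0[OF that] by (smt (verit))
    then have "s k \<in> corner t \<epsilon>" using s(2)[of k] by (simp add: mem_corner)
    then show ?thesis using \<epsilon>(2)[OF s(1)] by simp
  qed
  then show "\<exists>no. \<forall>n\<ge>no. norm (amp f (s n) - amp f t) < e" by blast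
qed

section \<open>Measurability through countably many coordinates\<close>

text \<open>
  \<open>grid k t\<close> takes countably many values and approaches \<open>t\<close> strictly from the upper right, or rounds down if \<open>T\<close> is the lattice.
  Hence \<open>reg\<close> recovers a path amplitude from countably many coordinates. It is defined on arbitrary functions, which
  is what makes functionals of a path measurable on the product space, which contains irregular functions too.
\<close>

definition grid :: "nat \<Rightarrow> real^'l \<Rightarrow> real^'l" where
  "grid k t = (if T = UNIV then (\<chi> i. (of_int \<lfloor>2^k * t $ i\<rfloor> + 1) / 2^k) else (\<chi> i. of_int \<lfloor>t $ i\<rfloor>))"

definition reg :: "(real^'l \<Rightarrow> real) \<Rightarrow> real^'l \<Rightarrow> real" where
  "reg v t = (if t \<in> T then lim (\<lambda>k. v (grid k t)) else 0)"

lemma grid_UNIV: "T = UNIV \<Longrightarrow> grid k t = (\<chi> i. (of_int \<lfloor>2^k * t $ i\<rfloor> + 1) / 2^k)"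
  and grid_lattice: "T \<noteq> UNIV \<Longrightarrow> grid k t = (\<chi> i. of_int \<lfloor>t $ i\<rfloor>)"
  unfolding grid_def by (simp_all only: if_True if_False simp_thms)

lemma grid_in: "grid k t \<in> T"
  using T_cases by (auto simp: grid_def int_lattice_def)

lemma grid_corner: "t \<in> T \<Longrightarrow> grid k t \<in> corner t ((1/2)^k)"
proof (cases "T = UNIV")
  case True
  have "t $ i \<le> (of_int \<lfloor>2^k * t $ i\<rfloor> + 1) / 2^k \<and> (of_int \<lfloor>2^k * t $ i\<rfloor> + 1) / 2^k \<le> t $ i + (1/2)^k" for i
  proof -
    have "2^k * t $ i < of_int \<lfloor>2^k * t $ i\<rfloor> + 1" "of_int \<lfloor>2^k * t $ i\<rfloor> \<le> 2^k * t $ i" by linarith+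
    then show ?thesis by (simp add: field_simps)
  qed
  then show ?thesis by (simp add: mem_corner grid_UNIV[OF True])
next
  case False assume "t \<in> T"
  then have "t $ i \<in> \<int>" for i using False T_cases by (auto simp: int_lattice_def)
  then have fl: "real_of_int \<lfloor>t $ i\<rfloor> = t $ i" for i by (auto simp: of_int_floor_cancel elim: Ints_cases)
  show ?thesis unfolding mem_corner grid_lattice[OF False] vec_lambda_beta fl by simp
qed

lemma reg_amp_shift:
  assumes f: "f \<in> path_space T" and h: "h \<in> T"
  shows "reg (\<lambda>t\<in>T. amp f (t + h)) = (\<lambda>t. amp f (t + h))"
proof
  fix t
  show "reg (\<lambda>t\<in>T. amp f (t + h)) t = amp f (t + h)"
  proof (cases "t \<in> T")
    case True
    have "(\<lambda>k. amp f (grid k t + h)) \<longlonglongrightarrow> amp f (t + h)"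
    proof (rule amp_tendsto_corner[OF f])
      show "grid k t + h \<in> corner (t + h) ((1/2)^k)" for k
        using grid_corner[OF True, of k] by (simp add: mem_corner algebra_simps)
      show "(\<lambda>k. (1/2)^k) \<longlonglongrightarrow> (0::real)" by (rule LIMSEQ_power_zero) simp
    qed (use True h grid_in T_add in auto)
    then show ?thesis using True by (simp add: reg_def grid_in limI)
  next
    case False
    then have "t + h \<notin> T" using T_diff[of "t + h" h] h by auto
    then show ?thesis using False by (simp add: reg_def amp_off[OF f])
  qed
qed

lemma reg_amp: "f \<in> path_space T \<Longrightarrow> reg (\<lambda>t\<in>T. amp f t) = amp f"
  using reg_amp_shift[of f 0] T_zero by simp

lemma grid_countable: "countable (range (grid k))"
proof (cases "T = UNIV")
    case True
    have "range (grid k) \<subseteq> range (\<lambda>z::int^'l. (\<chi> i. (of_int (z $ i) + 1) / 2^k))"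
    proof clarify
      fix t show "grid k t \<in> range (\<lambda>z::int^'l. (\<chi> i. (of_int (z $ i) + 1) / 2^k))"
        by (intro range_eqI[of _ _ "\<chi> i. \<lfloor>2^k * t $ i\<rfloor>"]) (simp add: grid_UNIV[OF True])
    qed
    then show ?thesis by (rule countable_subset) simp
  next
    case False
    have "range (grid k) \<subseteq> range (\<lambda>z::int^'l. (\<chi> i. of_int (z $ i)))"
    proof clarify
      fix t show "grid k t \<in> range (\<lambda>z::int^'l. (\<chi> i. of_int (z $ i)))"
        using False by (intro range_eqI[of _ _ "\<chi> i. \<lfloor>t $ i\<rfloor>"]) (simp add: grid_def)
    qed
    then show ?thesis by (rule countable_subset) simp
qed

lemma grid_measurable: "grid k \<in> borel \<rightarrow>\<^sub>M count_space (range (grid k))"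
proof -
  have coord[measurable]: "(\<lambda>t::real^'l. t $ i) \<in> borel_measurable borel" for i
    by (intro borel_measurable_continuous_onI continuous_intros)
  have "grid k -` {a} \<inter> space borel \<in> sets borel" for a
  proof (cases "T = UNIV")
    case True
    have "grid k -` {a} \<inter> space borel = {t\<in>space borel. \<forall>i. (of_int \<lfloor>2^k * t $ i\<rfloor> + 1) / 2^k = a $ i}"
      by (auto simp: grid_UNIV[OF True] vec_eq_iff)
    also have "\<dots> \<in> sets borel" by measurable
    finally show ?thesis .
  next
    case False
    have "grid k -` {a} \<inter> space borel = {t\<in>space borel. \<forall>i. of_int \<lfloor>t $ i\<rfloor> = a $ i}"
      by (auto simp: grid_lattice[OF False] vec_eq_iff)
    also have "\<dots> \<in> sets borel" by measurable
    finally show ?thesis .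
  qed
  then show ?thesis unfolding measurable_count_space_eq_countable[OF grid_countable] by auto
qed

lemma T_borel[measurable]: "T \<in> sets borel"
proof (cases "T = UNIV")
  case False
  have "closed (\<int> :: real set)" by simp
  then have "closed {t::real^'l. t $ i \<in> \<int>}" for i
    by (rule closed_vimage[unfolded vimage_def]) (intro continuous_intros)
  then have "closed (\<Inter>i. {t::real^'l. t $ i \<in> \<int>})" by auto
  moreover have "T = (\<Inter>i. {t::real^'l. t $ i \<in> \<int>})" using False T_cases by (auto simp: int_lattice_def)
  ultimately show ?thesis by (simp add: borel_closed)
qed simp

lemma reg_measurable:
  assumes [measurable]: "\<And>t. t \<in> T \<Longrightarrow> (\<lambda>\<omega>. \<xi> \<omega> t) \<in> borel_measurable \<Omega>"
  shows "(\<lambda>x. reg (\<xi> (fst x)) (snd x)) \<in> borel_measurable (\<Omega> \<Otimes>\<^sub>M borel)"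
proof -
  have [measurable]: "(\<lambda>x. \<xi> (fst x) (grid k (snd x))) \<in> borel_measurable (\<Omega> \<Otimes>\<^sub>M borel)" for k
  proof (rule measurable_compose_countable'[where I = "range (grid k)" and g = "\<lambda>x. grid k (snd x)" and f = "\<lambda>s x. \<xi> (fst x) s"])
    show "(\<lambda>x. grid k (snd x)) \<in> \<Omega> \<Otimes>\<^sub>M borel \<rightarrow>\<^sub>M count_space (range (grid k))"
      by (rule measurable_compose[OF measurable_snd grid_measurable])
    show "countable (range (grid k))" by (rule grid_countable)
    show "(\<lambda>x. \<xi> (fst x) i) \<in> borel_measurable (\<Omega> \<Otimes>\<^sub>M borel)" if "i \<in> range (grid k)" for i
    proof -
      have "i \<in> T" using that grid_in by auto
      then show ?thesis by measurable
    qed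
  qed
  show ?thesis unfolding reg_def by measurable
qed

end

context path_setting begin

section \<open>The index measure as a Borel measure\<close>

text \<open>
  The index measure, pushed forward to \<open>\<real>\<^sup>l\<close> with its Borel sets; the counting measure becomes the sum of the
  point masses at lattice points.
\<close>

definition lam :: "(real^'l) measure" where
  "lam = distr (index_measure T) borel (\<lambda>t. t)"

lemma sets_lam[measurable_cong, simp]: "sets lam = sets borel"
  and space_lam[simp]: "space lam = UNIV"
  by (simp_all add: lam_def)

lemma lam_UNIV: "T = UNIV \<Longrightarrow> lam = lborel"
  unfolding lam_def index_measure_def by (simp only: if_True distr_id2 sets_lborel simp_thms)

lemma index_measure_lattice: "T \<noteq> UNIV \<Longrightarrow> index_measure T = count_space T"
  by (simp add: index_measure_def)

lemma id_index_measurable: "(\<lambda>t. t) \<in> index_measure T \<rightarrow>\<^sub>M borel"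
proof (cases "T = UNIV")
  case True then show ?thesis by (simp add: index_measure_def)
next
  case False then show ?thesis by (simp add: index_measure_lattice)
qed

lemma nn_integral_lam:
  "F \<in> borel_measurable borel \<Longrightarrow> (\<integral>\<^sup>+t. F t \<partial>lam) = (\<integral>\<^sup>+t. F t \<partial>index_measure T)"
  unfolding lam_def using nn_integral_distr[OF id_index_measurable] by simp

lemma emeasure_lam_lattice:
  assumes "T \<noteq> UNIV" and [measurable]: "A \<in> sets borel"
  shows "emeasure lam A = emeasure (count_space T) (A \<inter> T)"
  unfolding lam_def using assms id_index_measurable
  by (subst emeasure_distr) (auto simp: index_measure_lattice)

definition cube :: "real \<Rightarrow> real \<Rightarrow> (real^'l) set" where
  "cube p q = cbox (\<chi> i. p) (\<chi> i. q)"

lemma mem_cube: "t \<in> cube p q \<longleftrightarrow> (\<forall>i. p \<le> t $ i \<and> t $ i \<le> q)"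
  by (simp add: cube_def mem_box_cart)

lemma cube_borel[measurable]: "cube p q \<in> sets borel"
  and corner_borel[measurable]: "corner t \<epsilon> \<in> sets borel"
  by (simp_all add: cube_def corner_def)

lemma lattice_cube:
  assumes "T \<noteq> UNIV"
  shows "cube (of_int p) (of_int q) \<inter> T = (\<lambda>z. \<chi> i. real_of_int (z i)) ` (PiE UNIV (\<lambda>_. {p..q}))"
proof -
  have T: "T = int_lattice" using T_cases assms by blast
  have "t \<in> (\<lambda>z. \<chi> i. real_of_int (z i)) ` (PiE UNIV (\<lambda>_. {p..q}))"
    if t: "t \<in> cube (of_int p) (of_int q)" "t \<in> T" for t
  proof -
    have "t $ i \<in> \<int>" for i using t(2) unfolding T int_lattice_def by simp
    then have ti: "real_of_int \<lfloor>t $ i\<rfloor> = t $ i" for i by (auto elim: Ints_cases)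
    have "p \<le> \<lfloor>t $ i\<rfloor> \<and> \<lfloor>t $ i\<rfloor> \<le> q" for i
      using t(1) ti[of i] unfolding mem_cube by (metis of_int_le_iff)
    then have "(\<lambda>i. \<lfloor>t $ i\<rfloor>) \<in> PiE UNIV (\<lambda>_. {p..q})" by auto
    moreover have "t = (\<chi> i. real_of_int \<lfloor>t $ i\<rfloor>)" unfolding vec_eq_iff vec_lambda_beta ti by simp
    ultimately show ?thesis by (rule rev_image_eqI[of "\<lambda>i. \<lfloor>t $ i\<rfloor>"])
  qed
  then show ?thesis by (auto simp: T int_lattice_def mem_cube PiE_iff)
qed

lemma emeasure_lam_cube:
  assumes "p \<le> q"
  shows "emeasure lam (cube (of_int p) (of_int q)) =
    ennreal ((of_int (q - p) + (if T = UNIV then 0 else 1)) ^ CARD('l))"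
proof (cases "T = UNIV")
  case True
  have "emeasure lborel (cube (of_int p) (of_int q) :: (real^'l) set) =
    ennreal (\<Prod>b\<in>Basis. ((\<chi> i. of_int q) - (\<chi> i. of_int p) :: real^'l) \<bullet> b)"
    unfolding cube_def
    by (rule emeasure_lborel_cbox) (use assms in \<open>auto simp: Basis_vec_def inner_axis\<close>)
  also have "(\<Prod>b\<in>Basis. ((\<chi> i. of_int q) - (\<chi> i. of_int p) :: real^'l) \<bullet> b) = (\<Prod>b\<in>(Basis :: (real^'l) set). of_int (q - p))"
    by (rule prod.cong) (auto simp: Basis_vec_def inner_axis)
  finally show ?thesis using True lam_UNIV[OF True] by simp
next
  case False
  have inj: "inj_on (\<lambda>z. \<chi> i. real_of_int (z i)) (PiE (UNIV::'l set) (\<lambda>_. {p..q}))"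
    by (auto simp: inj_on_def vec_eq_iff)
  let ?Z = "(\<lambda>z. \<chi> i. real_of_int (z i)) ` (PiE (UNIV::'l set) (\<lambda>_. {p..q}))"
  have "finite (PiE (UNIV::'l set) (\<lambda>_. {p..q}))" by (intro finite_PiE) auto
  then have "finite ?Z" by blast
  moreover have "?Z \<subseteq> T" using lattice_cube[OF False, of p q] by blast
  ultimately have "emeasure (count_space T) ?Z = of_nat (card ?Z)" by (simp add: emeasure_count_space)
  then have "emeasure lam (cube (of_int p) (of_int q)) = of_nat (card (PiE (UNIV::'l set) (\<lambda>_. {p..q})))"
    using False by (simp only: emeasure_lam_lattice[OF False cube_borel] lattice_cube[OF False] card_image[OF inj])
  also have "card (PiE (UNIV::'l set) (\<lambda>_. {p..q})) = nat (q - p + 1) ^ CARD('l)"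
    by (simp add: card_PiE)
  also have "of_nat \<dots> = ennreal ((of_int (q - p) + 1) ^ CARD('l))"
    using assms by (simp add: ennreal_of_nat_eq_real_of_nat)
  finally show ?thesis using False by simp
qed

lemma lam_bounded:
  assumes "bounded K" shows "emeasure lam K < \<infinity>"
proof -
  obtain B where B: "\<And>t. t \<in> K \<Longrightarrow> norm t \<le> B" using assms by (auto simp: bounded_iff)
  define m where "m = \<lceil>\<bar>B\<bar>\<rceil>"
  have "K \<subseteq> cube (of_int (-m)) (of_int m)"
  proof
    fix t assume "t \<in> K"
    then have "\<bar>t $ i\<bar> \<le> of_int m" for i
      using B[of t] component_le_norm_cart[of t i] unfolding m_def by linarith
    then show "t \<in> cube (of_int (-m)) (of_int m)" by (simp add: mem_cube abs_le_iff minus_le_iff)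
  qed
  then have "emeasure lam K \<le> emeasure lam (cube (of_int (-m)) (of_int m))"
    by (intro emeasure_mono) auto
  also have "\<dots> < \<infinity>" by (subst emeasure_lam_cube) (auto simp: m_def)
  finally show ?thesis .
qed

lemma bounded_cube: "bounded (cube p q)" and bounded_corner: "bounded (corner t \<epsilon>)"
  by (simp_all add: cube_def corner_def)

sublocale lam: sigma_finite_measure lam
proof
  show "\<exists>A. countable A \<and> A \<subseteq> sets lam \<and> \<Union> A = space lam \<and> (\<forall>a\<in>A. emeasure lam a \<noteq> \<infinity>)"
  proof (intro exI conjI)
    show "countable (range (\<lambda>n::nat. cball 0 (real n)))" by simp
    show "\<Union> (range (\<lambda>n::nat. cball 0 (real n))) = space lam"
    proof -
      have "t \<in> (\<Union>n::nat. cball 0 (real n))" for t :: "real^'l"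
        using real_arch_simple[of "norm t"] by (auto simp: mem_cball_0)
      then show ?thesis unfolding space_lam by blast
    qed
    show "\<forall>a\<in>range (\<lambda>n::nat. cball 0 (real n)). emeasure lam a \<noteq> \<infinity>"
    proof
      fix a assume "a \<in> range (\<lambda>n::nat. cball 0 (real n) :: (real^'l) set)"
      then have "bounded a" by auto
      then show "emeasure lam a \<noteq> \<infinity>" using lam_bounded[of a] by simp
    qed
    show "range (\<lambda>n::nat. cball 0 (real n)) \<subseteq> sets lam"
      unfolding sets_lam by (intro image_subsetI borel_closed closed_cball)
  qed
qed

lemma lam_corner_pos:
  assumes "t \<in> T" "\<epsilon> > 0" shows "emeasure lam (corner t \<epsilon>) > 0"
proof (cases "T = UNIV")
  case True
  have "emeasure lborel (corner t \<epsilon>) = ennreal (\<Prod>b\<in>Basis. (t + (\<chi> i. \<epsilon>) - t) \<bullet> b)"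
    unfolding corner_def
    by (rule emeasure_lborel_cbox) (use assms in \<open>auto simp: Basis_vec_def inner_axis\<close>)
  also have "(\<Prod>b\<in>Basis. (t + (\<chi> i. \<epsilon>) - t) \<bullet> b) = (\<Prod>b\<in>(Basis :: (real^'l) set). \<epsilon>)"
    by (rule prod.cong) (auto simp: Basis_vec_def inner_axis)
  finally show ?thesis using assms lam_UNIV[OF True] by simp
next
  case False
  have "0 < emeasure (count_space T) {t}" using assms by simp
  also have "\<dots> \<le> emeasure (count_space T) (corner t \<epsilon> \<inter> T)"
    using assms by (intro emeasure_mono) (auto simp: mem_corner)
  finally show ?thesis using False by (simp add: emeasure_lam_lattice)
qed

lemma lam_corner_finite: "emeasure lam (corner t \<epsilon>) < \<infinity>"
  by (rule lam_bounded[OF bounded_corner])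

lemma AE_lam_T: "AE t in lam. t \<in> T"
proof (cases "T = UNIV")
  case True
  show ?thesis by (rule AE_I2) (simp only: True UNIV_I)
next
  case False
  have "emeasure lam (- T) = emeasure (count_space T) (- T \<inter> T)"
    by (rule emeasure_lam_lattice[OF False]) (rule borel_comp[OF T_borel])
  then have "emeasure lam (- T) = 0" by simp
  then show ?thesis by (intro AE_I[of _ _ "- T"]) (auto intro: borel_comp[OF T_borel])
qed

lemma lam_shift:
  assumes "h \<in> T" shows "distr lam borel (\<lambda>t. t + h) = lam"
proof (cases "T = UNIV")
  case True
  have eq: "(\<lambda>t. t + h) = (+) h" by (rule ext) (rule add.commute)
  show ?thesis unfolding lam_UNIV[OF True] eq by (rule lborel_distr_plus)
next
  case False
  show ?thesis
  proof (rule measure_eqI)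
    fix A assume "A \<in> sets (distr lam borel (\<lambda>t. t + h))"
    then have A[measurable]: "A \<in> sets borel" by simp
    have bij: "bij_betw (\<lambda>t. t + h) T T"
      by (rule bij_betwI[where g = "\<lambda>t. t - h"]) (use T_add T_diff assms in simp_all)
    have m1: "(\<lambda>t. indicator A (t + h) :: ennreal) \<in> borel_measurable borel" by measurable
    have m2: "(indicator A :: _ \<Rightarrow> ennreal) \<in> borel_measurable borel" by measurable
    have m3: "(\<lambda>t. t + h) \<in> lam \<rightarrow>\<^sub>M borel" by measurable
    have "emeasure (distr lam borel (\<lambda>t. t + h)) A = (\<integral>\<^sup>+t. indicator A t \<partial>distr lam borel (\<lambda>t. t + h))"
      using A by (intro nn_integral_indicator[symmetric]) simp
    also have "\<dots> = (\<integral>\<^sup>+t. indicator A (t + h) \<partial>lam)"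
      by (rule nn_integral_distr[OF m3]) (use m2 in \<open>simp cong: measurable_cong_sets\<close>)
    also have "\<dots> = (\<integral>\<^sup>+t. indicator A (t + h) \<partial>count_space T)"
      unfolding index_measure_lattice[OF False, symmetric] by (rule nn_integral_lam[OF m1])
    also have "\<dots> = (\<integral>\<^sup>+t. indicator A t \<partial>count_space T)"
      by (rule nn_integral_bij_count_space[OF bij])
    also have "\<dots> = (\<integral>\<^sup>+t. indicator A t \<partial>lam)"
      unfolding index_measure_lattice[OF False, symmetric] by (rule nn_integral_lam[OF m2, symmetric])
    also have "\<dots> = emeasure lam A" using A by (intro nn_integral_indicator) simp
    finally show "emeasure (distr lam borel (\<lambda>t. t + h)) A = emeasure lam A" .
  qed simp
qed

lemma nn_integral_lam_shift:
  assumes "h \<in> T" and [measurable]: "F \<in> borel_measurable borel"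
  shows "(\<integral>\<^sup>+t. F (t + h) \<partial>lam) = (\<integral>\<^sup>+t. F t \<partial>lam)"
proof -
  have "(\<integral>\<^sup>+t. F t \<partial>distr lam borel (\<lambda>t. t + h)) = (\<integral>\<^sup>+t. F (t + h) \<partial>lam)"
    by (rule nn_integral_distr) auto
  then show ?thesis by (simp add: lam_shift[OF assms(1)])
qed

lemma amp_measurable:
  assumes "f \<in> path_space T" shows "amp f \<in> borel_measurable borel"
proof -
  have "(\<lambda>x. reg (\<lambda>t\<in>T. amp f t) (snd x)) \<in> borel_measurable (count_space (UNIV::unit set) \<Otimes>\<^sub>M borel)"
    by (rule reg_measurable[where \<xi> = "\<lambda>_. \<lambda>t\<in>T. amp f t"]) simp
  then have "(\<lambda>t. (\<lambda>x. reg (\<lambda>t\<in>T. amp f t) (snd x)) ((), t)) \<in> borel_measurable borel"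
    by (rule measurable_compose[rotated]) simp
  then show ?thesis by (simp add: reg_amp[OF assms])
qed

section \<open>Occupation integrals\<close>

text \<open>\<open>ramp i\<close> is a continuous version of \<open>\<lambda>r. 1 < r\<close>; it increases to it as \<open>i\<close> grows.\<close>

definition ramp :: "nat \<Rightarrow> real \<Rightarrow> real" where
  "ramp i r = max 0 (min 1 ((r - 1) * (real i + 1)))"

definition W :: "nat \<Rightarrow> (real^'l) set \<Rightarrow> (real^'l \<Rightarrow> real) \<Rightarrow> ennreal" where
  "W i K v = (\<integral>\<^sup>+t. indicator K t * ennreal (ramp i (v t)) \<partial>lam)"

definition occ :: "real \<Rightarrow> (real^'l) set \<Rightarrow> (real^'l \<Rightarrow> real) \<Rightarrow> ennreal" where
  "occ u K v = (\<integral>\<^sup>+t. indicator K t * (if v t > u then 1 else 0) \<partial>lam)"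

lemma ramp_bounds: "0 \<le> ramp i r" "ramp i r \<le> 1"
  by (auto simp: ramp_def)

lemma ramp_measurable[measurable]: "ramp i \<in> borel_measurable borel"
  unfolding ramp_def by measurable

lemma ramp_continuous: "continuous_on A (ramp i)"
  unfolding ramp_def by (intro continuous_intros)

lemma ramp_zero: "r \<le> 1 \<Longrightarrow> ramp i r = 0"
  using mult_nonpos_nonneg[of "r - 1" "real i + 1"] by (simp add: ramp_def)

lemma ramp_one: "r \<ge> 1 + 1 / (real i + 1) \<Longrightarrow> ramp i r = 1"
proof -
  assume "r \<ge> 1 + 1 / (real i + 1)"
  then have "(r - 1) * (real i + 1) \<ge> 1" by (simp add: field_simps)
  then show ?thesis by (simp add: ramp_def)
qed

text \<open>
  Joint measurability in sample and index. Occupation integrals are integrals over the index set, so this is the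
  property that makes them random variables.
\<close>

definition measurable_process :: "'e measure \<Rightarrow> ('e \<Rightarrow> real^'l \<Rightarrow> real) \<Rightarrow> bool" where
  "measurable_process \<Omega> \<xi> \<longleftrightarrow> case_prod \<xi> \<in> borel_measurable (\<Omega> \<Otimes>\<^sub>M borel)"

lemma nn_integral_process_measurable:
  fixes \<phi> :: "real \<Rightarrow> ennreal"
  assumes \<xi>: "measurable_process \<Omega> \<xi>"
    and [measurable]: "K \<in> sets borel" "\<phi> \<in> borel_measurable borel"
  shows "(\<lambda>\<omega>. \<integral>\<^sup>+t. indicator K t * \<phi> (\<xi> \<omega> t) \<partial>lam) \<in> borel_measurable \<Omega>"
proof -
  have "sets (\<Omega> \<Otimes>\<^sub>M lam) = sets (\<Omega> \<Otimes>\<^sub>M (borel :: (real^'l) measure))" by (rule sets_pair_measure_cong) simp_all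
  then have [measurable]: "case_prod \<xi> \<in> borel_measurable (\<Omega> \<Otimes>\<^sub>M lam)"
    using \<xi> unfolding measurable_process_def by (simp cong: measurable_cong_sets)
  have "(\<lambda>x. indicator K (snd x) * \<phi> (case_prod \<xi> x)) \<in> borel_measurable (\<Omega> \<Otimes>\<^sub>M lam)"
    by measurable
  from lam.borel_measurable_nn_integral_fst[OF this] show ?thesis by (simp only: fst_conv snd_conv prod.case)
qed

lemma W_measurable:
  assumes "measurable_process \<Omega> \<xi>" "K \<in> sets borel"
  shows "(\<lambda>\<omega>. W i K (\<xi> \<omega>)) \<in> borel_measurable \<Omega>"
  unfolding W_def
  by (rule nn_integral_process_measurable[where \<phi> = "\<lambda>r. ennreal (ramp i r)" and \<xi> = \<xi>, OF assms]) measurable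

lemma occ_measurable:
  assumes "measurable_process \<Omega> \<xi>" "K \<in> sets borel"
  shows "(\<lambda>\<omega>. occ u K (\<xi> \<omega>)) \<in> borel_measurable \<Omega>"
  unfolding occ_def
  by (rule nn_integral_process_measurable[where \<phi> = "\<lambda>r. if r > u then 1 else 0" and \<xi> = \<xi>, OF assms]) measurable

lemma measurable_process_section:
  assumes "measurable_process \<Omega> \<xi>" shows "(\<lambda>\<omega>. \<xi> \<omega> t) \<in> borel_measurable \<Omega>"
proof -
  have "(\<lambda>\<omega>. case_prod \<xi> (\<omega>, t)) \<in> borel_measurable \<Omega>"
    using assms unfolding measurable_process_def by (rule measurable_compose[rotated]) simp
  then show ?thesis by simp
qed

lemma measurable_process_affine:
  assumes "measurable_process \<Omega> \<xi>" shows "measurable_process \<Omega> (\<lambda>\<omega> t. c * \<xi> \<omega> (t + h))"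
proof -
  have [measurable]: "case_prod \<xi> \<in> borel_measurable (\<Omega> \<Otimes>\<^sub>M borel)" using assms by (simp add: measurable_process_def)
  have "(\<lambda>x. c * case_prod \<xi> (fst x, snd x + h)) \<in> borel_measurable (\<Omega> \<Otimes>\<^sub>M borel)" by measurable
  then show ?thesis by (simp add: measurable_process_def case_prod_unfold)
qed

lemma occupation_eq:
  assumes "f \<in> path_space T" and [measurable]: "K \<in> sets borel"
  shows "occupation nrm T K u f = occ u K (amp f)"
proof -
  note [measurable] = amp_measurable[OF assms(1)]
  have "occ u K (amp f) = (\<integral>\<^sup>+t. indicator K t * (if amp f t > u then 1 else 0) \<partial>index_measure T)"
    unfolding occ_def by (rule nn_integral_lam) measurable
  also have "\<dots> = occupation nrm T K u f"
    unfolding occupation_def by (intro nn_integral_cong) (auto simp: amp_def indicator_def)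
  finally show ?thesis by simp
qed

section \<open>Stationarity of functionals\<close>

text \<open>
  Stationarity is a statement about finite-dimensional laws, so the amplitudes of the shifted and of the original
  process have the same law on the product space. A functional of paths transfers to the product space through
  \<open>reg\<close>, which leaves path amplitudes unchanged.
\<close>

lemma stationary_functional:
  fixes M :: "'w measure"
  assumes M: "prob_space M" and X: "\<And>\<omega>. \<omega> \<in> space M \<Longrightarrow> X \<omega> \<in> path_space T"
    and stat: "stationary_process T M X" and h: "h \<in> T"
    and \<Phi>: "(\<lambda>v. \<Phi> (\<lambda>t. c * reg v t)) \<in> borel_measurable (PiM T (\<lambda>_. borel))"
  shows "(\<integral>\<^sup>+\<omega>. \<Phi> (\<lambda>t. c * amp (X \<omega>) (t + h)) \<partial>M) = (\<integral>\<^sup>+\<omega>. \<Phi> (\<lambda>t. c * amp (X \<omega>) t) \<partial>M)"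
proof -
  interpret prob_space M by fact
  have nrm_m[measurable]: "nrm \<in> borel_measurable borel"
    by (intro borel_measurable_continuous_onI is_norm_continuous nrm)
  have X_m[measurable]: "(\<lambda>\<omega>. X \<omega> t) \<in> borel_measurable M" if "t \<in> T" for t
    using stat that by (simp add: stationary_process_def)
  define V where "V h \<omega> = (\<lambda>t\<in>T. amp (X \<omega>) (t + h))" for h \<omega>
  have V_m: "V h \<in> M \<rightarrow>\<^sub>M PiM T (\<lambda>_. borel)" if "h \<in> T" for h
    unfolding V_def amp_def using that by (intro measurable_restrict measurable_compose[OF X_m nrm_m] T_add)
  have law: "distr M (PiM T (\<lambda>_. borel)) (V h) = distr M (PiM T (\<lambda>_. borel)) (V 0)"
  proof (rule measure_eqI_PiM_infinite[where I = T and M = "\<lambda>_. borel"])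
    fix A and J assume J: "finite J" "J \<subseteq> T" and A: "\<And>i. i \<in> J \<Longrightarrow> A i \<in> sets (borel :: real measure)"
    let ?E = "prod_emb T (\<lambda>_. borel) J (Pi\<^sub>E J A)"
    have E: "?E \<in> sets (PiM T (\<lambda>_. borel))" using J A by (intro sets_PiM_I) auto
    let ?B = "Pi\<^sub>E J (\<lambda>t. nrm -` A t)"
    have B: "?B \<in> sets (\<Pi>\<^sub>M t\<in>J. borel)"
      using J A by (intro sets_PiM_I_finite) (auto intro: measurable_sets_borel[OF nrm_m])
    have eq: "emeasure (distr M (PiM T (\<lambda>_. borel)) (V g)) ?E =
       emeasure (distr M (\<Pi>\<^sub>M t\<in>J. borel) (\<lambda>\<omega>. \<lambda>t\<in>J. X \<omega> (t + g))) ?B" if g: "g \<in> T" for g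
    proof -
      have "(\<lambda>\<omega>. \<lambda>t\<in>J. X \<omega> (t + g)) \<in> M \<rightarrow>\<^sub>M (\<Pi>\<^sub>M t\<in>J. borel)"
        using J g by (intro measurable_restrict X_m T_add) auto
      then have "emeasure (distr M (\<Pi>\<^sub>M t\<in>J. borel) (\<lambda>\<omega>. \<lambda>t\<in>J. X \<omega> (t + g))) ?B
        = emeasure M ((\<lambda>\<omega>. \<lambda>t\<in>J. X \<omega> (t + g)) -` ?B \<inter> space M)"
        using B by (rule emeasure_distr)
      also have "(\<lambda>\<omega>. \<lambda>t\<in>J. X \<omega> (t + g)) -` ?B \<inter> space M = V g -` ?E \<inter> space M"
      proof (intro set_eqI iffI)
        fix \<omega> assume "\<omega> \<in> (\<lambda>\<omega>. \<lambda>t\<in>J. X \<omega> (t + g)) -` ?B \<inter> space M"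
        then show "\<omega> \<in> V g -` ?E \<inter> space M"
          using J by (fastforce simp: prod_emb_iff V_def amp_def PiE_iff)
      next
        fix \<omega> assume "\<omega> \<in> V g -` ?E \<inter> space M"
        then show "\<omega> \<in> (\<lambda>\<omega>. \<lambda>t\<in>J. X \<omega> (t + g)) -` ?B \<inter> space M"
          using J by (fastforce simp: prod_emb_iff V_def amp_def PiE_iff)
      qed
      also have "emeasure M \<dots> = emeasure (distr M (PiM T (\<lambda>_. borel)) (V g)) ?E"
        by (rule emeasure_distr[OF V_m[OF g] E, symmetric])
      finally show ?thesis by (rule sym)
    qed
    have "distr M (\<Pi>\<^sub>M t\<in>J. borel) (\<lambda>\<omega>. \<lambda>t\<in>J. X \<omega> (t + h)) =
        distr M (\<Pi>\<^sub>M t\<in>J. borel) (\<lambda>\<omega>. \<lambda>t\<in>J. X \<omega> t)"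
      using stat J h by (simp add: stationary_process_def)
    then show "emeasure (distr M (PiM T (\<lambda>_. borel)) (V h)) ?E = emeasure (distr M (PiM T (\<lambda>_. borel)) (V 0)) ?E"
      using eq[OF h] eq[OF T_zero] by simp
  next
    show "finite_measure (distr M (PiM T (\<lambda>_. borel)) (V h))"
      by (intro finite_measure_distr V_m h)
  qed auto
  have "(\<integral>\<^sup>+\<omega>. \<Phi> (\<lambda>t. c * reg (V g \<omega>) t) \<partial>M) = (\<integral>\<^sup>+v. \<Phi> (\<lambda>t. c * reg v t) \<partial>distr M (PiM T (\<lambda>_. borel)) (V g))"
    if "g \<in> T" for g
    by (rule nn_integral_distr[symmetric, OF V_m[OF that]]) (simp add: \<Phi>)
  from this[OF h] this[OF T_zero] law
  have "(\<integral>\<^sup>+\<omega>. \<Phi> (\<lambda>t. c * reg (V h \<omega>) t) \<partial>M) = (\<integral>\<^sup>+\<omega>. \<Phi> (\<lambda>t. c * reg (V 0 \<omega>) t) \<partial>M)"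
    by simp
  moreover have "(\<integral>\<^sup>+\<omega>. \<Phi> (\<lambda>t. c * reg (V g \<omega>) t) \<partial>M) = (\<integral>\<^sup>+\<omega>. \<Phi> (\<lambda>t. c * amp (X \<omega>) (t + g)) \<partial>M)"
    if "g \<in> T" for g
    using that by (intro nn_integral_cong) (simp add: V_def reg_amp_shift X)
  ultimately show ?thesis using h T_zero by simp
qed

lemma reg_measurable_PiM: "measurable_process (PiM T (\<lambda>_. borel)) reg"
proof -
  have "(\<lambda>x. reg (fst x) (snd x)) \<in> borel_measurable (PiM T (\<lambda>_. borel) \<Otimes>\<^sub>M borel)"
    by (rule reg_measurable[where \<xi> = "\<lambda>v. v"]) (rule measurable_component_singleton)
  then show ?thesis by (simp add: measurable_process_def case_prod_unfold)
qed

lemma amp_measurable_process: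
  assumes "\<And>\<omega>. \<omega> \<in> space \<Omega> \<Longrightarrow> X \<omega> \<in> path_space T"
    and m: "\<And>t. t \<in> T \<Longrightarrow> (\<lambda>\<omega>. amp (X \<omega>) t) \<in> borel_measurable \<Omega>"
  shows "measurable_process \<Omega> (\<lambda>\<omega>. amp (X \<omega>))"
proof -
  have "(\<lambda>x. reg (\<lambda>t\<in>T. amp (X (fst x)) t) (snd x)) \<in> borel_measurable (\<Omega> \<Otimes>\<^sub>M borel)"
    by (rule reg_measurable[where \<xi> = "\<lambda>\<omega>. \<lambda>t\<in>T. amp (X \<omega>) t"]) (simp add: m)
  moreover have "reg (\<lambda>t\<in>T. amp (X (fst x)) t) (snd x) = amp (X (fst x)) (snd x)" if "x \<in> space (\<Omega> \<Otimes>\<^sub>M borel)" for x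
    using that assms(1) reg_amp by (auto simp: space_pair_measure)
  ultimately show ?thesis unfolding measurable_process_def case_prod_unfold
    by (simp cong: measurable_cong)
qed

end

section \<open>Discontinuities of cadlag functions\<close>

text \<open>
  Near \<open>t\<close> the function is close to one of its quadrant limits inside each open quadrant at \<open>t\<close>. So the points near \<open>t\<close> at which
  the oscillation exceeds a given size lie on the finitely many hyperplanes through \<open>t\<close>, and negligibility is a local property.
\<close>

lemma cadlag_discontinuities_negligible:
  fixes f :: "real^'l \<Rightarrow> real^'d"
  assumes "cadlag f" shows "negligible {t. \<not> isCont f t}"
proof -
  define D where "D n = {t. \<forall>d>0. \<exists>s s'. dist s t < d \<and> dist s' t < d \<and> dist (f s) (f s') \<ge> 1 / real (Suc n)}" for n
  have sub: "{t. \<not> isCont f t} \<subseteq> (\<Union>n. D n)"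
  proof
    fix t assume "t \<in> {t. \<not> isCont f t}"
    then have "\<not> (\<forall>e>0. \<exists>d>0. \<forall>s. dist s t < d \<longrightarrow> dist (f s) (f t) < e)"
      unfolding continuous_at_eps_delta by simp
    then obtain e where "e > 0" and ne: "\<not> (\<exists>d>0. \<forall>s. dist s t < d \<longrightarrow> dist (f s) (f t) < e)" by blast
    have e: "e > 0" "\<And>d. d > 0 \<Longrightarrow> \<exists>s. dist s t < d \<and> dist (f s) (f t) \<ge> e"
      using \<open>e > 0\<close> ne unfolding not_less[symmetric] by blast+
    obtain n where n: "1 / real (Suc n) < e" by (rule nat_approx_posE[OF e(1)])
    have "\<exists>s s'. dist s t < d \<and> dist s' t < d \<and> dist (f s) (f s') \<ge> 1 / real (Suc n)" if "d > 0" for d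
    proof -
      obtain s where "dist s t < d" "dist (f s) (f t) \<ge> e" using e(2)[OF \<open>d > 0\<close>] by blast
      then show ?thesis using n that by (intro exI[of _ s] exI[of _ t]) auto
    qed
    then have "t \<in> D n" unfolding D_def by simp
    then show "t \<in> (\<Union>n. D n)" by blast
  qed
  \<comment> \<open>negligibility is local: it suffices to cover \<open>D n\<close> near each of its points by hyperplanes\<close>
  have "negligible (D n)" for n
  proof (rule locally_negligible_alt[THEN iffD2], rule ballI)
    fix t assume "t \<in> D n"
    define e where "e = 1 / (2 * real (Suc n))"
    have "e > 0" by (simp add: e_def)
    have "\<forall>S. \<exists>p. snd p > 0 \<and> (\<forall>s\<in>quadrant t S. s \<noteq> t \<and> dist s t < snd p \<longrightarrow> dist (f s) (fst p) < e)"
    proof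
      fix S
      obtain L where "(f \<longlongrightarrow> L) (at t within quadrant t S)" using assms by (auto simp: cadlag_def)
      from tendstoD[OF this \<open>e > 0\<close>] obtain d where
        "d > 0" "\<forall>s\<in>quadrant t S. s \<noteq> t \<and> dist s t < d \<longrightarrow> dist (f s) L < e"
        unfolding eventually_at by blast
      then show "\<exists>p. snd p > 0 \<and> (\<forall>s\<in>quadrant t S. s \<noteq> t \<and> dist s t < snd p \<longrightarrow> dist (f s) (fst p) < e)"
        by (intro exI[of _ "(L, d)"]) simp
    qed
    then obtain p where p: "\<forall>S. snd (p S) > 0 \<and> (\<forall>s\<in>quadrant t S. s \<noteq> t \<and> dist s t < snd (p S) \<longrightarrow> dist (f s) (fst (p S)) < e)"
      by (rule choice[THEN exE])
    define L r where "L S = fst (p S)" and "r S = snd (p S)" for S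
    have r: "r S > 0" for S using p by (simp add: r_def)
    have L: "dist (f s) (L S) < e" if "s \<in> quadrant t S" "s \<noteq> t" "dist s t < r S" for s S
      using p that unfolding L_def r_def by blast
    define R where "R = Min (range r)"
    have R_pos: "R > 0" unfolding R_def using r by (intro Min_gr_iff[THEN iffD2]) auto
    have R_le: "R \<le> r S" for S unfolding R_def by (rule Min_le) simp_all
    have off: "s \<notin> D n" if s: "dist s t < R" "\<And>i. s $ i \<noteq> t $ i" for s
    proof -
      define S where "S = {i. s $ i < t $ i}"
      define G where "G = (\<Inter>i. if i \<in> S then {u. u $ i < t $ i} else {u. t $ i < u $ i})"
      have "open G" unfolding G_def
        by (intro open_INT) (simp_all add: open_halfspace_component_lt_cart open_halfspace_component_gt_cart)
      then have "open (G \<inter> ball t R)" by auto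
      moreover have "s \<in> G \<inter> ball t R"
      proof -
        have "s \<in> G" unfolding G_def S_def
        proof
          fix i show "s \<in> (if i \<in> {i. s $ i < t $ i} then {u. u $ i < t $ i} else {u. t $ i < u $ i})"
            using s(2)[of i] by simp
        qed
        then show ?thesis using s(1) by (simp add: dist_commute)
      qed
      ultimately obtain d where d: "d > 0" "ball s d \<subseteq> G \<inter> ball t R" using open_contains_ball by blast
      have near: "dist (f u) (L S) < e" if "dist u s < d" for u
      proof -
        have u: "u \<in> G" "dist u t < R" using d(2) that by (auto simp: dist_commute)
        have ui: "if i \<in> S then u $ i < t $ i else t $ i < u $ i" for i
          using u(1) unfolding G_def by (auto split: if_splits)
        have "u \<in> quadrant t S" unfolding quadrant_def mem_Collect_eq using ui by (meson less_imp_le)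
        moreover have "u \<noteq> t" using ui by (metis less_irrefl)
        moreover have "dist u t < r S" using u(2) R_le[of S] by linarith
        ultimately show ?thesis by (rule L)
      qed
      have lt: "dist (f u) (f u') < 1 / real (Suc n)" if "dist u s < d" "dist u' s < d" for u u'
      proof -
        have "dist (f u) (f u') < e + e"
          using dist_triangle2[of "f u" "f u'" "L S"] near[OF that(1)] near[OF that(2)] by linarith
        also have "e + e = 1 / real (Suc n)" by (simp add: e_def field_simps)
        finally show ?thesis .
      qed
      show ?thesis
      proof
        assume "s \<in> D n"
        then obtain u u' where "dist u s < d" "dist u' s < d" "1 / real (Suc n) \<le> dist (f u) (f u')"
          using d(1) unfolding D_def by blast
        then show False using lt[of u u'] by linarith
      qed
    qed
    show "\<exists>U. openin (top_of_set (D n)) U \<and> t \<in> U \<and> negligible U"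
    proof (intro exI conjI)
      show "openin (top_of_set (D n)) (D n \<inter> ball t R)" by (simp add: openin_open_Int)
      show "t \<in> D n \<inter> ball t R" using \<open>t \<in> D n\<close> R_pos by simp
      have "negligible {s :: real^'l. s $ i = c}" for i c
        using negligible_standard_hyperplane[of "axis i 1 :: real^'l" c] by (simp add: cart_eq_inner_axis axis_in_Basis_iff)
      then have "negligible (\<Union>i. {s. s $ i = t $ i})"
        by (intro negligible_Union) auto
      moreover have "D n \<inter> ball t R \<subseteq> (\<Union>i. {s. s $ i = t $ i})"
      proof
        fix s assume "s \<in> D n \<inter> ball t R"
        then have "\<not> (\<forall>i. s $ i \<noteq> t $ i)" using off[of s] by (auto simp: dist_commute)
        then show "s \<in> (\<Union>i. {s. s $ i = t $ i})" by blast
      qed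
      ultimately show "negligible (D n \<inter> ball t R)" using negligible_subset by blast
    qed
  qed
  then have "negligible (\<Union>n. D n)" by (rule negligible_Union_nat)
  then show ?thesis using sub negligible_subset by blast
qed

section \<open>Continuous functionals and Borel measurability\<close>

lemma continuous_map_borel_of:
  assumes "continuous_map X Y F" shows "F \<in> borel_of X \<rightarrow>\<^sub>M borel_of Y"
  unfolding borel_of_def[of Y]
proof (rule measurable_measure_of)
  show "{U. openin Y U} \<subseteq> Pow (topspace Y)" by (auto dest: openin_subset)
  show "F \<in> space (borel_of X) \<rightarrow> topspace Y"
    using assms by (auto simp: space_borel_of continuous_map_def)
  fix U assume "U \<in> {U. openin Y U}"
  then have "openin X {x \<in> topspace X. F x \<in> U}" using assms by (auto simp: continuous_map_def)
  moreover have "F -` U \<inter> space (borel_of X) = {x \<in> topspace X. F x \<in> U}" by (auto simp: space_borel_of)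
  ultimately show "F -` U \<inter> space (borel_of X) \<in> sets (borel_of X)" by (auto simp: sets_borel_of)
qed

lemma continuous_map_real_borel:
  assumes "continuous_map X euclideanreal F" shows "F \<in> borel_measurable (borel_of X)"
proof (rule borel_measurableI)
  fix U :: "real set" assume "open U"
  then have "openin X {x \<in> topspace X. F x \<in> U}" using assms by (auto simp: continuous_map_def)
  moreover have "F -` U \<inter> space (borel_of X) = {x \<in> topspace X. F x \<in> U}" by (auto simp: space_borel_of)
  ultimately show "F -` U \<inter> space (borel_of X) \<in> sets (borel_of X)" by (auto simp: sets_borel_of)
qed

context path_setting begin

text \<open>
  The Skorohod topology is the one of sequentially open sets, so sequential continuity implies continuity.
\<close>

lemma J1_continuous:
  assumes T: "T = UNIV"
    and F: "\<And>fs f. (\<And>n. fs n \<in> path_space T) \<Longrightarrow> f \<in> path_space T \<Longrightarrow> J1_converges nrm fs f \<Longrightarrow>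
       (\<lambda>n. F (fs n)) \<longlonglongrightarrow> F f"
  shows "continuous_map (path_topology nrm T) euclideanreal F"
  unfolding continuous_map_def topspace_path_topology
proof (intro conjI allI impI)
  fix U :: "real set" assume "openin euclideanreal U"
  then have "open U" by simp
  have "J1_open nrm {f \<in> path_space T. F f \<in> U}" unfolding J1_open_def
  proof (intro conjI ballI allI impI)
    fix f fs assume f: "f \<in> {f \<in> path_space T. F f \<in> U}" and fs: "\<forall>n. fs n \<in> path_space UNIV" "J1_converges nrm fs f"
    then have "(\<lambda>n. F (fs n)) \<longlonglongrightarrow> F f" using T by (intro F) auto
    then have "\<forall>\<^sub>F n in sequentially. F (fs n) \<in> U" using \<open>open U\<close> f by (intro topological_tendstoD) auto
    then show "\<forall>\<^sub>F n in sequentially. fs n \<in> {f \<in> path_space T. F f \<in> U}"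
      using fs T by simp
  qed (use T in auto)
  then show "openin (path_topology nrm T) {f \<in> path_space T. F f \<in> U}"
    using T by (simp add: path_topology_def openin_J1_topology)
qed simp

lemma lattice_continuous:
  assumes "T \<noteq> UNIV" "continuous_on (path_space T) F"
  shows "continuous_map (path_topology nrm T) euclideanreal F"
  using assms by (simp add: path_topology_def)

lemma lattice_amp_continuous: "continuous_on A (\<lambda>f. amp f t)"
proof -
  have "continuous_on A (\<lambda>f::real^'l \<Rightarrow> real^'d. f t)"
    by (rule continuous_on_subset[OF continuous_on_product_coordinates]) simp
  then show ?thesis unfolding amp_def
    by (rule continuous_on_compose2[OF is_norm_continuous[OF nrm, of UNIV]]) simp
qed

lemma finite_lattice_bounded:
  assumes "T \<noteq> UNIV" "bounded K" shows "finite (K \<inter> T)"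
proof -
  have fin: "finite (cube p q \<inter> T)" for p q
  proof (rule ccontr)
    assume "infinite (cube p q \<inter> T)"
    with Int_lower2 have "emeasure (count_space T) (cube p q \<inter> T) = \<infinity>"
      by (rule emeasure_count_space_infinite)
    moreover have "emeasure lam (cube p q) < \<infinity>" by (rule lam_bounded[OF bounded_cube])
    ultimately show False unfolding emeasure_lam_lattice[OF assms(1) cube_borel] by simp
  qed
  obtain B where B: "\<And>t. t \<in> K \<Longrightarrow> norm t \<le> B" using assms(2) unfolding bounded_iff by blast
  have "K \<subseteq> cube (- B) B"
  proof
    fix t assume "t \<in> K"
    then have "- B \<le> t $ i \<and> t $ i \<le> B" for i
      using B[of t] component_le_norm_cart[of t i] by linarith
    then show "t \<in> cube (- B) B" unfolding mem_cube by blast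
  qed
  then have "K \<inter> T \<subseteq> cube (- B) B \<inter> T" by blast
  then show ?thesis by (rule finite_subset) (rule fin)
qed

text \<open>
  A common form of the time changes: they act as one surjection of \<open>\<real>\<^sup>l\<close> that is uniformly close to the identity.
\<close>

lemma J1_convergesE:
  assumes "J1_converges nrm fs f"
  obtains \<tau> :: "nat \<Rightarrow> real^'l \<Rightarrow> real^'l" where "\<And>n. surj (\<tau> n)"
    "\<And>e. e > 0 \<Longrightarrow> \<forall>\<^sub>F n in sequentially. \<forall>u. norm (\<tau> n u - u) < e"
    "\<And>e R. e > 0 \<Longrightarrow> \<forall>\<^sub>F n in sequentially. \<forall>u\<in>cube (- R) R. nrm (fs n (\<tau> n u) - f u) < e"
proof -
  obtain \<sigma> :: "nat \<Rightarrow> 'l \<Rightarrow> real \<Rightarrow> real" where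
    tc: "\<And>n i. time_change1 (\<sigma> n i)" and
    ul: "\<And>i. uniform_limit UNIV (\<lambda>n s. \<sigma> n i s) (\<lambda>s. s) sequentially" and
    ub: "\<And>N :: nat^'l. uniform_limit (cbox (\<chi> i. - real (N $ i)) (\<chi> i. real (N $ i)))
             (\<lambda>n t. nrm (fs n (\<chi> i. \<sigma> n i (t $ i)) - f t)) (\<lambda>_. 0) sequentially"
    using assms unfolding J1_converges_def by blast
  define \<tau> where "\<tau> n u = (\<chi> i. \<sigma> n i (u $ i))" for n u
  show ?thesis
  proof (rule that[of \<tau>])
    fix n show "surj (\<tau> n)"
    proof (rule surjI)
      fix t show "\<tau> n (\<chi> i. inv (\<sigma> n i) (t $ i)) = t"
        using tc[of n] by (auto simp: \<tau>_def vec_eq_iff time_change1_def bij_is_surj surj_f_inv_f)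
    qed
  next
    fix e :: real assume "e > 0"
    define d where "d = e / (2 * CARD('l))"
    have "d > 0" using \<open>e > 0\<close> by (simp add: d_def)
    have "\<forall>\<^sub>F n in sequentially. \<forall>i. \<forall>s\<in>UNIV. dist (\<sigma> n i s) s < d"
      by (intro eventually_all_finite uniform_limitD[OF ul \<open>d > 0\<close>])
    then show "\<forall>\<^sub>F n in sequentially. \<forall>u. norm (\<tau> n u - u) < e"
    proof eventually_elim
      case (elim n)
      show ?case
      proof
        fix u
        have "norm (\<tau> n u - u) \<le> (\<Sum>i\<in>UNIV. \<bar>(\<tau> n u - u) $ i\<bar>)" by (rule norm_le_l1_cart)
        also have "\<dots> \<le> (\<Sum>i\<in>(UNIV::'l set). d)"
          by (intro sum_mono) (use elim in \<open>auto simp: \<tau>_def dist_real_def less_imp_le\<close>)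
        also have "\<dots> < e" using \<open>e > 0\<close> by (simp add: d_def)
        finally show "norm (\<tau> n u - u) < e" .
      qed
    qed
  next
    fix e R :: real assume "e > 0"
    define N :: "nat^'l" where "N = (\<chi> i. nat \<lceil>R\<rceil>)"
    have "cube (- R) R \<subseteq> cbox (\<chi> i. - real (N $ i)) (\<chi> i. real (N $ i))"
    proof
      fix t assume t: "t \<in> cube (- R) R"
      have "R \<le> real (nat \<lceil>R\<rceil>)" by linarith
      then have "- real (nat \<lceil>R\<rceil>) \<le> t $ i \<and> t $ i \<le> real (nat \<lceil>R\<rceil>)" for i
        using t unfolding mem_cube by (meson neg_le_iff_le order_trans)
      then show "t \<in> cbox (\<chi> i. - real (N $ i)) (\<chi> i. real (N $ i))"
        unfolding mem_box_cart by (simp add: N_def)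
    qed
    then show "\<forall>\<^sub>F n in sequentially. \<forall>u\<in>cube (- R) R. nrm (fs n (\<tau> n u) - f u) < e"
      using uniform_limitD[OF ub[of N] \<open>e > 0\<close>] 
      by (auto simp: \<tau>_def dist_real_def is_norm_nonneg[OF nrm] subset_iff elim!: eventually_mono)
  qed
qed

text \<open>
  With \<open>s n\<close> the preimage of \<open>t\<close> under the time change, the value of the \<open>n\<close>-th path at \<open>t\<close> is close to \<open>f (s n)\<close>, and
  \<open>s n\<close> tends to \<open>t\<close>.
\<close>

lemma J1_tendsto_at_continuity:
  assumes J: "J1_converges nrm fs f" and t: "isCont f t"
  shows "(\<lambda>n. amp (fs n) t) \<longlonglongrightarrow> amp f t"
proof -
  obtain \<tau> :: "nat \<Rightarrow> real^'l \<Rightarrow> real^'l" where \<tau>: "\<And>n. surj (\<tau> n)"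
    "\<And>e. e > 0 \<Longrightarrow> \<forall>\<^sub>F n in sequentially. \<forall>u. norm (\<tau> n u - u) < e"
    "\<And>e R. e > 0 \<Longrightarrow> \<forall>\<^sub>F n in sequentially. \<forall>u\<in>cube (- R) R. nrm (fs n (\<tau> n u) - f u) < e"
    using J1_convergesE[OF J] by blast
  define s where "s n = inv (\<tau> n) t" for n
  have s: "\<tau> n (s n) = t" for n using \<tau>(1) by (simp add: s_def surj_f_inv_f)
  have s_lim: "s \<longlonglongrightarrow> t"
  proof (rule tendstoI)
    fix e :: real assume "e > 0"
    from \<tau>(2)[OF this] show "\<forall>\<^sub>F n in sequentially. dist (s n) t < e"
    proof eventually_elim
      case (elim n) then show ?case using s[of n] by (metis dist_commute dist_norm)
    qed
  qed
  have "isCont nrm (f t)"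
    using is_norm_continuous[OF nrm, of UNIV] by (simp add: continuous_on_eq_continuous_at)
  then have "isCont (\<lambda>u. nrm (f u)) t" using t by (rule isCont_o2[rotated])
  then have lim1: "(\<lambda>n. nrm (f (s n))) \<longlonglongrightarrow> nrm (f t)" using s_lim by (rule isCont_tendsto_compose)
  have "(\<lambda>n. nrm (fs n t) - nrm (f (s n))) \<longlonglongrightarrow> 0"
  proof (rule tendstoI)
    fix e :: real assume "e > 0"
    have "\<forall>\<^sub>F n in sequentially. dist (s n) t < 1" by (rule tendstoD[OF s_lim]) simp
    with \<tau>(3)[OF \<open>e > 0\<close>, of "norm t + 1"]
    show "\<forall>\<^sub>F n in sequentially. dist (nrm (fs n t) - nrm (f (s n))) 0 < e"
    proof eventually_elim
      case (elim n)
      have "norm (s n) \<le> norm t + 1" using elim(2) norm_triangle_sub[of "s n" t] by (simp add: dist_norm)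
      then have "\<bar>s n $ i\<bar> \<le> norm t + 1" for i using component_le_norm_cart[of "s n" i] by linarith
      then have "s n \<in> cube (- (norm t + 1)) (norm t + 1)" by (simp add: mem_cube abs_le_iff) (smt (verit))
      then have "nrm (fs n t - f (s n)) < e" using elim(1) s by metis
      then show ?case using is_norm_diff[OF nrm, of "fs n t" "f (s n)"] by (simp add: dist_real_def)
    qed
  qed
  from tendsto_add[OF this lim1] show ?thesis by (simp add: amp_def)
qed

lemma AE_isCont:
  assumes "T = UNIV" "f \<in> path_space T" shows "AE t in lam. isCont f t"
proof -
  have "cadlag f" using assms by (simp add: path_space_def)
  then have "negligible {t. \<not> isCont f t}" by (rule cadlag_discontinuities_negligible)
  then have "AE t in lebesgue. isCont f t"
    by (intro AE_I'[of "{t. \<not> isCont f t}"]) (auto simp: negligible_iff_null_sets)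
  then have "AE t in lborel. isCont f t" by (simp add: AE_completion_iff)
  then show ?thesis unfolding lam_UNIV[OF assms(1)] .
qed

text \<open>
  Skorohod convergence implies convergence at almost every point, and dominated convergence does the rest. On the lattice
  the integral is a finite sum of evaluations.
\<close>

lemma integral_functional_continuous:
  fixes w :: "real \<Rightarrow> real"
  assumes w: "continuous_on UNIV w" "\<And>r. \<bar>w r\<bar> \<le> B" and K[measurable]: "K \<in> sets borel" and b: "bounded K"
  shows "continuous_map (path_topology nrm T) euclideanreal (\<lambda>f. \<integral>t. indicator K t * w (amp f t) \<partial>lam)"
proof (cases "T = UNIV")
  case True
  have [measurable]: "w \<in> borel_measurable borel" using w(1) by (rule borel_measurable_continuous_onI)
  show ?thesis
  proof (rule J1_continuous[OF True])
    fix fs f assume fs: "\<And>n. fs n \<in> path_space T" and f: "f \<in> path_space T" and J: "J1_converges nrm fs f"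
    note [measurable] = amp_measurable[OF fs] amp_measurable[OF f]
    show "(\<lambda>n. \<integral>t. indicator K t * w (amp (fs n) t) \<partial>lam) \<longlonglongrightarrow> (\<integral>t. indicator K t * w (amp f t) \<partial>lam)"
    proof (rule integral_dominated_convergence[where w = "\<lambda>t. indicator K t * B"])
      show "integrable lam (\<lambda>t. indicator K t * B)"
        using lam_bounded[OF b] by (intro integrable_mult_left integrable_real_indicator) auto
      show "AE t in lam. (\<lambda>n. indicator K t * w (amp (fs n) t)) \<longlonglongrightarrow> indicator K t * w (amp f t)"
        using AE_isCont[OF True f]
      proof eventually_elim
        case (elim t)
        have "isCont w (amp f t)" using w(1) by (simp add: continuous_on_eq_continuous_at)
        then have "(\<lambda>n. w (amp (fs n) t)) \<longlonglongrightarrow> w (amp f t)"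
          using J1_tendsto_at_continuity[OF J elim] by (rule isCont_tendsto_compose)
        then show ?case by (rule tendsto_mult[OF tendsto_const])
      qed
      show "AE t in lam. norm (indicator K t * w (amp (fs n) t)) \<le> indicator K t * B" for n
        using w(2) by (auto simp: abs_mult indicator_def)
    qed measurable
  qed
next
  case False
  have [measurable]: "w \<in> borel_measurable borel" using w(1) by (rule borel_measurable_continuous_onI)
  have fin: "finite (K \<inter> T)" by (rule finite_lattice_bounded[OF False b])
  have eq: "(\<integral>t. indicator K t * w (amp f t) \<partial>lam) = (\<Sum>t\<in>K \<inter> T. w (amp f t))" if f: "f \<in> path_space T" for f
  proof -
    note [measurable] = amp_measurable[OF f]
    have "(\<integral>t. indicator K t * w (amp f t) \<partial>lam) = (\<integral>t. indicator K t * w (amp f t) \<partial>count_space T)"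
      unfolding lam_def index_measure_lattice[OF False] by (rule integral_distr) auto
    also have "\<dots> = (\<Sum>t | t \<in> T \<and> indicator K t * w (amp f t) \<noteq> 0. indicator K t * w (amp f t))"
      by (rule lebesgue_integral_count_space_finite_support) (rule finite_subset[OF _ fin], auto simp: indicator_def split: if_splits)
    also have "\<dots> = (\<Sum>t\<in>K \<inter> T. w (amp f t))"
      by (rule sum.mono_neutral_cong_left[OF fin]) (auto simp: indicator_def split: if_splits)
    finally show ?thesis .
  qed
  have "continuous_on (path_space T) (\<lambda>f. \<Sum>t\<in>K \<inter> T. w (amp f t))"
    by (intro continuous_on_sum continuous_on_compose2[OF w(1) lattice_amp_continuous]) auto
  then have "continuous_on (path_space T) (\<lambda>f. \<integral>t. indicator K t * w (amp f t) \<partial>lam)"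
    using eq by (subst continuous_on_cong[OF refl eq]) auto
  then show ?thesis by (rule lattice_continuous[OF False])
qed

text \<open>
  A continuous substitute for the supremum over \<open>[0,1]\<^sup>l\<close>. The bump is \<open>2\<close> where the norm is at most \<open>l\<close>, hence on \<open>[-1,1]\<^sup>l\<close>, and vanishes
  outside a ball. Taking minima rather than products keeps the functional bounded and Lipschitz in the amplitude; the height
  \<open>2\<close> suffices because no threshold above \<open>2\<close> is used.
\<close>

definition bump :: "real^'l \<Rightarrow> real" where
  "bump t = max 0 (min 2 (real CARD('l) + 2 - norm t))"

definition peak :: "(real^'l \<Rightarrow> real) \<Rightarrow> real" where
  "peak v = (SUP t. min (bump t) (v t))"

lemma bump_bounds: "0 \<le> bump t" "bump t \<le> 2"
  by (auto simp: bump_def)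

lemma bdd_peak: "bdd_above (range (\<lambda>t. min (bump t) (v t)))"
  by (rule bdd_aboveI2[of _ _ 2]) (use bump_bounds in \<open>auto intro: min.coboundedI1\<close>)

lemma peak_upper: "min (bump t) (v t) \<le> peak v"
  unfolding peak_def by (rule cSUP_upper[OF _ bdd_peak]) simp

lemma peak_least: "(\<And>t. min (bump t) (v t) \<le> B) \<Longrightarrow> peak v \<le> B"
  unfolding peak_def by (rule cSUP_least) auto

lemma peak_close:
  assumes "\<And>u. \<bar>min (bump (\<tau> u)) (v (\<tau> u)) - min (bump u) (v' u)\<bar> \<le> e" "surj \<tau>"
  shows "\<bar>peak v - peak v'\<bar> \<le> e"
proof -
  have "peak v \<le> peak v' + e"
  proof (rule peak_least)
    fix t obtain u where "t = \<tau> u" using assms(2) by (metis surjD)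
    then show "min (bump t) (v t) \<le> peak v' + e" using assms(1)[of u] peak_upper[of u v'] by simp
  qed
  moreover have "peak v' \<le> peak v + e"
  proof (rule peak_least)
    fix u show "min (bump u) (v' u) \<le> peak v + e" using assms(1)[of u] peak_upper[of "\<tau> u" v] by linarith
  qed
  ultimately show ?thesis by (simp add: abs_le_iff)
qed

text \<open>
  A time change is a bijection, so it does not change a supremum over all of \<open>\<real>\<^sup>l\<close>; it moves the bump only slightly.
\<close>

lemma peak_continuous: "continuous_map (path_topology nrm T) euclideanreal (\<lambda>f. peak (amp f))"
proof (cases "T = UNIV")
  case True
  show ?thesis
  proof (rule J1_continuous[OF True])
    fix fs f assume "\<And>n. fs n \<in> path_space T" "f \<in> path_space T" and J: "J1_converges nrm fs f"
    obtain \<tau> :: "nat \<Rightarrow> real^'l \<Rightarrow> real^'l" where \<tau>: "\<And>n. surj (\<tau> n)"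
      "\<And>e. e > 0 \<Longrightarrow> \<forall>\<^sub>F n in sequentially. \<forall>u. norm (\<tau> n u - u) < e"
      "\<And>e R. e > 0 \<Longrightarrow> \<forall>\<^sub>F n in sequentially. \<forall>u\<in>cube (- R) R. nrm (fs n (\<tau> n u) - f u) < e"
      using J1_convergesE[OF J] by blast
    show "(\<lambda>n. peak (amp (fs n))) \<longlonglongrightarrow> peak (amp f)"
    proof (rule tendstoI)
      fix e :: real assume "e > 0"
      define d where "d = min (e / 2) 1"
      have "d > 0" using \<open>e > 0\<close> by (simp add: d_def)
      define R where "R = real CARD('l) + 3"
      from \<tau>(2)[OF \<open>d > 0\<close>] \<tau>(3)[OF \<open>d > 0\<close>, of R]
      show "\<forall>\<^sub>F n in sequentially. dist (peak (amp (fs n))) (peak (amp f)) < e"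
      proof eventually_elim
        case (elim n)
        have "\<bar>min (bump (\<tau> n u)) (amp (fs n) (\<tau> n u)) - min (bump u) (amp f u)\<bar> \<le> d" for u
        proof (cases "u \<in> cube (- R) R")
          case True
          have "\<bar>norm (\<tau> n u) - norm u\<bar> \<le> d" using elim(1) norm_triangle_ineq3[of "\<tau> n u" u] by (meson less_imp_le order_trans)
          then have "\<bar>bump (\<tau> n u) - bump u\<bar> \<le> d" by (auto simp: bump_def)
          moreover have "\<bar>amp (fs n) (\<tau> n u) - amp f u\<bar> \<le> d"
            using elim(2) True is_norm_diff[OF nrm, of "fs n (\<tau> n u)" "f u"] unfolding amp_def by force
          ultimately show ?thesis by linarith
        next
          case False
          then obtain i where "\<not> (- R \<le> u $ i \<and> u $ i \<le> R)" unfolding mem_cube by blast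
          then have "\<bar>u $ i\<bar> > R" by linarith
          then have "norm u > R" using component_le_norm_cart[of u i] by linarith
          moreover have "norm (\<tau> n u) \<ge> norm u - 1"
            using elim(1) norm_triangle_ineq3[of "\<tau> n u" u] by (smt (verit) d_def)
          ultimately have "bump (\<tau> n u) = 0" "bump u = 0" by (auto simp: bump_def R_def)
          then show ?thesis using \<open>d > 0\<close> by (simp add: amp_nonneg min_absorb1)
        qed
        then have "\<bar>peak (amp (fs n)) - peak (amp f)\<bar> \<le> d" using \<tau>(1) by (rule peak_close)
        then show ?case using \<open>e > 0\<close> by (simp add: dist_real_def d_def)
      qed
    qed
  qed
next
  case False
  define Q where "Q = cball 0 (real CARD('l) + 2) \<inter> T"
  have fin: "finite Q" unfolding Q_def by (rule finite_lattice_bounded[OF False bounded_cball])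
  have bd: "\<bar>peak (amp f') - peak (amp f)\<bar> \<le> (\<Sum>t\<in>Q. \<bar>amp f' t - amp f t\<bar>)"
    if "f \<in> path_space T" "f' \<in> path_space T" for f f' :: "real^'l \<Rightarrow> real^'d"
  proof (rule peak_close[where \<tau> = "\<lambda>u. u"])
    fix u show "\<bar>min (bump u) (amp f' u) - min (bump u) (amp f u)\<bar> \<le> (\<Sum>t\<in>Q. \<bar>amp f' t - amp f t\<bar>)"
    proof (cases "u \<in> Q")
      case True
      have "\<bar>min (bump u) (amp f' u) - min (bump u) (amp f u)\<bar> \<le> \<bar>amp f' u - amp f u\<bar>" by linarith
      also have "\<dots> \<le> (\<Sum>t\<in>Q. \<bar>amp f' t - amp f t\<bar>)" using True fin by (intro member_le_sum) auto
      finally show ?thesis .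
    next
      case False
      then have "bump u = 0 \<or> (amp f u = 0 \<and> amp f' u = 0)"
        using that by (auto simp: Q_def bump_def amp_off)
      then have "min (bump u) (amp f' u) = min (bump u) (amp f u)" by (auto simp: amp_nonneg min_absorb1)
      then show ?thesis by (simp add: sum_nonneg)
    qed
  qed simp
  have "continuous_on (path_space T) (\<lambda>f. peak (amp f))"
    unfolding continuous_on_def
  proof
    fix f :: "real^'l \<Rightarrow> real^'d" assume f: "f \<in> path_space T"
    have "((\<lambda>f'. \<Sum>t\<in>Q. \<bar>amp f' t - amp f t\<bar>) \<longlongrightarrow> (\<Sum>t\<in>Q. \<bar>amp f t - amp f t\<bar>)) (at f within path_space T)"
      using lattice_amp_continuous[of "path_space T"] f unfolding continuous_on_def
      by (intro tendsto_sum tendsto_rabs tendsto_diff tendsto_const) auto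
    then have lim: "((\<lambda>f'. \<Sum>t\<in>Q. \<bar>amp f' t - amp f t\<bar>) \<longlongrightarrow> 0) (at f within path_space T)" by simp
    have "((\<lambda>f'. peak (amp f') - peak (amp f)) \<longlongrightarrow> 0) (at f within path_space T)"
      by (rule Lim_null_comparison[OF _ lim]) (use bd f in \<open>auto simp: eventually_at_filter\<close>)
    then show "((\<lambda>f. peak (amp f)) \<longlongrightarrow> peak (amp f)) (at f within path_space T)"
      by (simp add: LIM_zero_iff)
  qed
  then show ?thesis by (rule lattice_continuous[OF False])
qed

end

context path_setting begin

section \<open>Evaluations, scaling and the zero path\<close>

lemma corner_mono: "\<epsilon> \<le> \<epsilon>' \<Longrightarrow> corner t \<epsilon> \<subseteq> corner t \<epsilon>'"
proof
  fix s assume "\<epsilon> \<le> \<epsilon>'" "s \<in> corner t \<epsilon>"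
  then show "s \<in> corner t \<epsilon>'" unfolding mem_corner by (meson add_left_mono order_trans)
qed

text \<open>
  Evaluation as a limit of continuous functionals. It gives the Borel measurability of evaluations here, and later undoes
  the averaging around the origin.
\<close>

lemma corner_average_tendsto:
  fixes w :: "real \<Rightarrow> real"
  assumes f: "f \<in> path_space T" and t: "t \<in> T" and w: "continuous_on UNIV w" "\<And>r. \<bar>w r\<bar> \<le> B"
  shows "(\<lambda>k. (\<integral>s. indicator (corner t (1 / real (Suc k))) s * w (amp f s) \<partial>lam) / measure lam (corner t (1 / real (Suc k))))
    \<longlonglongrightarrow> w (amp f t)"
proof (rule LIMSEQ_I)
  fix e :: real assume "e > 0"
  note [measurable] = amp_measurable[OF f]
  have [measurable]: "w \<in> borel_measurable borel" using w(1) by (rule borel_measurable_continuous_onI)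
  have "isCont w (amp f t)" using w(1) by (simp add: continuous_on_eq_continuous_at)
  then obtain d where d: "d > 0" "\<And>r. \<bar>r - amp f t\<bar> < d \<Longrightarrow> \<bar>w r - w (amp f t)\<bar> < e / 2"
    unfolding continuous_at_eps_delta dist_real_def using \<open>e > 0\<close> half_gt_zero by meson
  obtain \<epsilon> where \<epsilon>: "\<epsilon> > 0" "\<And>s. s \<in> T \<Longrightarrow> s \<in> corner t \<epsilon> \<Longrightarrow> \<bar>amp f s - amp f t\<bar> < d"
    using amp_right_continuous[OF f t d(1)] by blast
  obtain n0 where n0: "1 / real (Suc n0) < \<epsilon>" by (rule nat_approx_posE[OF \<epsilon>(1)])
  have "norm ((\<integral>s. indicator (corner t (1 / real (Suc k))) s * w (amp f s) \<partial>lam) / measure lam (corner t (1 / real (Suc k))) - w (amp f t)) < e"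
    if "k \<ge> n0" for k
  proof -
    let ?C = "corner t (1 / real (Suc k))"
    let ?m = "measure lam ?C"
    have "1 / real (Suc k) \<le> 1 / real (Suc n0)" using that by (simp add: field_simps)
    then have sub: "?C \<subseteq> corner t \<epsilon>" using n0 by (intro corner_mono) linarith
    then have near: "AE s in lam. s \<in> ?C \<longrightarrow> \<bar>w (amp f s) - w (amp f t)\<bar> < e / 2"
      using AE_lam_T
    proof eventually_elim
      case (elim s)
      then show ?case using \<epsilon>(2)[of s] d(2)[of "amp f s"] sub by blast
    qed
    have fin: "emeasure lam ?C < \<infinity>" by (rule lam_corner_finite)
    have m: "?m > 0" using lam_corner_pos[OF t, of "1 / real (Suc k)"] fin
      by (simp add: measure_def enn2real_positive_iff less_top)
    have ic: "integrable lam (\<lambda>s. indicator ?C s * c)" for c :: real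
      using fin by (intro integrable_mult_left integrable_real_indicator) auto
    have iw: "integrable lam (\<lambda>s. indicator ?C s * w (amp f s))"
      by (rule Bochner_Integration.integrable_bound[OF ic[of B]])
        (use w(2) in \<open>auto simp: indicator_def intro: order_trans[OF _ abs_ge_self]\<close>)
    have ci: "(\<integral>s. indicator ?C s * c \<partial>lam) = c * ?m" for c :: real by simp
    have "(\<integral>s. indicator ?C s * w (amp f s) \<partial>lam) - w (amp f t) * ?m
        = (\<integral>s. indicator ?C s * w (amp f s) - indicator ?C s * w (amp f t) \<partial>lam)"
      unfolding ci[symmetric] by (rule Bochner_Integration.integral_diff[symmetric, OF iw ic])
    also have "\<bar>\<dots>\<bar> \<le> (\<integral>s. \<bar>indicator ?C s * w (amp f s) - indicator ?C s * w (amp f t)\<bar> \<partial>lam)"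
      by (rule integral_abs_bound)
    also have "\<dots> \<le> (\<integral>s. indicator ?C s * (e / 2) \<partial>lam)"
    proof (rule integral_mono_AE)
      show "integrable lam (\<lambda>s. \<bar>indicator ?C s * w (amp f s) - indicator ?C s * w (amp f t)\<bar>)"
        by (rule integrable_abs[OF Bochner_Integration.integrable_diff[OF iw ic]])
      show "AE s in lam. \<bar>indicator ?C s * w (amp f s) - indicator ?C s * w (amp f t)\<bar> \<le> indicator ?C s * (e / 2)"
        using near by eventually_elim (auto simp: indicator_def)
    qed (rule ic)
    also have "\<dots> = e / 2 * ?m" by (rule ci)
    finally have "\<bar>(\<integral>s. indicator ?C s * w (amp f s) \<partial>lam) - w (amp f t) * ?m\<bar> \<le> e / 2 * ?m" .
    then have "\<bar>((\<integral>s. indicator ?C s * w (amp f s) \<partial>lam) - w (amp f t) * ?m) / ?m\<bar> \<le> e / 2"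
      using m by (simp add: abs_divide field_simps)
    moreover have "((\<integral>s. indicator ?C s * w (amp f s) \<partial>lam) - w (amp f t) * ?m) / ?m
       = (\<integral>s. indicator ?C s * w (amp f s) \<partial>lam) / ?m - w (amp f t)"
      using m by (simp add: diff_divide_distrib)
    ultimately have "norm ((\<integral>s. indicator ?C s * w (amp f s) \<partial>lam) / ?m - w (amp f t)) \<le> e / 2"
      unfolding real_norm_def by metis
    then show ?thesis using \<open>e > 0\<close> by linarith
  qed
  then show "\<exists>no. \<forall>k\<ge>no. norm ((\<integral>s. indicator (corner t (1 / real (Suc k))) s * w (amp f s) \<partial>lam) /
      measure lam (corner t (1 / real (Suc k))) - w (amp f t)) < e" by blast
qed

abbreviation "paths \<equiv> borel_of (path_topology nrm T)"

lemma space_paths: "space paths = path_space T"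
  by (simp add: space_borel_of topspace_path_topology)

lemma amp_eval_measurable:
  assumes t: "t \<in> T" shows "(\<lambda>f. amp f t) \<in> borel_measurable paths"
proof -
  have c: "continuous_on UNIV arctan" by (intro continuous_intros)
  have b: "\<bar>arctan r\<bar> \<le> pi / 2" for r using arctan_bounded[of r] by linarith
  have "(\<lambda>f. arctan (amp f t)) \<in> borel_measurable paths"
  proof (rule borel_measurable_LIMSEQ_real)
    show "(\<lambda>f. (\<integral>s. indicator (corner t (1 / real (Suc k))) s * arctan (amp f s) \<partial>lam) / measure lam (corner t (1 / real (Suc k))))
       \<in> borel_measurable paths" for k
      by (intro borel_measurable_divide borel_measurable_const continuous_map_real_borel
          integral_functional_continuous[OF c b] corner_borel bounded_corner)
  qed (use corner_average_tendsto[OF _ t c b] in \<open>simp add: space_paths\<close>)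
  then have "(\<lambda>f. tan (arctan (amp f t))) \<in> borel_measurable paths" unfolding tan_def by measurable
  then show ?thesis by (simp add: tan_arctan)
qed

lemma paths_process: "measurable_process paths amp"
  by (rule amp_measurable_process) (simp_all add: space_paths amp_eval_measurable)

lemma amp_scaleR: "amp (\<lambda>t. c *\<^sub>R f t) t = \<bar>c\<bar> * amp f t"
  using nrm by (simp add: amp_def is_norm_def)

lemma scaleR_path:
  fixes f :: "real^'l \<Rightarrow> real^'d"
  assumes "f \<in> path_space T" shows "(\<lambda>t. c *\<^sub>R f t) \<in> path_space T"
  using assms unfolding path_space_def cadlag_def
  by (force intro: tendsto_scaleR tendsto_const continuous_intros)

lemma scaleR_measurable: "(\<lambda>f t. c *\<^sub>R f t) \<in> paths \<rightarrow>\<^sub>M paths"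
proof (rule continuous_map_borel_of, cases "T = UNIV")
  case True
  show "continuous_map (path_topology nrm T) (path_topology nrm T) (\<lambda>(f::real^'l \<Rightarrow> real^'d) t. c *\<^sub>R f t)"
    unfolding continuous_map_def topspace_path_topology
  proof (intro conjI allI impI)
    show "(\<lambda>(f::real^'l \<Rightarrow> real^'d) t. c *\<^sub>R f t) \<in> path_space T \<rightarrow> path_space T" using scaleR_path by blast
    fix U assume "openin (path_topology nrm T) U"
    then have U: "J1_open nrm U" using True by (simp add: path_topology_def openin_J1_topology)
    have "J1_open nrm {f \<in> path_space T. (\<lambda>t. c *\<^sub>R f t) \<in> U}" unfolding J1_open_def
    proof (intro conjI ballI allI impI)
      fix f fs assume f: "f \<in> {f \<in> path_space T. (\<lambda>t. c *\<^sub>R f t) \<in> U}" and fs: "\<forall>n. fs n \<in> path_space UNIV"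
        and J: "J1_converges nrm fs f"
      have eq: "nrm (c *\<^sub>R x - c *\<^sub>R y) = \<bar>c\<bar> * nrm (x - y)" for x y
        using nrm by (simp add: is_norm_def flip: scaleR_diff_right)
      have "uniform_limit A (\<lambda>n x. \<bar>c\<bar> * g n x) (\<lambda>_. \<bar>c\<bar> * 0) F" if "uniform_limit A g (\<lambda>_. 0::real) F"
        for A :: "(real^'l) set" and g and F :: "nat filter"
        by (rule bounded_linear.uniform_limit[OF bounded_linear_mult_right that])
      note ul = this[unfolded mult_zero_right]
      have "J1_converges nrm (\<lambda>n t. c *\<^sub>R fs n t) (\<lambda>t. c *\<^sub>R f t)"
      proof -
        obtain \<tau> :: "nat \<Rightarrow> 'l \<Rightarrow> real \<Rightarrow> real" where
          \<tau>: "\<forall>n i. time_change1 (\<tau> n i)" "\<forall>i. uniform_limit UNIV (\<lambda>n s. \<tau> n i s) (\<lambda>s. s) sequentially"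
            "\<forall>N :: nat^'l. uniform_limit (cbox (\<chi> i. - real (N $ i)) (\<chi> i. real (N $ i)))
               (\<lambda>n t. nrm (fs n (\<chi> i. \<tau> n i (t $ i)) - f t)) (\<lambda>_. 0) sequentially"
          using J unfolding J1_converges_def by blast
        show ?thesis unfolding J1_converges_def eq
          using \<tau>(1,2) ul[OF \<tau>(3)[rule_format]] by (intro exI[of _ \<tau>]) blast
      qed
      moreover have "\<forall>n. (\<lambda>t. c *\<^sub>R fs n t) \<in> path_space UNIV" using fs scaleR_path[of _ c] True by simp
      ultimately have "\<forall>\<^sub>F n in sequentially. (\<lambda>t. c *\<^sub>R fs n t) \<in> U"
        using U f unfolding J1_open_def mem_Collect_eq
        by (elim conjE) (drule (1) bspec, drule spec, drule (1) mp, drule (1) mp, assumption)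
      then show "\<forall>\<^sub>F n in sequentially. fs n \<in> {f \<in> path_space T. (\<lambda>t. c *\<^sub>R f t) \<in> U}"
        using fs True by simp
    qed (use True in auto)
    then show "openin (path_topology nrm T) {f \<in> path_space T. (\<lambda>t. c *\<^sub>R f t) \<in> U}"
      using True by (simp add: path_topology_def openin_J1_topology)
  qed
next
  case False
  have "continuous_on (path_space T) (\<lambda>(f::real^'l \<Rightarrow> real^'d) t. c *\<^sub>R f t)"
    by (intro continuous_on_coordinatewise_then_product continuous_on_scaleR continuous_on_const
        continuous_on_subset[OF continuous_on_product_coordinates]) simp
  then show "continuous_map (path_topology nrm T) (path_topology nrm T) (\<lambda>(f::real^'l \<Rightarrow> real^'d) t. c *\<^sub>R f t)"
    using False scaleR_path by (auto simp: path_topology_def)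
qed

lemma amp_eq_0: "amp f t = 0 \<longleftrightarrow> f t = 0"
  using nrm unfolding amp_def is_norm_def by blast

lemma nonzero_paths_open: "openin (path_topology nrm T) (path_space T - {\<lambda>_. 0})"
proof (cases "T = UNIV")
  case True
  have "J1_open nrm (path_space T - {\<lambda>_. 0})" unfolding J1_open_def
  proof (intro conjI ballI allI impI)
    fix f :: "real^'l \<Rightarrow> real^'d" and fs
    assume f: "f \<in> path_space T - {\<lambda>_. 0}" and fs: "\<forall>n. fs n \<in> path_space UNIV" and J: "J1_converges nrm fs f"
    have "f \<noteq> (\<lambda>_. 0)" using f by blast
    then obtain t where "f t \<noteq> 0" unfolding fun_eq_iff by blast
    then have "amp f t \<noteq> 0" by (simp only: amp_eq_0 simp_thms)
    then have pos: "nrm (f t) > 0" using amp_nonneg[of f t] by (simp add: amp_def)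
    obtain \<tau> :: "nat \<Rightarrow> real^'l \<Rightarrow> real^'l" where "\<And>n. surj (\<tau> n)"
      "\<And>e. e > 0 \<Longrightarrow> \<forall>\<^sub>F n in sequentially. \<forall>u. norm (\<tau> n u - u) < e"
      and \<tau>: "\<And>e R. e > 0 \<Longrightarrow> \<forall>\<^sub>F n in sequentially. \<forall>u\<in>cube (- R) R. nrm (fs n (\<tau> n u) - f u) < e"
      using J1_convergesE[OF J] by blast
    have t: "t \<in> cube (- norm t) (norm t)"
      unfolding mem_cube
    proof
      fix i show "- norm t \<le> t $ i \<and> t $ i \<le> norm t" using component_le_norm_cart[of t i] by linarith
    qed
    from \<tau>[OF pos, of "norm t"] show "\<forall>\<^sub>F n in sequentially. fs n \<in> path_space T - {\<lambda>_. 0}"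
    proof eventually_elim
      case (elim n)
      then have "nrm (fs n (\<tau> n t) - f t) < nrm (f t)" using t by blast
      then have "fs n (\<tau> n t) \<noteq> 0" using is_norm_minus[OF nrm, of "f t"] by (cases "fs n (\<tau> n t) = 0") simp_all
      then have "fs n \<noteq> (\<lambda>_. 0)" by (rule contrapos_nn) (simp only:)
      moreover have "fs n \<in> path_space T" using fs unfolding True by (rule spec)
      ultimately show ?case by blast
    qed
  qed (use True in auto)
  then show ?thesis using True by (simp add: path_topology_def openin_J1_topology)
next
  case False
  have "openin (top_of_set (path_space T)) {f \<in> path_space T. amp f t \<noteq> 0}" for t
  proof -
    have "openin (top_of_set (path_space T)) (path_space T \<inter> (\<lambda>f. amp f t) -` (- {0}))"
      by (rule continuous_openin_preimage_gen[OF lattice_amp_continuous]) (simp add: open_Compl)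
    moreover have "path_space T \<inter> (\<lambda>f. amp f t) -` (- {0}) = {f \<in> path_space T. amp f t \<noteq> 0}" by auto
    ultimately show ?thesis by (simp only:)
  qed
  then have "openin (top_of_set (path_space T)) (\<Union>t. {f \<in> path_space T. amp f t \<noteq> 0})"
    by (intro openin_Union) auto
  moreover have "(\<Union>t. {f \<in> path_space T. amp f t \<noteq> 0}) = path_space T - {\<lambda>_. 0}"
    unfolding amp_eq_0 by auto
  ultimately show ?thesis using False by (simp add: path_topology_def)
qed

lemma punctured_embedding: "(\<lambda>f. f) \<in> borel_of (punctured_topology nrm T) \<rightarrow>\<^sub>M paths"
  unfolding punctured_topology_def
  by (intro continuous_map_borel_of continuous_map_from_subtopology) (rule continuous_map_id[unfolded id_def])

lemma punctured_continuous:
  "continuous_map (path_topology nrm T) Y F \<Longrightarrow> continuous_map (punctured_topology nrm T) Y F"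
  unfolding punctured_topology_def by (rule continuous_map_from_subtopology)

section \<open>Paths with a high peak form a bounded set\<close>

lemma peak_high:
  assumes "peak v > c" "c \<ge> 0"
  obtains t where "norm t < real CARD('l) + 2" "v t > c" "bump t > c"
proof -
  have "\<exists>t. min (bump t) (v t) > c"
  proof (rule ccontr)
    assume "\<nexists>t. min (bump t) (v t) > c"
    then have "peak v \<le> c" by (intro peak_least) (meson not_less)
    then show False using assms(1) by simp
  qed
  then obtain t where t: "bump t > c" "v t > c" by (meson min_less_iff_conj)
  then have "norm t < real CARD('l) + 2" using assms(2) unfolding bump_def by linarith
  then show ?thesis using t that by blast
qed

text \<open>
  A path with a high peak exceeds a fixed level inside the support of the bump, which lies in a fixed cube.
\<close>

lemma peak_bounded_sets:
  assumes A: "A \<subseteq> path_space T - {\<lambda>_. 0}" and p: "\<And>f. f \<in> A \<Longrightarrow> peak (amp f) \<ge> 1 / 2"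
  shows "A \<in> bounded_sets nrm T"
proof -
  define L where "L = real CARD('l) + 2"
  have "(SUP t \<in> cbox (\<chi> i. - L) (\<chi> i. (\<chi> i. - L) $ i + 2 * L) \<inter> T. ennreal (nrm (f t))) > ennreal (1 / 4)"
    if "f \<in> A" for f
  proof -
    have "peak (amp f) > 1 / 4" using p[OF that] by simp
    then obtain t where t: "norm t < real CARD('l) + 2" "amp f t > 1 / 4" "bump t > 1 / 4"
      by (rule peak_high[where v = "amp f"]) simp
    have "f \<in> path_space T" using A that by blast
    then have "t \<in> T" using t(2) amp_off[of f t] by (cases "t \<in> T") simp_all
    moreover have "\<bar>t $ i\<bar> \<le> L" for i using t(1) component_le_norm_cart[of t i] unfolding L_def by linarith
    then have "t \<in> cbox (\<chi> i. - L) (\<chi> i. (\<chi> i. - L) $ i + 2 * L)"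
      unfolding mem_box_cart vec_lambda_beta abs_le_iff by (smt (verit))
    moreover have "ennreal (1 / 4) < ennreal (nrm (f t))" using t(2) by (simp add: amp_def ennreal_less_iff)
    ultimately show ?thesis unfolding less_SUP_iff by blast
  qed
  moreover have "2 * L > 0" by (simp add: L_def)
  ultimately show ?thesis using A unfolding bounded_sets_def mem_Collect_eq
    by (intro conjI exI[of _ "\<chi> i. - L"] exI[of _ "2 * L"] exI[of _ "1 / 4"]) simp_all
qed

end

section \<open>Vague convergence of the rescaled process\<close>

locale rv_setting = path_setting nrm T
  for nrm :: "real^'d \<Rightarrow> real" and T :: "(real^'l) set" +
  fixes M :: "'w measure" and X :: "'w \<Rightarrow> real^'l \<Rightarrow> real^'d"
    and \<nu> :: "(real^'l \<Rightarrow> real^'d) measure" and a :: "nat \<Rightarrow> real"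
  assumes rv: "regularly_varying nrm T M X a \<nu>"
begin

lemma prob_M: "prob_space M" and X_measurable: "X \<in> M \<rightarrow>\<^sub>M paths"
  using rv by (simp_all add: regularly_varying_def path_random_element_def)

sublocale prob_space M by (rule prob_M)

lemma X_path: "\<omega> \<in> space M \<Longrightarrow> X \<omega> \<in> path_space T"
  using measurable_space[OF X_measurable] by (simp add: space_paths)

lemma sets_nu: "sets \<nu> = sets (borel_of (punctured_topology nrm T))"
  using rv by (simp add: regularly_varying_def)

lemma space_nu: "space \<nu> = path_space T - {\<lambda>_. 0}"
  using sets_eq_imp_space_eq[OF sets_nu] by (simp add: space_borel_of topspace_punctured_topology)

lemma nu_embedding: "(\<lambda>f. f) \<in> \<nu> \<rightarrow>\<^sub>M paths"
  using punctured_embedding by (simp add: measurable_cong_sets[OF sets_nu refl])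

lemma nu_measurable: "F \<in> borel_measurable paths \<Longrightarrow> F \<in> borel_measurable \<nu>"
  by (rule measurable_compose[OF nu_embedding])

lemma nu_bounded:
  assumes "A \<in> sets \<nu>" "\<And>f. f \<in> A \<Longrightarrow> peak (amp f) \<ge> 1 / 2"
  shows "emeasure \<nu> A < \<infinity>"
proof -
  have "A \<subseteq> path_space T - {\<lambda>_. 0}" using sets.sets_into_space[OF assms(1)] by (simp add: space_nu)
  then have "A \<in> bounded_sets nrm T" using assms(2) by (rule peak_bounded_sets)
  then show ?thesis using rv assms(1) unfolding regularly_varying_def locally_finite_def by blast
qed

definition Xs :: "nat \<Rightarrow> 'w \<Rightarrow> real^'l \<Rightarrow> real^'d" where
  "Xs n \<omega> t = inverse (a n) *\<^sub>R X \<omega> t"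

lemma Xs_measurable: "Xs n \<in> M \<rightarrow>\<^sub>M paths"
  using measurable_compose[OF X_measurable scaleR_measurable[of "inverse (a n)"]]
  unfolding Xs_def[abs_def] .

lemma Xs_path: "\<omega> \<in> space M \<Longrightarrow> Xs n \<omega> \<in> path_space T"
  using measurable_space[OF Xs_measurable] by (simp add: space_paths)

lemma nn_integral_scaled_law:
  fixes h :: "(real^'l \<Rightarrow> real^'d) \<Rightarrow> real"
  assumes [measurable]: "h \<in> borel_measurable paths" and h0: "h (\<lambda>_. 0) = 0"
  shows "(\<integral>\<^sup>+f. ennreal (h f) \<partial>scaled_law nrm T M X a n) = of_nat n * (\<integral>\<^sup>+\<omega>. ennreal (h (Xs n \<omega>)) \<partial>M)"
proof -
  let ?A = "path_space T - {\<lambda>_. 0}"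
  let ?D = "distr M paths (Xs n)"
  have A: "?A \<in> sets paths" using nonzero_paths_open by (simp add: sets_borel_of sigma_sets.Basic)
  have A': "?A \<inter> space ?D \<in> sets ?D" using A by (simp add: space_paths Int_absorb2 Diff_subset)
  have hm: "(\<lambda>f. ennreal (h f)) \<in> borel_measurable (restrict_space ?D ?A)"
    by (rule measurable_restrict_space1) measurable
  have "(\<integral>\<^sup>+f. ennreal (h f) \<partial>scaled_law nrm T M X a n)
     = of_nat n * (\<integral>\<^sup>+f. ennreal (h f) \<partial>restrict_space ?D ?A)"
  proof -
    have "scaled_law nrm T M X a n = scale_measure (of_nat n) (restrict_space ?D ?A)"
      by (simp only: scaled_law_def Xs_def[abs_def])
    then show ?thesis using nn_integral_scale_measure[OF hm, of "of_nat n"] by (simp only:)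
  qed
  also have "(\<integral>\<^sup>+f. ennreal (h f) \<partial>restrict_space ?D ?A) = (\<integral>\<^sup>+f. ennreal (h f) * indicator ?A f \<partial>?D)"
    by (rule nn_integral_restrict_space[OF A'])
  also have "\<dots> = (\<integral>\<^sup>+f. ennreal (h f) \<partial>?D)"
    by (rule nn_integral_cong) (auto simp: h0 space_paths indicator_def)
  also have "\<dots> = (\<integral>\<^sup>+\<omega>. ennreal (h (Xs n \<omega>)) \<partial>M)"
    by (rule nn_integral_distr[OF Xs_measurable]) measurable
  finally show ?thesis .
qed

text \<open>
  Vague convergence in the form used throughout. A functional that vanishes on paths with a low peak has bounded support,
  because the set of paths with a high peak is closed. The value at the zero path is \<open>0\<close>, so removing that path from the
  space changes nothing.
\<close>

lemma vague_limit:
  assumes h: "continuous_map (path_topology nrm T) euclideanreal h"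
    and b: "\<And>f. 0 \<le> h f" "\<And>f. h f \<le> B"
    and p: "\<And>f. f \<in> path_space T \<Longrightarrow> h f \<noteq> 0 \<Longrightarrow> peak (amp f) \<ge> 1 / 2"
  shows "(\<lambda>n. of_nat n * (\<integral>\<^sup>+\<omega>. ennreal (h (Xs n \<omega>)) \<partial>M)) \<longlonglongrightarrow> (\<integral>\<^sup>+f. ennreal (h f) \<partial>\<nu>)"
proof -
  let ?A = "path_space T - {\<lambda>_. 0}"
  have hm[measurable]: "h \<in> borel_measurable paths" using h by (rule continuous_map_real_borel)
  have h\<nu>[measurable]: "h \<in> borel_measurable \<nu>" by (rule nu_measurable[OF hm])
  have z: "(\<lambda>_. 0) \<in> path_space T" by (auto simp: path_space_def cadlag_def intro: tendsto_const)
  have "peak (amp (\<lambda>_. 0)) \<le> 0"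
    by (rule peak_least) (simp add: amp_def is_norm_zero[OF nrm])
  then have h0: "h (\<lambda>_. 0) = 0" using p[OF z] by (cases "h (\<lambda>_. 0) = 0") simp_all
  have "B \<ge> 0" using b[of undefined] by linarith
  let ?P = "{f \<in> ?A. peak (amp f) \<ge> 1 / 2}"
  have P: "closedin (punctured_topology nrm T) ?P"
    using closedin_continuous_map_preimage[OF punctured_continuous[OF peak_continuous], of "{1/2..}"]
    by (simp add: topspace_punctured_topology)
  have P\<nu>: "?P \<in> sets \<nu>"
  proof -
    have "(\<lambda>f. peak (amp f)) \<in> borel_measurable \<nu>"
      by (intro nu_measurable continuous_map_real_borel peak_continuous)
    then have "{f \<in> space \<nu>. 1 / 2 \<le> peak (amp f)} \<in> sets \<nu>" by measurable
    then show ?thesis by (simp add: space_nu)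
  qed
  have fin: "(\<integral>\<^sup>+f. ennreal (h f) \<partial>\<nu>) < \<infinity>"
  proof -
    have "(\<integral>\<^sup>+f. ennreal (h f) \<partial>\<nu>) \<le> (\<integral>\<^sup>+f. ennreal B * indicator ?P f \<partial>\<nu>)"
    proof (rule nn_integral_mono)
      fix f assume "f \<in> space \<nu>"
      then show "ennreal (h f) \<le> ennreal B * indicator ?P f"
        using p[of f] b[of f] by (cases "h f = 0") (auto simp: space_nu intro: ennreal_leI)
    qed
    also have "\<dots> = ennreal B * emeasure \<nu> ?P" by (rule nn_integral_cmult_indicator[OF P\<nu>])
    also have "\<dots> < \<infinity>" using nu_bounded[OF P\<nu>] by (simp add: ennreal_mult_less_top)
    finally show ?thesis .
  qed
  have supp: "punctured_topology nrm T closure_of {f \<in> ?A. h f \<noteq> 0} \<in> bounded_sets nrm T"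
  proof (rule peak_bounded_sets)
    have "punctured_topology nrm T closure_of {f \<in> ?A. h f \<noteq> 0} \<subseteq> ?P"
      using P p by (intro closure_of_minimal) auto
    then show "punctured_topology nrm T closure_of {f \<in> ?A. h f \<noteq> 0} \<subseteq> ?A"
      "\<And>f. f \<in> punctured_topology nrm T closure_of {f \<in> ?A. h f \<noteq> 0} \<Longrightarrow> peak (amp f) \<ge> 1 / 2" by auto
  qed
  have bd: "bounded (h ` ?A)"
    using b by (intro boundedI[of _ B]) auto
  have lim: "(\<lambda>n. \<integral>f. h f \<partial>scaled_law nrm T M X a n) \<longlonglongrightarrow> (\<integral>f. h f \<partial>\<nu>)"
  proof -
    have "vaguely_converges nrm T (scaled_law nrm T M X a) \<nu>" using rv by (simp add: regularly_varying_def)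
    from this[unfolded vaguely_converges_def, rule_format, OF punctured_continuous[OF h] bd supp]
    show ?thesis .
  qed
  have prelim: "(\<integral>\<^sup>+\<omega>. ennreal (h (Xs n \<omega>)) \<partial>M) < \<infinity>" for n
  proof -
    have "(\<integral>\<^sup>+\<omega>. ennreal (h (Xs n \<omega>)) \<partial>M) \<le> (\<integral>\<^sup>+\<omega>. ennreal B \<partial>M)"
      by (intro nn_integral_mono ennreal_leI b)
    also have "\<dots> < \<infinity>" by (simp add: emeasure_space_1)
    finally show ?thesis .
  qed
  have hs: "h \<in> borel_measurable (scaled_law nrm T M X a n)" for n
  proof -
    have "h \<in> borel_measurable (restrict_space (distr M paths (\<lambda>\<omega> t. inverse (a n) *\<^sub>R X \<omega> t)) ?A)"
      by (rule measurable_restrict_space1) measurable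
    then show ?thesis unfolding scaled_law_def by (simp add: measurable_def space_scale_measure)
  qed
  have e1: "ennreal (\<integral>f. h f \<partial>scaled_law nrm T M X a n) = of_nat n * (\<integral>\<^sup>+\<omega>. ennreal (h (Xs n \<omega>)) \<partial>M)" for n
  proof -
    have "of_nat n * (\<integral>\<^sup>+\<omega>. ennreal (h (Xs n \<omega>)) \<partial>M) < \<top>"
      using prelim[of n] by (simp add: ennreal_mult_less_top of_nat_less_top)
    then show ?thesis
      using integral_eq_nn_integral[OF hs, of n] b nn_integral_scaled_law[OF hm h0, of n] by simp
  qed
  have e2: "ennreal (\<integral>f. h f \<partial>\<nu>) = (\<integral>\<^sup>+f. ennreal (h f) \<partial>\<nu>)"
    using integral_eq_nn_integral[OF h\<nu>] b fin by simp
  show ?thesis using tendsto_ennrealI[OF lim] unfolding e1 e2 .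
qed

end

context path_setting begin

section \<open>Pathwise bounds\<close>

lemma nn_integral_window_shift:
  fixes \<phi> :: "real \<Rightarrow> ennreal"
  assumes t: "t \<in> T" and [measurable]: "v \<in> borel_measurable borel" "K \<in> sets borel" "\<phi> \<in> borel_measurable borel"
  shows "(\<integral>\<^sup>+s. indicator K s * \<phi> (v (s + t)) \<partial>lam) = (\<integral>\<^sup>+s. indicator ((\<lambda>s. s - t) -` K) s * \<phi> (v s) \<partial>lam)"
proof -
  have m: "(\<lambda>s. indicator K (s - t) * \<phi> (v s)) \<in> borel_measurable borel" by measurable
  have "(\<integral>\<^sup>+s. indicator K (s - t) * \<phi> (v s) \<partial>lam) = (\<integral>\<^sup>+s. indicator K (s + t - t) * \<phi> (v (s + t)) \<partial>lam)"
    by (rule nn_integral_lam_shift[OF t m, symmetric])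
  then show ?thesis by (simp add: indicator_vimage[unfolded comp_def])
qed

lemma W_shift:
  assumes "t \<in> T" "v \<in> borel_measurable borel" "K \<in> sets borel"
  shows "W i K (\<lambda>s. v (s + t)) = W i ((\<lambda>s. s - t) -` K) v"
  unfolding W_def
  by (rule nn_integral_window_shift[where \<phi> = "\<lambda>r. ennreal (ramp i r)", OF assms]) measurable

lemma occ_shift:
  assumes "t \<in> T" "v \<in> borel_measurable borel" "K \<in> sets borel"
  shows "occ u K (\<lambda>s. v (s + t)) = occ u ((\<lambda>s. s - t) -` K) v"
  unfolding occ_def
  by (rule nn_integral_window_shift[where \<phi> = "\<lambda>r. if r > u then 1 else 0", OF assms]) measurable

lemma W_mono: "K \<subseteq> K' \<Longrightarrow> W i K v \<le> W i K' v"
  unfolding W_def by (intro nn_integral_mono mult_right_mono) (auto simp: indicator_def)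

lemma occ_mono: "K \<subseteq> K' \<Longrightarrow> occ u K v \<le> occ u K' v"
  unfolding occ_def by (intro nn_integral_mono mult_right_mono) (auto simp: indicator_def)

lemma W_finite: assumes "bounded K" and [measurable]: "K \<in> sets borel" shows "W i K v < \<infinity>"
proof -
  have "W i K v \<le> (\<integral>\<^sup>+t. indicator K t \<partial>lam)" unfolding W_def
    by (intro nn_integral_mono) (auto simp: indicator_def ramp_bounds ennreal_le_1)
  also have "\<dots> = emeasure lam K" by (rule nn_integral_indicator) simp
  finally show ?thesis using lam_bounded[OF assms(1)] by (rule le_less_trans)
qed

lemma nn_integral_window_nonzero:
  assumes "(\<integral>\<^sup>+s. indicator K s * \<phi> s \<partial>lam) \<noteq> 0" shows "\<exists>t\<in>K. \<phi> t \<noteq> 0"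
proof (rule ccontr)
  assume "\<not> (\<exists>t\<in>K. \<phi> t \<noteq> 0)"
  then have "(\<integral>\<^sup>+s. indicator K s * \<phi> s \<partial>lam) = (\<integral>\<^sup>+s. 0 \<partial>lam)"
    by (intro nn_integral_cong) (auto simp: indicator_def)
  then show False using assms by simp
qed

lemma W_pos_obtain:
  assumes "W i K v \<noteq> 0" obtains t where "t \<in> K" "v t > 1"
proof -
  obtain t where "t \<in> K" "ennreal (ramp i (v t)) \<noteq> 0"
    using nn_integral_window_nonzero[OF assms[unfolded W_def]] by blast
  then show ?thesis using ramp_zero[of "v t" i] that by (cases "v t \<le> 1") auto
qed

lemma occ_pos_obtain:
  assumes "occ u K v \<noteq> 0" obtains t where "t \<in> K" "v t > u"
proof -
  obtain t where "t \<in> K" "(if v t > u then 1 else 0 :: ennreal) \<noteq> 0"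
    using nn_integral_window_nonzero[OF assms[unfolded occ_def]] by blast
  then show ?thesis using that by (auto split: if_splits)
qed

text \<open>
  Right continuity: an exceedance at one point persists on a set of positive measure.
\<close>

lemma occ_pos:
  assumes f: "f \<in> path_space T" and t: "t \<in> T" "amp f t > u" and \<delta>: "\<delta> > 0" "corner t \<delta> \<subseteq> K"
    and [measurable]: "K \<in> sets borel"
  shows "occ u K (amp f) > 0"
proof -
  have "amp f t - u > 0" using t(2) by simp
  then obtain \<epsilon> where \<epsilon>: "\<epsilon> > 0" "\<And>s. s \<in> T \<Longrightarrow> s \<in> corner t \<epsilon> \<Longrightarrow> \<bar>amp f s - amp f t\<bar> < amp f t - u"
    using amp_right_continuous[OF f t(1)] by blast
  define d where "d = min \<epsilon> \<delta>"
  have d: "d > 0" "corner t d \<subseteq> corner t \<epsilon>" "corner t d \<subseteq> K"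
    using \<epsilon>(1) \<delta> corner_mono[of d \<epsilon> t] corner_mono[of d \<delta> t] by (auto simp: d_def)
  have "0 < emeasure lam (corner t d)" by (rule lam_corner_pos[OF t(1) d(1)])
  also have "\<dots> = (\<integral>\<^sup>+s. indicator (corner t d) s \<partial>lam)" by (rule nn_integral_indicator[symmetric]) simp
  also have "\<dots> \<le> occ u K (amp f)" unfolding occ_def
  proof (rule nn_integral_mono_AE)
    show "AE s in lam. indicator (corner t d) s \<le> indicator K s * (if amp f s > u then 1 else 0 :: ennreal)"
      using AE_lam_T
    proof eventually_elim
      case (elim s)
      show ?case
      proof (cases "s \<in> corner t d")
        case True
        then have "\<bar>amp f s - amp f t\<bar> < amp f t - u" using \<epsilon>(2)[OF elim] d(2) by blast
        then have "amp f s > u" by linarith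
        moreover have "s \<in> K" using True d(3) by blast
        ultimately show ?thesis using True by simp
      qed simp
    qed
  qed
  finally show ?thesis .
qed

text \<open>
  The thresholds, the cells and the windows of the argument. The number \<open>reach\<close> is a radius beyond which the bump vanishes.
  The function \<open>thin\<close> indicates an exceedance in the unit cell at the origin that is accompanied by
  little occupation around it, and \<open>ratio\<close> is the capped quotient whose expectation replaces \<open>\<theta>\<^sub>Y\<close> before the limit.
\<close>

definition ball_cube :: "nat \<Rightarrow> (real^'l) set" where "ball_cube j = cube (- real j) (real j)"

definition reach :: nat where "reach = CARD('l) + 2"

definition unit_cell :: "(real^'l) set" where "unit_cell = {t. \<forall>i. 0 \<le> t $ i \<and> t $ i < 1}"

definition level :: "nat \<Rightarrow> real" where "level i = 1 + 1 / (real i + 1)"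

definition thin :: "nat \<Rightarrow> real \<Rightarrow> (real^'l \<Rightarrow> real) \<Rightarrow> ennreal" where
  "thin i \<eta> v = (if occ (level i) unit_cell v > 0 \<and> W i (ball_cube reach) v \<le> ennreal \<eta> then 1 else 0)"

definition ratio :: "nat \<Rightarrow> real \<Rightarrow> nat \<Rightarrow> (real^'l \<Rightarrow> real) \<Rightarrow> ennreal" where
  "ratio i \<eta> j v = ennreal (ramp i (v 0)) / max (ennreal \<eta>) (W i (ball_cube j) v)"

definition cells :: "nat \<Rightarrow> (real^'l) set" where
  "cells n = (\<lambda>z. \<chi> i. real (z i)) ` (PiE UNIV (\<lambda>_. {..n}))"

definition window :: "nat \<Rightarrow> (real^'l) set" where
  "window n = cube (- real reach) (real n + real reach)"

lemma ball_cube_borel[measurable]: "ball_cube j \<in> sets borel" and bounded_ball_cube: "bounded (ball_cube j)"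
  and window_borel[measurable]: "window n \<in> sets borel" and bounded_window: "bounded (window n)"
  by (simp_all add: ball_cube_def window_def bounded_cube)

lemma unit_cell_borel[measurable]: "unit_cell \<in> sets borel"
proof -
  have [measurable]: "(\<lambda>t::real^'l. t $ i) \<in> borel_measurable borel" for i
    by (intro borel_measurable_continuous_onI continuous_intros)
  have "{t \<in> space borel. \<forall>i. 0 \<le> t $ i \<and> t $ i < 1} \<in> sets (borel :: (real^'l) measure)" by measurable
  then show ?thesis by (simp add: unit_cell_def)
qed

lemma finite_cells: "finite (cells n)" and card_cells: "card (cells n) \<le> (n + 1) ^ CARD('l)"
proof -
  have fin: "finite (PiE (UNIV::'l set) (\<lambda>_. {..n}))" by (intro finite_PiE) auto
  then show "finite (cells n)" unfolding cells_def by (rule finite_imageI)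
  have "card (cells n) \<le> card (PiE (UNIV::'l set) (\<lambda>_. {..n}))"
    unfolding cells_def by (rule card_image_le[OF fin])
  also have "\<dots> = (n + 1) ^ CARD('l)" by (simp add: card_PiE)
  finally show "card (cells n) \<le> (n + 1) ^ CARD('l)" .
qed

lemma cells_T: "z \<in> cells n \<Longrightarrow> z \<in> T"
  using T_cases by (auto simp: cells_def int_lattice_def)

lemma thin_measurable:
  assumes "measurable_process \<Omega> \<xi>" shows "(\<lambda>\<omega>. thin i \<eta> (\<xi> \<omega>)) \<in> borel_measurable \<Omega>"
proof -
  have [measurable]: "(\<lambda>\<omega>. occ (level i) unit_cell (\<xi> \<omega>)) \<in> borel_measurable \<Omega>"
    "(\<lambda>\<omega>. W i (ball_cube reach) (\<xi> \<omega>)) \<in> borel_measurable \<Omega>"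
    by (rule occ_measurable[OF assms unit_cell_borel], rule W_measurable[OF assms ball_cube_borel])
  show ?thesis unfolding thin_def by measurable
qed

lemma ratio_measurable:
  assumes "measurable_process \<Omega> \<xi>" shows "(\<lambda>\<omega>. ratio i \<eta> j (\<xi> \<omega>)) \<in> borel_measurable \<Omega>"
proof -
  have [measurable]: "(\<lambda>\<omega>. \<xi> \<omega> 0) \<in> borel_measurable \<Omega>"
    "(\<lambda>\<omega>. W i (ball_cube j) (\<xi> \<omega>)) \<in> borel_measurable \<Omega>"
    by (rule measurable_process_section[OF assms], rule W_measurable[OF assms ball_cube_borel])
  show ?thesis unfolding ratio_def by measurable
qed

text \<open>
  Let the exceedance occur in the cell at \<open>z\<close>, the point \<open>t\<close> rounded down. Either the occupation around this cell is
  at most \<open>\<eta>\<close>, and the term of the sum at \<open>z\<close> is \<open>1\<close>; or it exceeds \<open>\<eta>\<close>, hence so does the occupation of the window, the cap is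
  not active and the quotient is \<open>1\<close>.
\<close>

lemma pathwise_bound:
  assumes f: "f \<in> path_space T" and \<eta>: "\<eta> > 0"
    and t: "t \<in> T" "t \<in> cube 0 (real n)" "amp f t > level i"
  shows "1 \<le> (\<Sum>z\<in>cells n. thin i \<eta> (\<lambda>s. amp f (s + z))) +
     W i (window n) (amp f) / max (ennreal \<eta>) (W i (window n) (amp f))"
proof -
  note am = amp_measurable[OF f]
  define z :: "real^'l" where "z = (\<chi> i. of_int \<lfloor>t $ i\<rfloor>)"
  have fl: "0 \<le> \<lfloor>t $ i\<rfloor> \<and> \<lfloor>t $ i\<rfloor> \<le> int n" for i
  proof -
    have "0 \<le> t $ i \<and> t $ i \<le> real n" using t(2) unfolding mem_cube by blast
    then show ?thesis by linarith
  qed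
  have z: "z \<in> cells n"
  proof -
    have "(\<lambda>i. nat \<lfloor>t $ i\<rfloor>) \<in> PiE UNIV (\<lambda>_. {..n})" using fl by (auto simp: nat_le_iff)
    moreover have "z = (\<chi> i. real (nat \<lfloor>t $ i\<rfloor>))"
      unfolding z_def vec_eq_iff vec_lambda_beta using fl by simp
    ultimately show ?thesis unfolding cells_def by (rule rev_image_eqI[of "\<lambda>i. nat \<lfloor>t $ i\<rfloor>"])
  qed
  then have zT: "z \<in> T" by (rule cells_T)
  \<comment> \<open>half the distance to the excluded faces of the half-open cell, so that a small cube at \<open>t\<close> stays inside\<close>
  define \<delta> where "\<delta> = Min (range (\<lambda>i. z $ i + 1 - t $ i)) / 2"
  have zt: "z $ i \<le> t $ i \<and> t $ i < z $ i + 1" for i unfolding z_def vec_lambda_beta by linarith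
  have \<delta>: "\<delta> > 0" unfolding \<delta>_def using zt by (intro half_gt_zero Min_gr_iff[THEN iffD2]) (auto simp: algebra_simps)
  have \<delta>_less: "\<delta> < z $ i + 1 - t $ i" for i
  proof -
    have "2 * \<delta> \<le> z $ i + 1 - t $ i" unfolding \<delta>_def by (simp add: Min_le)
    then show ?thesis using \<delta> by linarith
  qed
  have "corner t \<delta> \<subseteq> (\<lambda>s. s - z) -` unit_cell"
  proof
    fix s assume s: "s \<in> corner t \<delta>"
    have "0 \<le> (s - z) $ i \<and> (s - z) $ i < 1" for i
    proof -
      have "t $ i \<le> s $ i \<and> s $ i \<le> t $ i + \<delta>" using s unfolding mem_corner by blast
      then show ?thesis using zt[of i] \<delta>_less[of i] by (simp only: vector_minus_component) linarith
    qed
    then show "s \<in> (\<lambda>s. s - z) -` unit_cell" unfolding unit_cell_def by blast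
  qed
  then have "occ (level i) ((\<lambda>s. s - z) -` unit_cell) (amp f) > 0"
    by (rule occ_pos[OF f t(1,3) \<delta>]) (rule measurable_sets_borel[OF _ unit_cell_borel], measurable)
  then have occ: "occ (level i) unit_cell (\<lambda>s. amp f (s + z)) > 0"
    by (simp add: occ_shift[OF zT am unit_cell_borel])
  show ?thesis
  proof (cases "W i (ball_cube reach) (\<lambda>s. amp f (s + z)) \<le> ennreal \<eta>")
    case True
    then have "1 = thin i \<eta> (\<lambda>s. amp f (s + z))" using occ by (simp add: thin_def)
    also have "\<dots> \<le> (\<Sum>z\<in>cells n. thin i \<eta> (\<lambda>s. amp f (s + z)))"
      by (rule member_le_sum[OF z _ finite_cells]) simp
    finally show ?thesis by (rule order_trans) simp
  next
    case False
    have sub: "(\<lambda>s. s - z) -` ball_cube reach \<subseteq> window n"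
    proof
      fix s assume "s \<in> (\<lambda>s. s - z) -` ball_cube reach"
      then have "- real reach \<le> (s - z) $ i \<and> (s - z) $ i \<le> real reach" for i
        unfolding ball_cube_def vimage_def mem_Collect_eq mem_cube by blast
      moreover have "0 \<le> z $ i \<and> z $ i \<le> real n" for i using fl[of i] unfolding z_def vec_lambda_beta by linarith
      ultimately have "- real reach \<le> s $ i \<and> s $ i \<le> real n + real reach" for i
        unfolding vector_minus_component by (smt (verit))
      then show "s \<in> window n" unfolding window_def mem_cube by blast
    qed
    let ?W = "W i (window n) (amp f)"
    have "ennreal \<eta> < W i ((\<lambda>s. s - z) -` ball_cube reach) (amp f)"
      using False by (simp add: W_shift[OF zT am ball_cube_borel] not_le)
    also have "\<dots> \<le> ?W" by (rule W_mono[OF sub])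
    finally have gt: "ennreal \<eta> < ?W" .
    then have "?W / max (ennreal \<eta>) ?W = ?W / ?W" by (simp add: max_absorb2 less_imp_le)
    also have "\<dots> = 1" using gt W_finite[OF bounded_window window_borel, of i n "amp f"]
      by (intro ennreal_divide_self) auto
    finally show ?thesis by simp
  qed
qed

section \<open>Continuous majorants\<close>

definition Wr :: "nat \<Rightarrow> (real^'l) set \<Rightarrow> (real^'l \<Rightarrow> real^'d) \<Rightarrow> real" where
  "Wr i K f = (\<integral>t. indicator K t * ramp i (amp f t) \<partial>lam)"

lemma Wr_continuous:
  assumes "K \<in> sets borel" "bounded K"
  shows "continuous_map (path_topology nrm T) euclideanreal (Wr i K)"
  unfolding Wr_def[abs_def]
  by (rule integral_functional_continuous[OF ramp_continuous _ assms, of i 1]) (use ramp_bounds in \<open>simp add: abs_le_iff\<close>)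

lemma Wr_nonneg: "0 \<le> Wr i K f"
  unfolding Wr_def by (intro integral_nonneg_AE) (simp add: ramp_bounds)

lemma W_eq_Wr:
  assumes f: "f \<in> path_space T" and K[measurable]: "K \<in> sets borel" and b: "bounded K"
  shows "W i K (amp f) = ennreal (Wr i K f)"
proof -
  note [measurable] = amp_measurable[OF f]
  have "W i K (amp f) = (\<integral>\<^sup>+t. ennreal (indicator K t * ramp i (amp f t)) \<partial>lam)"
    unfolding W_def by (intro nn_integral_cong) (simp add: indicator_def)
  moreover have "Wr i K f = enn2real (\<integral>\<^sup>+t. ennreal (indicator K t * ramp i (amp f t)) \<partial>lam)"
    unfolding Wr_def by (rule integral_eq_nn_integral) (auto simp: ramp_bounds)
  ultimately show ?thesis using W_finite[OF b K, of i "amp f"] by simp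
qed

text \<open>
  A continuous majorant of \<open>thin\<close>: the first factor replaces the exceedance of \<open>level i\<close>, the second one is \<open>1\<close> if the occupation is at
  most \<open>\<eta>\<close> and \<open>0\<close> if it is at least \<open>2\<eta>\<close>.
\<close>

definition thin_bound :: "nat \<Rightarrow> real \<Rightarrow> (real^'l \<Rightarrow> real^'d) \<Rightarrow> real" where
  "thin_bound i \<eta> f = ramp i (peak (amp f)) * max 0 (min 1 (2 - Wr i (ball_cube reach) f / \<eta>))"

lemma norm_unit: "(\<And>i. \<bar>t $ i\<bar> \<le> 1) \<Longrightarrow> norm (t :: real^'l) \<le> real CARD('l)"
proof -
  assume "\<And>i. \<bar>t $ i\<bar> \<le> 1"
  then have "(\<Sum>i\<in>UNIV. \<bar>t $ i\<bar>) \<le> (\<Sum>i\<in>(UNIV::'l set). 1)" by (intro sum_mono)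
  with norm_le_l1_cart[of t] show ?thesis by simp
qed

lemma peak_ge:
  assumes "\<And>i. \<bar>t $ i\<bar> \<le> 1" "v t \<ge> c" "c \<le> 2" shows "peak v \<ge> c"
proof -
  have "bump t = 2" using norm_unit[OF assms(1)] by (simp add: bump_def)
  then show ?thesis using peak_upper[of t v] assms by linarith
qed

lemma thin_le:
  assumes f: "f \<in> path_space T" and \<eta>: "\<eta> > 0" shows "thin i \<eta> (amp f) \<le> ennreal (thin_bound i \<eta> f)"
proof (cases "occ (level i) unit_cell (amp f) > 0 \<and> W i (ball_cube reach) (amp f) \<le> ennreal \<eta>")
  case True
  then obtain t where t: "t \<in> unit_cell" "amp f t > level i" using occ_pos_obtain by (metis less_irrefl)
  have le: "level i \<le> 2" by (simp add: level_def)
  have "peak (amp f) \<ge> level i"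
    by (rule peak_ge[of t]) (use t le in \<open>auto simp: unit_cell_def less_imp_le abs_le_iff intro: order_trans[of _ 0]\<close>)
  then have "ramp i (peak (amp f)) = 1" by (intro ramp_one) (simp add: level_def)
  moreover have "Wr i (ball_cube reach) f \<le> \<eta>"
    using True W_eq_Wr[OF f ball_cube_borel bounded_ball_cube, of i reach] \<eta> by (simp add: ennreal_le_iff)
  then have "max 0 (min 1 (2 - Wr i (ball_cube reach) f / \<eta>)) = 1" using \<eta> by (simp add: field_simps)
  ultimately show ?thesis by (simp add: thin_def thin_bound_def)
qed (auto simp: thin_def)

lemma thin_bound_continuous:
  assumes "\<eta> > 0"
  shows "continuous_map (path_topology nrm T) euclideanreal (thin_bound i \<eta>)"
proof -
  have "continuous_map (path_topology nrm T) euclideanreal (ramp i \<circ> (\<lambda>f. peak (amp f)))"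
    by (rule continuous_map_compose[OF peak_continuous]) (simp add: ramp_continuous)
  then show ?thesis unfolding thin_bound_def[abs_def] comp_def
    using assms by (intro continuous_map_real_mult continuous_map_real_max continuous_map_real_min
      continuous_map_diff continuous_map_real_divide Wr_continuous ball_cube_borel bounded_ball_cube) (auto intro: continuous_map_const[THEN iffD2])
qed

lemma thin_bound_bounds: "0 \<le> thin_bound i \<eta> f" "thin_bound i \<eta> f \<le> 1"
  unfolding thin_bound_def using ramp_bounds[of i "peak (amp f)"]
  by (auto intro!: mult_nonneg_nonneg mult_le_one)

lemma thin_bound_nonzero:
  assumes "thin_bound i \<eta> f \<noteq> 0" shows "peak (amp f) > 1"
  using assms ramp_zero[of "peak (amp f)" i] by (cases "peak (amp f) \<le> 1") (auto simp: thin_bound_def)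

text \<open>
  The quotient \<open>ratio\<close> with its numerator averaged over \<open>[0,1/(k+1)]\<^sup>l\<close>, which makes it a continuous functional.
\<close>

definition avg_ratio :: "nat \<Rightarrow> real \<Rightarrow> nat \<Rightarrow> nat \<Rightarrow> (real^'l \<Rightarrow> real^'d) \<Rightarrow> real" where
  "avg_ratio i \<eta> j k f = Wr i (corner 0 (1 / real (Suc k))) f / measure lam (corner 0 (1 / real (Suc k)))
      / max \<eta> (Wr i (ball_cube j) f)"

lemma lam_corner_measure: "\<epsilon> > 0 \<Longrightarrow> measure lam (corner 0 \<epsilon>) > 0"
  and emeasure_corner: "emeasure lam (corner 0 \<epsilon>) = ennreal (measure lam (corner 0 \<epsilon>))"
proof -
  show e: "emeasure lam (corner 0 \<epsilon>) = ennreal (measure lam (corner 0 \<epsilon>))"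
    using lam_corner_finite[of 0 \<epsilon>] by (intro emeasure_eq_ennreal_measure) auto
  show "\<epsilon> > 0 \<Longrightarrow> measure lam (corner 0 \<epsilon>) > 0"
    using lam_corner_pos[OF T_zero, of \<epsilon>] unfolding e by simp
qed

lemma avg_ratio_continuous:
  assumes "\<eta> > 0"
  shows "continuous_map (path_topology nrm T) euclideanreal (avg_ratio i \<eta> j k)"
proof -
  have "measure lam (corner 0 (1 / real (Suc k))) \<noteq> 0" using lam_corner_measure[of "1 / real (Suc k)"] by simp
  moreover have "max \<eta> x \<noteq> 0" for x using assms by (simp add: max_def)
  ultimately show ?thesis unfolding avg_ratio_def[abs_def]
    by (intro continuous_map_real_divide continuous_map_real_max Wr_continuous ball_cube_borel
      bounded_ball_cube corner_borel bounded_corner) (auto intro: continuous_map_const[THEN iffD2])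
qed

lemma max_ennreal: "0 \<le> b \<Longrightarrow> max (ennreal a) (ennreal b) = ennreal (max a b)"
  by (cases "a \<le> b") (auto simp: max_def ennreal_leI ennreal_le_iff)

lemma ennreal_avg_ratio:
  assumes f: "f \<in> path_space T" and "\<eta> > 0"
  shows "ennreal (measure lam (corner 0 (1 / real (Suc k)))) * ennreal (avg_ratio i \<eta> j k f) =
    W i (corner 0 (1 / real (Suc k))) (amp f) / max (ennreal \<eta>) (W i (ball_cube j) (amp f))"
proof -
  let ?m = "measure lam (corner 0 (1 / real (Suc k)))"
  have m: "?m > 0" using lam_corner_measure by simp
  have mx: "max \<eta> (Wr i (ball_cube j) f) > 0" using assms(2) by simp
  have "W i (corner 0 (1 / real (Suc k))) (amp f) / max (ennreal \<eta>) (W i (ball_cube j) (amp f))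
    = ennreal (Wr i (corner 0 (1 / real (Suc k))) f) / ennreal (max \<eta> (Wr i (ball_cube j) f))"
    using assms(2) Wr_nonneg
    by (simp add: W_eq_Wr[OF f corner_borel bounded_corner] W_eq_Wr[OF f ball_cube_borel bounded_ball_cube] max_ennreal)
  also have "\<dots> = ennreal (Wr i (corner 0 (1 / real (Suc k))) f / max \<eta> (Wr i (ball_cube j) f))"
    by (rule divide_ennreal[OF Wr_nonneg mx])
  also have "\<dots> = ennreal (?m * avg_ratio i \<eta> j k f)" using m by (simp add: avg_ratio_def)
  also have "\<dots> = ennreal ?m * ennreal (avg_ratio i \<eta> j k f)" using m by (intro ennreal_mult') simp
  finally show ?thesis by simp
qed

lemma avg_ratio_bounds:
  assumes "\<eta> > 0" shows "0 \<le> avg_ratio i \<eta> j k f" "avg_ratio i \<eta> j k f \<le> 1 / \<eta>"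
proof -
  let ?C = "corner 0 (1 / real (Suc k))"
  let ?m = "measure lam ?C"
  have m: "?m > 0" using lam_corner_measure by simp
  show "0 \<le> avg_ratio i \<eta> j k f"
    unfolding avg_ratio_def using assms by (intro divide_nonneg_nonneg Wr_nonneg) (auto simp: le_max_iff_disj)
  have "Wr i ?C f \<le> ?m"
  proof -
    have "Wr i ?C f \<le> (\<integral>t. indicator ?C t \<partial>lam)" unfolding Wr_def
    proof (rule integral_mono')
      show "integrable lam (indicator ?C :: real^'l \<Rightarrow> real)"
        by (rule integrable_real_indicator) (simp_all add: emeasure_corner)
    qed (auto simp: indicator_def ramp_bounds)
    then show ?thesis by simp
  qed
  then have "Wr i ?C f / ?m \<le> 1" using m by simp
  then show "avg_ratio i \<eta> j k f \<le> 1 / \<eta>"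
    unfolding avg_ratio_def using assms(1) by (intro frac_le) auto
qed

lemma avg_ratio_nonzero:
  assumes f: "f \<in> path_space T" and "avg_ratio i \<eta> j k f \<noteq> 0" shows "peak (amp f) \<ge> 1"
proof -
  let ?C = "corner 0 (1 / real (Suc k))"
  have "Wr i ?C f \<noteq> 0" using assms(2) by (auto simp: avg_ratio_def)
  then have "W i ?C (amp f) \<noteq> 0" using Wr_nonneg[of i ?C f]
    by (simp add: W_eq_Wr[OF f corner_borel bounded_corner])
  then obtain t where t: "t \<in> ?C" "amp f t > 1" by (rule W_pos_obtain)
  have "\<bar>t $ i\<bar> \<le> 1" for i
  proof -
    have "0 \<le> t $ i \<and> t $ i \<le> 1 / real (Suc k)" using t(1) unfolding mem_corner by simp
    moreover have "1 / real (Suc k) \<le> 1" by simp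
    ultimately show ?thesis by linarith
  qed
  then show ?thesis by (rule peak_ge) (use t(2) in auto)
qed

end

lemma divide_left_mono_ennreal:
  assumes "b \<le> (c :: ennreal)" shows "a / c \<le> a / b"
proof -
  have "inverse c \<le> inverse b"
  proof (cases "b = 0 \<or> c = top")
    case False
    then have "c < top" "b < top" using assms by (auto simp: less_top[symmetric] top_unique)
    then obtain p q where p: "b = ennreal p" "0 \<le> p" and q: "c = ennreal q" "0 \<le> q"
      by (metis ennreal_cases less_irrefl)
    have "0 < p" "p \<le> q" using False assms p q by (auto simp: ennreal_le_iff less_le)
    then show ?thesis using p q by (simp add: inverse_ennreal ennreal_leI)
  qed auto
  then show ?thesis unfolding divide_ennreal_def by (rule mult_left_mono) simp
qed

section \<open>Expectations under stationarity\<close>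

locale stationary_rv_setting = rv_setting nrm T M X \<nu> a
  for nrm :: "real^'d \<Rightarrow> real" and T :: "(real^'l) set"
    and M :: "'w measure" and X :: "'w \<Rightarrow> real^'l \<Rightarrow> real^'d"
    and \<nu> :: "(real^'l \<Rightarrow> real^'d) measure" and a :: "nat \<Rightarrow> real" +
  assumes stationary: "stationary_process T M X"
begin

lemma Xs_process: "measurable_process M (\<lambda>\<omega>. amp (Xs m \<omega>))"
proof (rule amp_measurable_process)
  show "(\<lambda>\<omega>. amp (Xs m \<omega>) t) \<in> borel_measurable M" if "t \<in> T" for t
    by (rule measurable_compose[OF Xs_measurable amp_eval_measurable[OF that]])
qed (rule Xs_path)

lemma Xs_shift_process: "measurable_process M (\<lambda>\<omega> s. amp (Xs m \<omega>) (s + t))"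
  using measurable_process_affine[OF Xs_process, of 1 m t] by simp

text \<open>
  The hypothesis on \<open>\<Phi>\<close> asks that it be a random variable for every jointly measurable process; it is applied to
  \<open>reg\<close> on the product space.
\<close>

lemma stationary_Xs:
  fixes \<Phi> :: "(real^'l \<Rightarrow> real) \<Rightarrow> ennreal"
  assumes \<Phi>: "\<And>\<Omega> (\<xi> :: (real^'l \<Rightarrow> real) \<Rightarrow> real^'l \<Rightarrow> real). measurable_process \<Omega> \<xi> \<Longrightarrow> (\<lambda>\<omega>. \<Phi> (\<xi> \<omega>)) \<in> borel_measurable \<Omega>"
    and t: "t \<in> T"
  shows "(\<integral>\<^sup>+\<omega>. \<Phi> (\<lambda>s. amp (Xs m \<omega>) (s + t)) \<partial>M) = (\<integral>\<^sup>+\<omega>. \<Phi> (amp (Xs m \<omega>)) \<partial>M)"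
proof -
  define c where "c = \<bar>inverse (a m)\<bar>"
  have amp: "amp (Xs m \<omega>) s = c * amp (X \<omega>) s" for \<omega> s
    unfolding Xs_def[abs_def] c_def by (rule amp_scaleR)
  have "(\<lambda>v. \<Phi> (\<lambda>t. c * reg v t)) \<in> borel_measurable (PiM T (\<lambda>_. borel))"
    using \<Phi>[OF measurable_process_affine[OF reg_measurable_PiM, of c 0]] by simp
  from stationary_functional[OF prob_M X_path stationary t this]
  show ?thesis unfolding amp[abs_def] by simp
qed

definition mean_ratio :: "nat \<Rightarrow> real \<Rightarrow> nat \<Rightarrow> nat \<Rightarrow> ennreal" where
  "mean_ratio i \<eta> j m = (\<integral>\<^sup>+\<omega>. ratio i \<eta> j (amp (Xs m \<omega>)) \<partial>M)"

lemma mean_ratio_shift: "t \<in> T \<Longrightarrow> (\<integral>\<^sup>+\<omega>. ratio i \<eta> j (\<lambda>s. amp (Xs m \<omega>) (s + t)) \<partial>M) = mean_ratio i \<eta> j m"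
  unfolding mean_ratio_def by (rule stationary_Xs[where \<Phi> = "ratio i \<eta> j", OF ratio_measurable])

lemma thin_shift:
  "t \<in> T \<Longrightarrow> (\<integral>\<^sup>+\<omega>. thin i \<eta> (\<lambda>s. amp (Xs m \<omega>) (s + t)) \<partial>M) = (\<integral>\<^sup>+\<omega>. thin i \<eta> (amp (Xs m \<omega>)) \<partial>M)"
  by (rule stationary_Xs[where \<Phi> = "thin i \<eta>", OF thin_measurable])

definition mean_ramp :: "nat \<Rightarrow> nat \<Rightarrow> ennreal" where
  "mean_ramp i m = (\<integral>\<^sup>+\<omega>. ennreal (ramp i (amp (Xs m \<omega>) 0)) \<partial>M)"

lemma mean_ramp_shift:
  assumes "t \<in> T" shows "(\<integral>\<^sup>+\<omega>. ennreal (ramp i (amp (Xs m \<omega>) t)) \<partial>M) = mean_ramp i m"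
proof -
  have "(\<lambda>\<omega>. ennreal (ramp i (\<xi> \<omega> 0))) \<in> borel_measurable \<Omega>"
    if "measurable_process \<Omega> \<xi>" for \<Omega> and \<xi> :: "(real^'l \<Rightarrow> real) \<Rightarrow> real^'l \<Rightarrow> real"
    using measurable_process_section[OF that, of 0] by measurable
  then show ?thesis
    using stationary_Xs[of "\<lambda>v. ennreal (ramp i (v 0))" t m] assms by (simp add: mean_ramp_def)
qed

sublocale prod: pair_sigma_finite M lam ..

text \<open>
  The numerator is integrated over the sample first, so that each index \<open>s\<close> can be shifted to the origin.
\<close>

lemma fubini_weighted:
  assumes K[measurable]: "K \<in> sets borel" and D[measurable]: "D \<in> borel_measurable M"
  shows "(\<integral>\<^sup>+\<omega>. W i K (amp (Xs m \<omega>)) / D \<omega> \<partial>M) =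
    (\<integral>\<^sup>+s. indicator K s * (\<integral>\<^sup>+\<omega>. ennreal (ramp i (amp (Xs m \<omega>) s)) / D \<omega> \<partial>M) \<partial>lam)"
proof -
  have "sets (M \<Otimes>\<^sub>M lam) = sets (M \<Otimes>\<^sub>M (borel :: (real^'l) measure))" by (rule sets_pair_measure_cong) simp_all
  then have [measurable]: "case_prod (\<lambda>\<omega>. amp (Xs m \<omega>)) \<in> borel_measurable (M \<Otimes>\<^sub>M lam)"
    using Xs_process[of m] unfolding measurable_process_def by (simp cong: measurable_cong_sets)
  have sec: "(\<lambda>\<omega>. amp (Xs m \<omega>) s) \<in> borel_measurable M" for s
    by (rule measurable_process_section[OF Xs_process])
  note [measurable] = sec
  have path: "amp (Xs m \<omega>) \<in> borel_measurable borel" if "\<omega> \<in> space M" for \<omega>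
    by (rule amp_measurable[OF Xs_path[OF that]])
  define H where "H x = indicator K (snd x) * (ennreal (ramp i (case_prod (\<lambda>\<omega>. amp (Xs m \<omega>)) x)) / D (fst x))" for x
  have H: "H \<in> borel_measurable (M \<Otimes>\<^sub>M lam)" unfolding H_def[abs_def] by measurable
  have "(\<integral>\<^sup>+\<omega>. W i K (amp (Xs m \<omega>)) / D \<omega> \<partial>M) = (\<integral>\<^sup>+\<omega>. (\<integral>\<^sup>+s. H (\<omega>, s) \<partial>lam) \<partial>M)"
  proof (rule nn_integral_cong)
    fix \<omega> assume "\<omega> \<in> space M"
    note [measurable] = path[OF this]
    have "W i K (amp (Xs m \<omega>)) / D \<omega> = (\<integral>\<^sup>+s. indicator K s * ennreal (ramp i (amp (Xs m \<omega>) s)) / D \<omega> \<partial>lam)"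
      unfolding W_def by (rule nn_integral_divide[symmetric]) measurable
    then show "W i K (amp (Xs m \<omega>)) / D \<omega> = (\<integral>\<^sup>+s. H (\<omega>, s) \<partial>lam)"
      by (simp add: H_def ennreal_times_divide)
  qed
  also have "\<dots> = (\<integral>\<^sup>+s. (\<integral>\<^sup>+\<omega>. H (\<omega>, s) \<partial>M) \<partial>lam)" by (rule prod.Fubini'[symmetric]) (use H in simp)
  also have "\<dots> = (\<integral>\<^sup>+s. indicator K s * (\<integral>\<^sup>+\<omega>. ennreal (ramp i (amp (Xs m \<omega>) s)) / D \<omega> \<partial>M) \<partial>lam)"
    unfolding H_def by (intro nn_integral_cong) (simp add: nn_integral_cmult)
  finally show ?thesis .
qed

lemma denominator_measurable:
  "K \<in> sets borel \<Longrightarrow> (\<lambda>\<omega>. max (ennreal \<eta>) (W i K (amp (Xs m \<omega>)))) \<in> borel_measurable M"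
  by (intro borel_measurable_max borel_measurable_const W_measurable[OF Xs_process])

lemma ratio_shift_le:
  assumes "\<omega> \<in> space M" "t \<in> T" "K \<in> sets borel" "(\<lambda>s. s - t) -` ball_cube j \<subseteq> K" "\<eta> > 0"
  shows "ennreal (ramp i (amp (Xs m \<omega>) t)) / max (ennreal \<eta>) (W i K (amp (Xs m \<omega>))) \<le> ratio i \<eta> j (\<lambda>s. amp (Xs m \<omega>) (s + t))"
  unfolding ratio_def using assms W_mono[OF assms(4), of i "amp (Xs m \<omega>)"]
  by (auto simp: W_shift[OF assms(2) amp_measurable[OF Xs_path[OF assms(1)]] ball_cube_borel]
      intro!: divide_left_mono_ennreal max.mono)

lemma ratio_shift_ge:
  assumes "\<omega> \<in> space M" "t \<in> T" "K \<in> sets borel" "K \<subseteq> (\<lambda>s. s - t) -` ball_cube j" "\<eta> > 0"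
  shows "ratio i \<eta> j (\<lambda>s. amp (Xs m \<omega>) (s + t)) \<le> ennreal (ramp i (amp (Xs m \<omega>) t)) / max (ennreal \<eta>) (W i K (amp (Xs m \<omega>)))"
  unfolding ratio_def using assms W_mono[OF assms(4), of i "amp (Xs m \<omega>)"]
  by (auto simp: W_shift[OF assms(2) amp_measurable[OF Xs_path[OF assms(1)]] ball_cube_borel]
      intro!: divide_left_mono_ennreal max.mono)

text \<open>The part of the window at distance at least \<open>j\<close> from its boundary.\<close>

definition inner :: "nat \<Rightarrow> nat \<Rightarrow> (real^'l) set" where
  "inner j n = cube (real j - real reach) (real n + real reach - real j)"

lemma inner_borel[measurable]: "inner j n \<in> sets borel" and inner_sub: "inner j n \<subseteq> window n"
proof -
  show "inner j n \<in> sets borel" by (simp add: inner_def)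
  show "inner j n \<subseteq> window n"
  proof
    fix t assume "t \<in> inner j n"
    then have "real j - real reach \<le> t $ i \<and> t $ i \<le> real n + real reach - real j" for i
      unfolding inner_def mem_cube by blast
    then have "- real reach \<le> t $ i \<and> t $ i \<le> real n + real reach" for i by (smt (verit) of_nat_0_le_iff)
    then show "t \<in> window n" unfolding window_def mem_cube by blast
  qed
qed

text \<open>
  At an inner point the window contains the cube of radius \<open>j\<close> around the point, and the shifted quotient has expectation
  \<open>mean_ratio i \<eta> j m\<close>. Near the boundary the cap bounds the denominator from below.
\<close>

lemma window_expectation_le:
  assumes \<eta>: "\<eta> > 0"
  shows "(\<integral>\<^sup>+\<omega>. W i (window n) (amp (Xs m \<omega>)) / max (ennreal \<eta>) (W i (window n) (amp (Xs m \<omega>))) \<partial>M)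
    \<le> emeasure lam (inner j n) * mean_ratio i \<eta> j m + emeasure lam (window n - inner j n) * (mean_ramp i m / ennreal \<eta>)"
proof -
  let ?D = "\<lambda>\<omega>. max (ennreal \<eta>) (W i (window n) (amp (Xs m \<omega>)))"
  have [measurable]: "(\<lambda>\<omega>. ennreal (ramp i (amp (Xs m \<omega>) s))) \<in> borel_measurable M" for s
    using measurable_process_section[OF Xs_process, of m s] by measurable
  have "(\<integral>\<^sup>+\<omega>. W i (window n) (amp (Xs m \<omega>)) / ?D \<omega> \<partial>M)
    = (\<integral>\<^sup>+s. indicator (window n) s * (\<integral>\<^sup>+\<omega>. ennreal (ramp i (amp (Xs m \<omega>) s)) / ?D \<omega> \<partial>M) \<partial>lam)"
    by (rule fubini_weighted[OF window_borel denominator_measurable[OF window_borel]])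
  also have "\<dots> \<le> (\<integral>\<^sup>+s. mean_ratio i \<eta> j m * indicator (inner j n) s + (mean_ramp i m / ennreal \<eta>) * indicator (window n - inner j n) s \<partial>lam)"
  proof (rule nn_integral_mono_AE)
    show "AE s in lam. indicator (window n) s * (\<integral>\<^sup>+\<omega>. ennreal (ramp i (amp (Xs m \<omega>) s)) / ?D \<omega> \<partial>M)
      \<le> mean_ratio i \<eta> j m * indicator (inner j n) s + (mean_ramp i m / ennreal \<eta>) * indicator (window n - inner j n) s"
      using AE_lam_T
    proof eventually_elim
      case (elim s)
      consider "s \<in> inner j n" | "s \<in> window n - inner j n" | "s \<notin> window n" by blast
      then show ?case
      proof cases
        case 1
        have sub: "(\<lambda>t. t - s) -` ball_cube j \<subseteq> window n"
        proof
          fix t assume "t \<in> (\<lambda>t. t - s) -` ball_cube j"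
          then have "- real j \<le> (t - s) $ i \<and> (t - s) $ i \<le> real j" for i
            unfolding ball_cube_def vimage_def mem_Collect_eq mem_cube by blast
          moreover have "real j - real reach \<le> s $ i \<and> s $ i \<le> real n + real reach - real j" for i
            using 1 unfolding inner_def mem_cube by blast
          ultimately have "- real reach \<le> t $ i \<and> t $ i \<le> real n + real reach" for i
            unfolding vector_minus_component by (smt (verit))
          then show "t \<in> window n" unfolding window_def mem_cube by blast
        qed
        have "(\<integral>\<^sup>+\<omega>. ennreal (ramp i (amp (Xs m \<omega>) s)) / ?D \<omega> \<partial>M) \<le> (\<integral>\<^sup>+\<omega>. ratio i \<eta> j (\<lambda>t. amp (Xs m \<omega>) (t + s)) \<partial>M)"
          by (intro nn_integral_mono ratio_shift_le[OF _ elim window_borel sub \<eta>])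
        also have "\<dots> = mean_ratio i \<eta> j m" by (rule mean_ratio_shift[OF elim])
        finally show ?thesis using 1 inner_sub[of j n] by (auto simp: indicator_def)
      next
        case 2
        have "(\<integral>\<^sup>+\<omega>. ennreal (ramp i (amp (Xs m \<omega>) s)) / ?D \<omega> \<partial>M) \<le> (\<integral>\<^sup>+\<omega>. ennreal (ramp i (amp (Xs m \<omega>) s)) / ennreal \<eta> \<partial>M)"
          using \<eta> by (intro nn_integral_mono divide_left_mono_ennreal) auto
        also have "\<dots> = (\<integral>\<^sup>+\<omega>. ennreal (ramp i (amp (Xs m \<omega>) s)) \<partial>M) / ennreal \<eta>"
          by (rule nn_integral_divide) measurable
        also have "\<dots> = mean_ramp i m / ennreal \<eta>" by (simp only: mean_ramp_shift[OF elim])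
        finally show ?thesis using 2 by simp
      qed simp
    qed
  qed
  also have "\<dots> = mean_ratio i \<eta> j m * emeasure lam (inner j n) + (mean_ramp i m / ennreal \<eta>) * emeasure lam (window n - inner j n)"
    by (subst nn_integral_add) (simp_all add: nn_integral_cmult_indicator)
  finally show ?thesis by (simp add: mult.commute)
qed

lemma sup_prob_le:
  assumes \<eta>: "\<eta> > 0"
    and E: "E \<subseteq> {\<omega> \<in> space M. \<exists>t\<in>T \<inter> cube 0 (real n). amp (Xs m \<omega>) t > level i}"
  shows "emeasure M E
    \<le> of_nat ((n + 1) ^ CARD('l)) * (\<integral>\<^sup>+\<omega>. ennreal (thin_bound i \<eta> (Xs m \<omega>)) \<partial>M) +
      (emeasure lam (inner j n) * mean_ratio i \<eta> j m + emeasure lam (window n - inner j n) * (mean_ramp i m / ennreal \<eta>))"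
proof -
  let ?A = "\<lambda>\<omega>. \<Sum>z\<in>cells n. thin i \<eta> (\<lambda>s. amp (Xs m \<omega>) (s + z))"
  let ?B = "\<lambda>\<omega>. W i (window n) (amp (Xs m \<omega>)) / max (ennreal \<eta>) (W i (window n) (amp (Xs m \<omega>)))"
  have A1[measurable]: "(\<lambda>\<omega>. thin i \<eta> (\<lambda>s. amp (Xs m \<omega>) (s + z))) \<in> borel_measurable M" for z
    by (rule thin_measurable[OF Xs_shift_process])
  have B[measurable]: "?B \<in> borel_measurable M"
    by (intro borel_measurable_divide_ennreal denominator_measurable window_borel W_measurable[OF Xs_process])
  have "emeasure M E \<le> emeasure M {\<omega> \<in> space M. 1 \<le> ?A \<omega> + ?B \<omega>}"
  proof (rule emeasure_mono)
    have "{\<omega> \<in> space M. \<exists>t\<in>T \<inter> cube 0 (real n). amp (Xs m \<omega>) t > level i} \<subseteq> {\<omega> \<in> space M. 1 \<le> ?A \<omega> + ?B \<omega>}"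
    proof safe
      fix \<omega> t assume "\<omega> \<in> space M" "t \<in> T" "t \<in> cube 0 (real n)" "level i < amp (Xs m \<omega>) t"
      then show "1 \<le> ?A \<omega> + ?B \<omega>" by (intro pathwise_bound[OF Xs_path \<eta>])
    qed
    with E show "E \<subseteq> {\<omega> \<in> space M. 1 \<le> ?A \<omega> + ?B \<omega>}" by blast
    show "{\<omega> \<in> space M. 1 \<le> ?A \<omega> + ?B \<omega>} \<in> sets M" by measurable
  qed
  also have "\<dots> = (\<integral>\<^sup>+\<omega>. indicator {\<omega> \<in> space M. 1 \<le> ?A \<omega> + ?B \<omega>} \<omega> \<partial>M)"
    by (rule nn_integral_indicator[symmetric]) measurable
  also have "\<dots> \<le> (\<integral>\<^sup>+\<omega>. ?A \<omega> + ?B \<omega> \<partial>M)"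
    by (intro nn_integral_mono) (auto simp: indicator_def)
  also have "\<dots> = (\<integral>\<^sup>+\<omega>. ?A \<omega> \<partial>M) + (\<integral>\<^sup>+\<omega>. ?B \<omega> \<partial>M)"
    by (rule nn_integral_add) measurable
  also have "(\<integral>\<^sup>+\<omega>. ?A \<omega> \<partial>M) = (\<Sum>z\<in>cells n. (\<integral>\<^sup>+\<omega>. thin i \<eta> (\<lambda>s. amp (Xs m \<omega>) (s + z)) \<partial>M))"
    by (rule nn_integral_sum) measurable
  also have "\<dots> = (\<Sum>z\<in>cells n. (\<integral>\<^sup>+\<omega>. thin i \<eta> (amp (Xs m \<omega>)) \<partial>M))"
    by (intro sum.cong refl thin_shift cells_T)
  also have "\<dots> = of_nat (card (cells n)) * (\<integral>\<^sup>+\<omega>. thin i \<eta> (amp (Xs m \<omega>)) \<partial>M)" by simp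
  also have "\<dots> \<le> of_nat ((n + 1) ^ CARD('l)) * (\<integral>\<^sup>+\<omega>. ennreal (thin_bound i \<eta> (Xs m \<omega>)) \<partial>M)"
    by (intro mult_mono nn_integral_mono thin_le Xs_path \<eta>) (use card_cells[of n] in \<open>simp_all only: of_nat_le_iff zero_le\<close>)
  finally show ?thesis using window_expectation_le[OF \<eta>, of i n m j]
    by (meson add_left_mono add_right_mono order_trans)
qed

text \<open>
  Averaging the numerator around the origin changes the expected quotient only through the size of the cube in the
  denominator. The two directions bound \<open>mean_ratio\<close> from above and from below by expectations of continuous functionals.
\<close>

lemma corner_average_ge:
  assumes \<eta>: "\<eta> > 0" and K: "K \<in> sets borel" and sub: "\<And>s. s \<in> corner 0 \<epsilon> \<Longrightarrow> K \<subseteq> (\<lambda>t. t - s) -` ball_cube j"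
  shows "emeasure lam (corner 0 \<epsilon>) * mean_ratio i \<eta> j m \<le>
    (\<integral>\<^sup>+\<omega>. W i (corner 0 \<epsilon>) (amp (Xs m \<omega>)) / max (ennreal \<eta>) (W i K (amp (Xs m \<omega>))) \<partial>M)"
proof -
  let ?D = "\<lambda>\<omega>. max (ennreal \<eta>) (W i K (amp (Xs m \<omega>)))"
  have "emeasure lam (corner 0 \<epsilon>) * mean_ratio i \<eta> j m = (\<integral>\<^sup>+s. mean_ratio i \<eta> j m * indicator (corner 0 \<epsilon>) s \<partial>lam)"
    by (subst nn_integral_cmult_indicator) (simp_all add: mult.commute)
  also have "\<dots> \<le> (\<integral>\<^sup>+s. indicator (corner 0 \<epsilon>) s * (\<integral>\<^sup>+\<omega>. ennreal (ramp i (amp (Xs m \<omega>) s)) / ?D \<omega> \<partial>M) \<partial>lam)"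
  proof (rule nn_integral_mono_AE)
    show "AE s in lam. mean_ratio i \<eta> j m * indicator (corner 0 \<epsilon>) s \<le>
      indicator (corner 0 \<epsilon>) s * (\<integral>\<^sup>+\<omega>. ennreal (ramp i (amp (Xs m \<omega>) s)) / ?D \<omega> \<partial>M)"
      using AE_lam_T
    proof eventually_elim
      case (elim s)
      show ?case
      proof (cases "s \<in> corner 0 \<epsilon>")
        case True
        have "mean_ratio i \<eta> j m = (\<integral>\<^sup>+\<omega>. ratio i \<eta> j (\<lambda>t. amp (Xs m \<omega>) (t + s)) \<partial>M)"
          by (rule mean_ratio_shift[OF elim, symmetric])
        also have "\<dots> \<le> (\<integral>\<^sup>+\<omega>. ennreal (ramp i (amp (Xs m \<omega>) s)) / ?D \<omega> \<partial>M)"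
          by (intro nn_integral_mono ratio_shift_ge[OF _ elim K sub[OF True] \<eta>])
        finally show ?thesis using True by simp
      qed simp
    qed
  qed
  also have "\<dots> = (\<integral>\<^sup>+\<omega>. W i (corner 0 \<epsilon>) (amp (Xs m \<omega>)) / ?D \<omega> \<partial>M)"
    by (rule fubini_weighted[OF corner_borel denominator_measurable[OF K], symmetric])
  finally show ?thesis .
qed

lemma corner_average_le:
  assumes \<eta>: "\<eta> > 0" and K: "K \<in> sets borel" and sub: "\<And>s. s \<in> corner 0 \<epsilon> \<Longrightarrow> (\<lambda>t. t - s) -` ball_cube j \<subseteq> K"
  shows "(\<integral>\<^sup>+\<omega>. W i (corner 0 \<epsilon>) (amp (Xs m \<omega>)) / max (ennreal \<eta>) (W i K (amp (Xs m \<omega>))) \<partial>M)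
    \<le> emeasure lam (corner 0 \<epsilon>) * mean_ratio i \<eta> j m"
proof -
  let ?D = "\<lambda>\<omega>. max (ennreal \<eta>) (W i K (amp (Xs m \<omega>)))"
  have "(\<integral>\<^sup>+\<omega>. W i (corner 0 \<epsilon>) (amp (Xs m \<omega>)) / ?D \<omega> \<partial>M)
    = (\<integral>\<^sup>+s. indicator (corner 0 \<epsilon>) s * (\<integral>\<^sup>+\<omega>. ennreal (ramp i (amp (Xs m \<omega>) s)) / ?D \<omega> \<partial>M) \<partial>lam)"
    by (rule fubini_weighted[OF corner_borel denominator_measurable[OF K]])
  also have "\<dots> \<le> (\<integral>\<^sup>+s. mean_ratio i \<eta> j m * indicator (corner 0 \<epsilon>) s \<partial>lam)"
  proof (rule nn_integral_mono_AE)
    show "AE s in lam. indicator (corner 0 \<epsilon>) s * (\<integral>\<^sup>+\<omega>. ennreal (ramp i (amp (Xs m \<omega>) s)) / ?D \<omega> \<partial>M)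
       \<le> mean_ratio i \<eta> j m * indicator (corner 0 \<epsilon>) s"
      using AE_lam_T
    proof eventually_elim
      case (elim s)
      show ?case
      proof (cases "s \<in> corner 0 \<epsilon>")
        case True
        have "(\<integral>\<^sup>+\<omega>. ennreal (ramp i (amp (Xs m \<omega>) s)) / ?D \<omega> \<partial>M) \<le> (\<integral>\<^sup>+\<omega>. ratio i \<eta> j (\<lambda>t. amp (Xs m \<omega>) (t + s)) \<partial>M)"
          by (intro nn_integral_mono ratio_shift_le[OF _ elim K sub[OF True] \<eta>])
        also have "\<dots> = mean_ratio i \<eta> j m" by (rule mean_ratio_shift[OF elim])
        finally show ?thesis using True by simp
      qed simp
    qed
  qed
  also have "\<dots> = emeasure lam (corner 0 \<epsilon>) * mean_ratio i \<eta> j m"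
    by (subst nn_integral_cmult_indicator) (simp_all add: mult.commute)
  finally show ?thesis .
qed

lemma corner_ball_cube:
  assumes s: "s \<in> corner 0 \<epsilon>" and \<epsilon>: "\<epsilon> \<le> 1"
  shows "ball_cube j \<subseteq> (\<lambda>t. t - s) -` ball_cube (Suc j)" "(\<lambda>t. t - s) -` ball_cube j \<subseteq> ball_cube (Suc j)"
    "corner 0 1 \<subseteq> (\<lambda>t. t - s) -` ball_cube 1"
proof -
  have s01: "0 \<le> s $ i \<and> s $ i \<le> 1" for i
    using s \<epsilon> unfolding mem_corner by (smt (verit) zero_index)
  show "ball_cube j \<subseteq> (\<lambda>t. t - s) -` ball_cube (Suc j)"
  proof
    fix t assume "t \<in> ball_cube j"
    then have "- real j \<le> t $ i \<and> t $ i \<le> real j" for i unfolding ball_cube_def mem_cube by blast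
    then have "- real (Suc j) \<le> (t - s) $ i \<and> (t - s) $ i \<le> real (Suc j)" for i
      using s01 unfolding vector_minus_component of_nat_Suc by (smt (verit))
    then show "t \<in> (\<lambda>t. t - s) -` ball_cube (Suc j)" unfolding ball_cube_def vimage_def mem_cube by blast
  qed
  show "(\<lambda>t. t - s) -` ball_cube j \<subseteq> ball_cube (Suc j)"
  proof
    fix t assume "t \<in> (\<lambda>t. t - s) -` ball_cube j"
    then have "- real j \<le> (t - s) $ i \<and> (t - s) $ i \<le> real j" for i
      unfolding ball_cube_def vimage_def mem_Collect_eq mem_cube by blast
    then have "- real (Suc j) \<le> t $ i \<and> t $ i \<le> real (Suc j)" for i
      using s01 unfolding vector_minus_component of_nat_Suc by (smt (verit))
    then show "t \<in> ball_cube (Suc j)" unfolding ball_cube_def mem_cube by blast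
  qed
  show "corner 0 1 \<subseteq> (\<lambda>t. t - s) -` ball_cube 1"
  proof
    fix t :: "real^'l" assume t: "t \<in> corner 0 1"
    have "- 1 \<le> (t - s) $ i \<and> (t - s) $ i \<le> 1" for i
      using s01 t unfolding mem_corner vector_minus_component by (smt (verit) zero_index)
    then show "t \<in> (\<lambda>t. t - s) -` ball_cube 1" by (simp add: ball_cube_def mem_cube)
  qed
qed

text \<open>
  A continuous majorant of the indicator of an exceedance of \<open>1\<close> in \<open>[0,1]\<^sup>l\<close>.
\<close>

definition high_peak :: "(real^'l \<Rightarrow> real^'d) \<Rightarrow> real" where
  "high_peak f = max 0 (min 1 (2 * peak (amp f) - 1))"

text \<open>
  For \<open>s\<close> in \<open>[0,1]\<^sup>l\<close> the cube of radius \<open>1\<close> around \<open>s\<close> contains \<open>[0,1]\<^sup>l\<close>. With this cube in the denominator the weights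
  integrate to at most \<open>1\<close>, and to \<open>0\<close> if there is no exceedance.
\<close>

lemma unit_corner_mean_ratio_le:
  assumes \<eta>: "\<eta> > 0"
  shows "emeasure lam (corner 0 1) * mean_ratio i \<eta> 1 m \<le> (\<integral>\<^sup>+\<omega>. ennreal (high_peak (Xs m \<omega>)) \<partial>M)"
proof -
  let ?D = "\<lambda>\<omega>. max (ennreal \<eta>) (W i (corner 0 1) (amp (Xs m \<omega>)))"
  have "emeasure lam (corner 0 1) * mean_ratio i \<eta> 1 m \<le> (\<integral>\<^sup>+\<omega>. W i (corner 0 1) (amp (Xs m \<omega>)) / ?D \<omega> \<partial>M)"
    by (rule corner_average_ge[OF \<eta> corner_borel corner_ball_cube(3)[where \<epsilon> = 1]]) simp_all
  also have "\<dots> \<le> (\<integral>\<^sup>+\<omega>. ennreal (high_peak (Xs m \<omega>)) \<partial>M)"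
  proof (rule nn_integral_mono)
    fix \<omega> assume "\<omega> \<in> space M"
    let ?W = "W i (corner 0 1) (amp (Xs m \<omega>))"
    show "?W / max (ennreal \<eta>) ?W \<le> ennreal (high_peak (Xs m \<omega>))"
    proof (cases "?W = 0")
      case False
      then obtain t where t: "t \<in> corner 0 1" "amp (Xs m \<omega>) t > 1" by (rule W_pos_obtain)
      have "\<bar>t $ i\<bar> \<le> 1" for i using t(1) unfolding mem_corner by (smt (verit) zero_index)
      then have "peak (amp (Xs m \<omega>)) \<ge> 1" by (rule peak_ge) (use t(2) in auto)
      then have "high_peak (Xs m \<omega>) = 1" by (simp add: high_peak_def)
      moreover have "?W / max (ennreal \<eta>) ?W \<le> ?W / ?W" by (intro divide_left_mono_ennreal) simp
      moreover have "?W / ?W = 1"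
        using False W_finite[OF bounded_corner corner_borel, of i 0 1 "amp (Xs m \<omega>)"] by (intro ennreal_divide_self) auto
      ultimately show ?thesis by simp
    qed simp
  qed
  finally show ?thesis .
qed

end

section \<open>Vague limits of the smoothed functionals\<close>

lemma tendsto_ratio_ennreal:
  assumes \<eta>: "\<eta> > 0" and p: "(p \<longlongrightarrow> p') F" "p' < top" and q: "(q \<longlongrightarrow> q') F"
  shows "((\<lambda>n. p n / max (ennreal \<eta>) (q n)) \<longlongrightarrow> p' / max (ennreal \<eta>) q') F"
proof -
  have mx: "((\<lambda>n. max (ennreal \<eta>) (q n)) \<longlongrightarrow> max (ennreal \<eta>) q') F"
    by (intro tendsto_max tendsto_const q)
  have "continuous_on UNIV (\<lambda>x::ennreal. inverse x)" by (intro continuous_intros)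
  from continuous_on_tendsto_compose[OF this mx]
  have inv: "((\<lambda>n. inverse (max (ennreal \<eta>) (q n))) \<longlongrightarrow> inverse (max (ennreal \<eta>) q')) F" by simp
  have "max (ennreal \<eta>) q' \<noteq> 0" using \<eta> by (auto simp: max_def)
  then have "\<not> (p' = 0 \<and> inverse (max (ennreal \<eta>) q') = \<infinity> \<or> p' = \<infinity> \<and> inverse (max (ennreal \<eta>) q') = 0)"
    using p(2) by auto
  from tendsto_mult_ennreal[OF p(1) inv this] show ?thesis unfolding divide_ennreal_def .
qed

lemma one_minus_exp_le: "1 - exp (- y) \<le> (y::real)"
  using exp_ge_add_one_self[of "- y"] by simp

text \<open>
  Volume of the window over the level index: the asymptotic number of observations per unit of \<open>m\<close>.
\<close>

lemma power_ratio_tendsto: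
  fixes c \<kappa> :: real
  assumes \<kappa>: "\<kappa> > 0" and l: "l > 0"
  shows "(\<lambda>n. (real n + c) ^ l / real (nat \<lfloor>real n ^ l * \<kappa>\<rfloor>)) \<longlonglongrightarrow> 1 / \<kappa>"
proof -
  have "filterlim (\<lambda>n. real n ^ l) at_top sequentially"
    by (rule filterlim_pow_at_top[OF l filterlim_real_sequentially])
  then have "filterlim (\<lambda>n. \<kappa> * real n ^ l) at_top sequentially"
    by (rule filterlim_tendsto_pos_mult_at_top[OF tendsto_const \<kappa>])
  then have top: "filterlim (\<lambda>n. real n ^ l * \<kappa>) at_top sequentially" by (simp only: mult.commute)
  have "(\<lambda>n. 1 + c / real n) \<longlonglongrightarrow> 1 + 0" by (intro tendsto_add tendsto_const lim_const_over_n)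
  moreover have "\<forall>\<^sub>F n in sequentially. 1 + c / real n = (real n + c) / real n"
    using eventually_gt_at_top[of 0] by eventually_elim (simp add: field_simps)
  ultimately have base: "(\<lambda>n. (real n + c) / real n) \<longlonglongrightarrow> 1" by (simp add: Lim_transform_eventually)
  have p1: "(\<lambda>n. ((real n + c) / real n) ^ l) \<longlonglongrightarrow> 1"
    using tendsto_power[OF base, of l] by simp
  have fl: "((\<lambda>y::real. y / real (nat \<lfloor>y\<rfloor>)) \<longlongrightarrow> 1) at_top"
  proof -
    have "((\<lambda>y::real. 1 - inverse y) \<longlongrightarrow> 1 - 0) at_top"
      by (intro tendsto_diff tendsto_const tendsto_inverse_0_at_top filterlim_ident)
    then have lower: "((\<lambda>y::real. 1 - inverse y) \<longlongrightarrow> 1) at_top" by simp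
    have "((\<lambda>y::real. real (nat \<lfloor>y\<rfloor>) / y) \<longlongrightarrow> 1) at_top"
    proof (rule tendsto_sandwich[OF _ _ lower tendsto_const])
      show "\<forall>\<^sub>F y::real in at_top. 1 - inverse y \<le> real (nat \<lfloor>y\<rfloor>) / y"
        using eventually_gt_at_top[of 0]
      proof eventually_elim
        case (elim y)
        have "y - 1 \<le> real (nat \<lfloor>y\<rfloor>)" using elim by linarith
        then have "(y - 1) / y \<le> real (nat \<lfloor>y\<rfloor>) / y" using elim by (intro divide_right_mono) auto
        moreover have "(y - 1) / y = 1 - inverse y" using elim by (simp add: diff_divide_distrib inverse_eq_divide)
        ultimately show ?case by simp
      qed
      show "\<forall>\<^sub>F y::real in at_top. real (nat \<lfloor>y\<rfloor>) / y \<le> 1"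
        using eventually_gt_at_top[of 0] by eventually_elim (simp add: divide_le_eq)
    qed
    from tendsto_inverse[OF this] show ?thesis by (simp add: inverse_eq_divide)
  qed
  have p2: "(\<lambda>n. (real n ^ l * \<kappa>) / real (nat \<lfloor>real n ^ l * \<kappa>\<rfloor>)) \<longlonglongrightarrow> 1"
    by (rule filterlim_compose[OF fl top])
  have "(\<lambda>n. ((real n + c) / real n) ^ l * ((real n ^ l * \<kappa>) / real (nat \<lfloor>real n ^ l * \<kappa>\<rfloor>)) / \<kappa>) \<longlonglongrightarrow> 1 * 1 / \<kappa>"
    by (intro tendsto_divide tendsto_mult p1 p2 tendsto_const) (use \<kappa> in simp)
  moreover have "\<forall>\<^sub>F n in sequentially. ((real n + c) / real n) ^ l * ((real n ^ l * \<kappa>) / real (nat \<lfloor>real n ^ l * \<kappa>\<rfloor>)) / \<kappa>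
     = (real n + c) ^ l / real (nat \<lfloor>real n ^ l * \<kappa>\<rfloor>)"
    using eventually_gt_at_top[of 0]
  proof eventually_elim
    case (elim n)
    then have "real n ^ l \<noteq> 0" by simp
    then show ?case using elim \<kappa> by (simp add: power_divide)
  qed
  ultimately show ?thesis by (simp add: Lim_transform_eventually)
qed

locale limit_setting = stationary_rv_setting nrm T M X \<nu> a
  for nrm :: "real^'d \<Rightarrow> real" and T :: "(real^'l) set"
    and M :: "'w measure" and X :: "'w \<Rightarrow> real^'l \<Rightarrow> real^'d"
    and \<nu> :: "(real^'l \<Rightarrow> real^'d) measure" and a :: "nat \<Rightarrow> real" +
  fixes \<alpha> :: real
  assumes \<alpha>: "\<alpha> > 0" and a: "a = (\<lambda>n. real n powr (1 / \<alpha>))"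
    and frechet: "\<And>x. x > 0 \<Longrightarrow> measure M {\<omega> \<in> space M. nrm (X \<omega> 0) \<le> x} = exp (- (x powr (- \<alpha>)))"
begin

lemma mean_ramp_le:
  assumes "m > 0" shows "mean_ramp i m \<le> ennreal (1 / real m)"
proof -
  have am: "a m > 0" using assms by (simp add: a)
  have apow: "a m powr (- \<alpha>) = 1 / real m" using assms \<alpha> by (simp add: a powr_powr powr_minus_divide)
  have X0[measurable]: "(\<lambda>\<omega>. amp (X \<omega>) 0) \<in> borel_measurable M"
    by (rule measurable_compose[OF X_measurable amp_eval_measurable[OF T_zero]])
  have amp0: "amp (Xs m \<omega>) 0 = amp (X \<omega>) 0 / a m" for \<omega>
    unfolding Xs_def[abs_def] amp_scaleR using am by (simp add: field_simps)
  then have eq: "amp (Xs m \<omega>) 0 > 1 \<longleftrightarrow> amp (X \<omega>) 0 > a m" for \<omega>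
    unfolding amp0 using am by (simp add: less_divide_eq)
  let ?A = "{\<omega> \<in> space M. amp (X \<omega>) 0 > a m}"
  have "mean_ramp i m \<le> (\<integral>\<^sup>+\<omega>. indicator ?A \<omega> \<partial>M)" unfolding mean_ramp_def
  proof (rule nn_integral_mono)
    fix \<omega> assume "\<omega> \<in> space M"
    then show "ennreal (ramp i (amp (Xs m \<omega>) 0)) \<le> indicator ?A \<omega>"
      using eq[of \<omega>] ramp_zero[of "amp (Xs m \<omega>) 0" i] ramp_bounds[of i "amp (Xs m \<omega>) 0"]
      by (cases "amp (Xs m \<omega>) 0 > 1") (auto simp: ennreal_le_1)
  qed
  also have "\<dots> = emeasure M ?A" by (rule nn_integral_indicator) measurable
  also have "\<dots> = ennreal (prob ?A)" by (rule emeasure_eq_measure)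
  also have "prob ?A = 1 - prob {\<omega> \<in> space M. amp (X \<omega>) 0 \<le> a m}"
  proof -
    have "?A = space M - {\<omega> \<in> space M. amp (X \<omega>) 0 \<le> a m}" by auto
    then show ?thesis by (simp add: prob_compl)
  qed
  also have "prob {\<omega> \<in> space M. amp (X \<omega>) 0 \<le> a m} = exp (- (1 / real m))"
    using frechet[OF am] unfolding amp_def apow .
  also have "1 - exp (- (1 / real m)) \<le> 1 / real m" by (rule one_minus_exp_le)
  finally show ?thesis by (simp add: ennreal_leI)
qed

lemma expectation_avg_ratio:
  assumes \<eta>: "\<eta> > 0"
  shows "(\<integral>\<^sup>+\<omega>. W i (corner 0 (1 / real (Suc k))) (amp (Xs m \<omega>)) / max (ennreal \<eta>) (W i (ball_cube j) (amp (Xs m \<omega>))) \<partial>M)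
    = emeasure lam (corner 0 (1 / real (Suc k))) * (\<integral>\<^sup>+\<omega>. ennreal (avg_ratio i \<eta> j k (Xs m \<omega>)) \<partial>M)"
proof -
  have "avg_ratio i \<eta> j k \<in> borel_measurable paths"
    by (rule continuous_map_real_borel[OF avg_ratio_continuous[OF \<eta>]])
  then have [measurable]: "(\<lambda>\<omega>. avg_ratio i \<eta> j k (Xs m \<omega>)) \<in> borel_measurable M"
    by (rule measurable_compose[OF Xs_measurable])
  have "(\<integral>\<^sup>+\<omega>. W i (corner 0 (1 / real (Suc k))) (amp (Xs m \<omega>)) / max (ennreal \<eta>) (W i (ball_cube j) (amp (Xs m \<omega>))) \<partial>M)
    = (\<integral>\<^sup>+\<omega>. emeasure lam (corner 0 (1 / real (Suc k))) * ennreal (avg_ratio i \<eta> j k (Xs m \<omega>)) \<partial>M)"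
    unfolding emeasure_corner by (intro nn_integral_cong ennreal_avg_ratio[OF Xs_path \<eta>, symmetric])
  also have "\<dots> = emeasure lam (corner 0 (1 / real (Suc k))) * (\<integral>\<^sup>+\<omega>. ennreal (avg_ratio i \<eta> j k (Xs m \<omega>)) \<partial>M)"
    by (rule nn_integral_cmult) measurable
  finally show ?thesis .
qed

text \<open>
  The averaging cubes have side at most \<open>1\<close>, which costs one unit of the radius \<open>j\<close> in either direction.
\<close>

lemma mean_ratio_bounds_by_avg:
  assumes \<eta>: "\<eta> > 0"
  shows "mean_ratio i \<eta> (Suc j) m \<le> (\<integral>\<^sup>+\<omega>. ennreal (avg_ratio i \<eta> j k (Xs m \<omega>)) \<partial>M)"
    and "(\<integral>\<^sup>+\<omega>. ennreal (avg_ratio i \<eta> (Suc j) k (Xs m \<omega>)) \<partial>M) \<le> mean_ratio i \<eta> j m"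
proof -
  let ?C = "corner 0 (1 / real (Suc k))"
  have c: "emeasure lam ?C \<noteq> 0" "emeasure lam ?C \<noteq> top"
    using lam_corner_measure[of "1 / real (Suc k)"] by (auto simp: emeasure_corner)
  note sub = corner_ball_cube[where \<epsilon> = "1 / real (Suc k)"]
  have "emeasure lam ?C * mean_ratio i \<eta> (Suc j) m \<le> emeasure lam ?C * (\<integral>\<^sup>+\<omega>. ennreal (avg_ratio i \<eta> j k (Xs m \<omega>)) \<partial>M)"
    unfolding expectation_avg_ratio[OF \<eta>, symmetric]
    by (rule corner_average_ge[OF \<eta> ball_cube_borel sub(1)]) simp_all
  then show "mean_ratio i \<eta> (Suc j) m \<le> (\<integral>\<^sup>+\<omega>. ennreal (avg_ratio i \<eta> j k (Xs m \<omega>)) \<partial>M)"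
    using c by (simp add: ennreal_mult_le_mult_iff)
  have "emeasure lam ?C * (\<integral>\<^sup>+\<omega>. ennreal (avg_ratio i \<eta> (Suc j) k (Xs m \<omega>)) \<partial>M) \<le> emeasure lam ?C * mean_ratio i \<eta> j m"
    unfolding expectation_avg_ratio[OF \<eta>, symmetric]
    by (rule corner_average_le[OF \<eta> ball_cube_borel sub(2)]) simp_all
  then show "(\<integral>\<^sup>+\<omega>. ennreal (avg_ratio i \<eta> (Suc j) k (Xs m \<omega>)) \<partial>M) \<le> mean_ratio i \<eta> j m"
    using c by (simp add: ennreal_mult_le_mult_iff)
qed

lemma avg_ratio_vague:
  assumes \<eta>: "\<eta> > 0"
  shows "(\<lambda>m. of_nat m * (\<integral>\<^sup>+\<omega>. ennreal (avg_ratio i \<eta> j k (Xs m \<omega>)) \<partial>M)) \<longlonglongrightarrow> (\<integral>\<^sup>+f. ennreal (avg_ratio i \<eta> j k f) \<partial>\<nu>)"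
  by (rule vague_limit[OF avg_ratio_continuous[OF \<eta>] avg_ratio_bounds[OF \<eta>]]) (drule (1) avg_ratio_nonzero, simp)

lemma thin_bound_vague:
  assumes \<eta>: "\<eta> > 0"
  shows "(\<lambda>m. of_nat m * (\<integral>\<^sup>+\<omega>. ennreal (thin_bound i \<eta> (Xs m \<omega>)) \<partial>M)) \<longlonglongrightarrow> (\<integral>\<^sup>+f. ennreal (thin_bound i \<eta> f) \<partial>\<nu>)"
  by (rule vague_limit[OF thin_bound_continuous[OF \<eta>] thin_bound_bounds]) (drule thin_bound_nonzero, simp)

lemma high_peak_vague:
  shows "(\<lambda>m. of_nat m * (\<integral>\<^sup>+\<omega>. ennreal (high_peak (Xs m \<omega>)) \<partial>M)) \<longlonglongrightarrow> (\<integral>\<^sup>+f. ennreal (high_peak f) \<partial>\<nu>)"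
proof (rule vague_limit[where B = 1])
  show "continuous_map (path_topology nrm T) euclideanreal high_peak"
    unfolding high_peak_def[abs_def]
    by (intro continuous_map_real_max continuous_map_real_min continuous_map_diff continuous_map_real_mult peak_continuous)
      (auto intro: continuous_map_const[THEN iffD2])
  show "0 \<le> high_peak f" "high_peak f \<le> 1" for f by (simp_all add: high_peak_def)
  show "1 / 2 \<le> peak (amp f)" if "high_peak f \<noteq> 0" for f
    using that unfolding high_peak_def by linarith
qed

end

context path_setting begin

section \<open>Removing the smoothing under the tail measure\<close>

lemma ramp_mono: "i \<le> i' \<Longrightarrow> ramp i r \<le> ramp i' r"
proof (cases "r \<le> 1")
  case False
  assume "i \<le> i'"
  then have "(r - 1) * (real i + 1) \<le> (r - 1) * (real i' + 1)" using False by (intro mult_left_mono) auto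
  then show ?thesis unfolding ramp_def by (intro max.mono min.mono order_refl)
qed (simp add: ramp_zero)

lemma ramp_tendsto: "(\<lambda>i. ramp i r) \<longlonglongrightarrow> (if r > 1 then 1 else 0)"
proof (cases "r > 1")
  case True
  then obtain n where n: "1 / real (Suc n) < r - 1" using nat_approx_posE[of "r - 1"] by auto
  have "ramp i r = 1" if "i \<ge> n" for i
  proof (rule ramp_one)
    have "1 / (real i + 1) \<le> 1 / real (Suc n)" using that by (simp add: field_simps)
    then show "r \<ge> 1 + 1 / (real i + 1)" using n by linarith
  qed
  then have "\<forall>\<^sub>F i in sequentially. 1 = ramp i r" using eventually_sequentially by force
  then show ?thesis using True by (simp add: Lim_transform_eventually[OF tendsto_const])
qed (simp add: ramp_zero)

lemma W_tendsto_occ: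
  assumes f: "f \<in> path_space T" and [measurable]: "K \<in> sets borel"
  shows "(\<lambda>i. W i K (amp f)) \<longlonglongrightarrow> occ 1 K (amp f)"
  unfolding W_def occ_def
proof (rule nn_integral_LIMSEQ)
  note [measurable] = amp_measurable[OF f]
  show "incseq (\<lambda>i t. indicator K t * ennreal (ramp i (amp f t)))"
    by (auto simp: incseq_def le_fun_def intro!: mult_left_mono ennreal_leI ramp_mono)
  show "(\<lambda>t. indicator K t * ennreal (ramp i (amp f t))) \<in> borel_measurable lam" for i by measurable
  fix t
  have "(\<lambda>i. ennreal (ramp i (amp f t))) \<longlonglongrightarrow> ennreal (if amp f t > 1 then 1 else 0)"
    by (intro tendsto_ennrealI ramp_tendsto)
  moreover have "ennreal (if amp f t > 1 then 1 else 0) = (if amp f t > 1 then 1 else 0)" by simp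
  ultimately show "(\<lambda>i. indicator K t * ennreal (ramp i (amp f t))) \<longlonglongrightarrow> indicator K t * (if amp f t > 1 then 1 else 0)"
    by (cases "t \<in> K") simp_all
qed

lemma occ_tendsto_UNIV:
  assumes f: "f \<in> path_space T"
  shows "(\<lambda>j. occ 1 (ball_cube j) (amp f)) \<longlonglongrightarrow> occ 1 UNIV (amp f)"
  unfolding occ_def
proof (rule nn_integral_LIMSEQ)
  note [measurable] = amp_measurable[OF f]
  have mono: "ball_cube j \<subseteq> ball_cube j'" if "j \<le> j'" for j j'
  proof
    fix t assume "t \<in> ball_cube j"
    then have "- real j' \<le> t $ i \<and> t $ i \<le> real j'" for i
      using that unfolding ball_cube_def mem_cube by (smt (verit) of_nat_mono)
    then show "t \<in> ball_cube j'" unfolding ball_cube_def mem_cube by blast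
  qed
  show "incseq (\<lambda>j t. indicator (ball_cube j) t * (if 1 < amp f t then 1 else 0 :: ennreal))"
    using mono by (auto simp: incseq_def le_fun_def indicator_def)
  show "(\<lambda>t. indicator (ball_cube j) t * (if 1 < amp f t then 1 else 0 :: ennreal)) \<in> borel_measurable lam" for j by measurable
  fix t :: "real^'l"
  obtain j0 where j0: "norm t \<le> real j0" using real_arch_simple by blast
  have "t \<in> ball_cube j" if "j \<ge> j0" for j
  proof -
    have "- real j \<le> t $ i \<and> t $ i \<le> real j" for i
      using j0 that component_le_norm_cart[of t i] by (smt (verit) of_nat_mono)
    then show ?thesis unfolding ball_cube_def mem_cube by blast
  qed
  then have "\<forall>\<^sub>F j in sequentially. t \<in> ball_cube j" by (rule eventually_sequentiallyI)
  then have "\<forall>\<^sub>F j in sequentially. indicator UNIV t * (if 1 < amp f t then 1 else 0 :: ennreal) = indicator (ball_cube j) t * (if 1 < amp f t then 1 else 0)"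
    by (rule eventually_mono) simp
  then show "(\<lambda>j. indicator (ball_cube j) t * (if 1 < amp f t then 1 else 0 :: ennreal)) \<longlonglongrightarrow> indicator UNIV t * (if 1 < amp f t then 1 else 0)"
    by (rule Lim_transform_eventually[OF tendsto_const])
qed

text \<open>
  The limit of \<open>ratio\<close> as the ramps increase to the indicator of exceeding \<open>1\<close>.
\<close>

definition sharp_ratio :: "real \<Rightarrow> (real^'l) set \<Rightarrow> (real^'l \<Rightarrow> real) \<Rightarrow> ennreal" where
  "sharp_ratio \<eta> K v = (if v 0 > 1 then 1 else 0) / max (ennreal \<eta>) (occ 1 K v)"

lemma sharp_ratio_measurable:
  assumes "measurable_process \<Omega> \<xi>" "K \<in> sets borel" shows "(\<lambda>\<omega>. sharp_ratio \<eta> K (\<xi> \<omega>)) \<in> borel_measurable \<Omega>"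
proof -
  have [measurable]: "(\<lambda>\<omega>. \<xi> \<omega> 0) \<in> borel_measurable \<Omega>"
    "(\<lambda>\<omega>. occ 1 K (\<xi> \<omega>)) \<in> borel_measurable \<Omega>"
    by (rule measurable_process_section[OF assms(1)], rule occ_measurable[OF assms])
  show ?thesis unfolding sharp_ratio_def by measurable
qed

lemma capped_le:
  assumes "\<eta> > 0" "c \<le> 1" shows "c / max (ennreal \<eta>) b \<le> ennreal (1 / \<eta>)"
proof -
  have "c / max (ennreal \<eta>) b \<le> c / ennreal \<eta>" by (rule divide_left_mono_ennreal) simp
  also have "\<dots> \<le> 1 / ennreal \<eta>" by (rule divide_right_mono_ennreal[OF assms(2)])
  also have "\<dots> = ennreal (1 / \<eta>)" using assms(1) divide_ennreal[of 1 \<eta>] by simp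
  finally show ?thesis .
qed

lemma peak_ge_origin: "v 0 > 1 \<Longrightarrow> peak v \<ge> 1"
  by (rule peak_ge[of 0]) auto

end

context rv_setting begin

text \<open>
  Dominated convergence for \<open>\<nu>\<close>: the paths with peak at least \<open>1\<close> have finite measure.
\<close>

lemma nu_dominated:
  assumes m: "\<And>n. u n \<in> borel_measurable paths" "u' \<in> borel_measurable paths"
    and B: "\<And>n f. f \<in> path_space T \<Longrightarrow> u n f \<le> ennreal B"
    and p: "\<And>n f. f \<in> path_space T \<Longrightarrow> u n f \<noteq> 0 \<Longrightarrow> peak (amp f) \<ge> 1"
    and lim: "\<And>f. f \<in> path_space T \<Longrightarrow> (\<lambda>n. u n f) \<longlonglongrightarrow> (u' f :: ennreal)"
  shows "(\<lambda>n. \<integral>\<^sup>+f. u n f \<partial>\<nu>) \<longlonglongrightarrow> (\<integral>\<^sup>+f. u' f \<partial>\<nu>)"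
proof -
  let ?P = "{f \<in> space \<nu>. peak (amp f) \<ge> 1}"
  have [measurable]: "(\<lambda>f. peak (amp f)) \<in> borel_measurable \<nu>"
    by (intro nu_measurable continuous_map_real_borel peak_continuous)
  have P[measurable]: "?P \<in> sets \<nu>" by measurable
  have path: "f \<in> path_space T" if "f \<in> space \<nu>" for f using that by (simp add: space_nu)
  show ?thesis
  proof (rule nn_integral_dominated_convergence[where w = "\<lambda>f. ennreal B * indicator ?P f"])
    show "u n \<in> borel_measurable \<nu>" for n by (rule nu_measurable[OF m(1)])
    show "u' \<in> borel_measurable \<nu>" by (rule nu_measurable[OF m(2)])
    show "(\<lambda>f. ennreal B * indicator ?P f) \<in> borel_measurable \<nu>" by measurable
    show "AE f in \<nu>. u n f \<le> ennreal B * indicator ?P f" for n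
    proof (rule AE_I2)
      fix f assume f: "f \<in> space \<nu>"
      show "u n f \<le> ennreal B * indicator ?P f"
        using B[OF path[OF f], of n] p[OF path[OF f], of n] f by (cases "u n f = 0") auto
    qed
    have "emeasure \<nu> ?P < \<infinity>" by (rule nu_bounded[OF P]) auto
    then show "(\<integral>\<^sup>+f. ennreal B * indicator ?P f \<partial>\<nu>) < \<infinity>"
      by (subst nn_integral_cmult_indicator[OF P]) (simp add: ennreal_mult_less_top)
    show "AE f in \<nu>. (\<lambda>n. u n f) \<longlonglongrightarrow> u' f" by (rule AE_I2) (rule lim[OF path])
  qed
qed

lemma avg_ratio_limit:
  assumes \<eta>: "\<eta> > 0"
  shows "(\<lambda>k. \<integral>\<^sup>+f. ennreal (avg_ratio i \<eta> j k f) \<partial>\<nu>) \<longlonglongrightarrow> (\<integral>\<^sup>+f. ratio i \<eta> j (amp f) \<partial>\<nu>)"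
proof (rule nu_dominated[where B = "1 / \<eta>"])
  show "(\<lambda>f. ennreal (avg_ratio i \<eta> j k f)) \<in> borel_measurable paths" for k
    using continuous_map_real_borel[OF avg_ratio_continuous[OF \<eta>]] by measurable
  show "(\<lambda>f. ratio i \<eta> j (amp f)) \<in> borel_measurable paths" by (rule ratio_measurable[OF paths_process])
  show "ennreal (avg_ratio i \<eta> j k f) \<le> ennreal (1 / \<eta>)" for k f by (intro ennreal_leI avg_ratio_bounds \<eta>)
  show "peak (amp f) \<ge> 1" if "f \<in> path_space T" "ennreal (avg_ratio i \<eta> j k f) \<noteq> 0" for k f
    using avg_ratio_nonzero[OF that(1), of i \<eta> j k] that(2) by fastforce
  fix f :: "real^'l \<Rightarrow> real^'d" assume f: "f \<in> path_space T"
  have mx: "max \<eta> (Wr i (ball_cube j) f) > 0" using \<eta> by simp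
  have b: "\<bar>ramp i r\<bar> \<le> 1" for r using ramp_bounds by (simp add: abs_le_iff)
  have "(\<lambda>k. avg_ratio i \<eta> j k f) \<longlonglongrightarrow> ramp i (amp f 0) / max \<eta> (Wr i (ball_cube j) f)"
    unfolding avg_ratio_def Wr_def[of i "corner _ _"]
    using mx by (intro tendsto_divide tendsto_const corner_average_tendsto[OF f T_zero ramp_continuous b]) auto
  then have "(\<lambda>k. ennreal (avg_ratio i \<eta> j k f)) \<longlonglongrightarrow> ennreal (ramp i (amp f 0) / max \<eta> (Wr i (ball_cube j) f))"
    by (rule tendsto_ennrealI)
  also have "ennreal (ramp i (amp f 0) / max \<eta> (Wr i (ball_cube j) f)) = ratio i \<eta> j (amp f)"
    unfolding ratio_def W_eq_Wr[OF f ball_cube_borel bounded_ball_cube] max_ennreal[OF Wr_nonneg]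
    by (rule divide_ennreal[OF ramp_bounds(1) mx, symmetric])
  finally show "(\<lambda>k. ennreal (avg_ratio i \<eta> j k f)) \<longlonglongrightarrow> ratio i \<eta> j (amp f)" .
qed

lemma ratio_limit:
  assumes \<eta>: "\<eta> > 0"
  shows "(\<lambda>i. \<integral>\<^sup>+f. ratio i \<eta> j (amp f) \<partial>\<nu>) \<longlonglongrightarrow> (\<integral>\<^sup>+f. sharp_ratio \<eta> (ball_cube j) (amp f) \<partial>\<nu>)"
proof (rule nu_dominated[where B = "1 / \<eta>"])
  show "(\<lambda>f. ratio i \<eta> j (amp f)) \<in> borel_measurable paths" for i by (rule ratio_measurable[OF paths_process])
  show "(\<lambda>f. sharp_ratio \<eta> (ball_cube j) (amp f)) \<in> borel_measurable paths"
    by (rule sharp_ratio_measurable[OF paths_process ball_cube_borel])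
  show "ratio i \<eta> j (amp f) \<le> ennreal (1 / \<eta>)" for i f
    unfolding ratio_def by (rule capped_le[OF \<eta>]) (simp add: ennreal_le_1 ramp_bounds)
  show "peak (amp f) \<ge> 1" if "ratio i \<eta> j (amp f) \<noteq> 0" for i f
  proof (rule peak_ge_origin)
    show "amp f 0 > 1" using that ramp_zero[of "amp f 0" i] by (cases "amp f 0 \<le> 1") (auto simp: ratio_def)
  qed
  fix f :: "real^'l \<Rightarrow> real^'d" assume f: "f \<in> path_space T"
  have "(\<lambda>i. ennreal (ramp i (amp f 0))) \<longlonglongrightarrow> ennreal (if amp f 0 > 1 then 1 else 0)"
    by (intro tendsto_ennrealI ramp_tendsto)
  moreover have "ennreal (if amp f 0 > 1 then 1 else 0) = (if amp f 0 > 1 then 1 else 0)" by simp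
  ultimately show "(\<lambda>i. ratio i \<eta> j (amp f)) \<longlonglongrightarrow> sharp_ratio \<eta> (ball_cube j) (amp f)"
    unfolding ratio_def sharp_ratio_def
    by (intro tendsto_ratio_ennreal \<eta> W_tendsto_occ[OF f ball_cube_borel]) auto
qed

lemma sharp_ratio_le: "\<eta> > 0 \<Longrightarrow> sharp_ratio \<eta> K v \<le> ennreal (1 / \<eta>)"
  unfolding sharp_ratio_def by (rule capped_le) auto

lemma sharp_ratio_limit:
  assumes \<eta>: "\<eta> > 0"
  shows "(\<lambda>j. \<integral>\<^sup>+f. sharp_ratio \<eta> (ball_cube j) (amp f) \<partial>\<nu>) \<longlonglongrightarrow> (\<integral>\<^sup>+f. sharp_ratio \<eta> UNIV (amp f) \<partial>\<nu>)"
proof (rule nu_dominated[where B = "1 / \<eta>"])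
  show "(\<lambda>f. sharp_ratio \<eta> (ball_cube j) (amp f)) \<in> borel_measurable paths" for j
    by (rule sharp_ratio_measurable[OF paths_process ball_cube_borel])
  show "(\<lambda>f. sharp_ratio \<eta> UNIV (amp f)) \<in> borel_measurable paths"
    by (rule sharp_ratio_measurable[OF paths_process]) simp
  show "sharp_ratio \<eta> (ball_cube j) (amp f) \<le> ennreal (1 / \<eta>)" for j f by (rule sharp_ratio_le[OF \<eta>])
  show "peak (amp f) \<ge> 1" if "sharp_ratio \<eta> (ball_cube j) (amp f) \<noteq> 0" for j f
    by (rule peak_ge_origin) (use that in \<open>auto simp: sharp_ratio_def split: if_splits\<close>)
  fix f :: "real^'l \<Rightarrow> real^'d" assume f: "f \<in> path_space T"
  show "(\<lambda>j. sharp_ratio \<eta> (ball_cube j) (amp f)) \<longlonglongrightarrow> sharp_ratio \<eta> UNIV (amp f)"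
    unfolding sharp_ratio_def by (intro tendsto_ratio_ennreal \<eta> tendsto_const occ_tendsto_UNIV[OF f]) auto
qed

text \<open>
  The part of \<open>thin_bound\<close> that survives as the ramps steepen, as a function of the occupation \<open>b\<close> and of the peak \<open>r\<close>. The first
  factor of \<open>thin_bound\<close> is replaced by the indicator of \<open>r > 1\<close>, which bounds it for every \<open>i\<close>.
\<close>

definition thin_limit :: "real \<Rightarrow> ennreal \<Rightarrow> real \<Rightarrow> ennreal" where
  "thin_limit \<eta> b r = (if r > 1 then ennreal (max 0 (min 1 (2 - enn2real b / \<eta>))) else 0)"

lemma thin_limit_le: "thin_limit \<eta> b r \<le> ennreal 1"
  unfolding thin_limit_def by (auto intro!: ennreal_leI simp del: ennreal_1)

lemma peak_paths_measurable: "(\<lambda>f. peak (amp f)) \<in> borel_measurable paths"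
  by (intro continuous_map_real_borel peak_continuous)

lemma thin_bound_le_limit:
  assumes f: "f \<in> path_space T"
  shows "ennreal (thin_bound i \<eta> f) \<le> thin_limit \<eta> (W i (ball_cube reach) (amp f)) (peak (amp f))"
proof (cases "peak (amp f) > 1")
  case True
  have "thin_bound i \<eta> f \<le> 1 * max 0 (min 1 (2 - Wr i (ball_cube reach) f / \<eta>))"
    unfolding thin_bound_def by (intro mult_right_mono ramp_bounds) simp
  then have le: "thin_bound i \<eta> f \<le> max 0 (min 1 (2 - Wr i (ball_cube reach) f / \<eta>))" by (simp only: mult_1)
  have eq: "enn2real (W i (ball_cube reach) (amp f)) = Wr i (ball_cube reach) f"
    unfolding W_eq_Wr[OF f ball_cube_borel bounded_ball_cube] by (rule enn2real_ennreal[OF Wr_nonneg])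
  show ?thesis unfolding thin_limit_def eq if_P[OF True] by (rule ennreal_leI[OF le])
qed (simp add: thin_bound_def ramp_zero)

lemma thin_tendsto:
  assumes \<eta>: "\<eta> > 0"
  shows "(\<lambda>i. \<integral>\<^sup>+f. thin_limit \<eta> (W i (ball_cube reach) (amp f)) (peak (amp f)) \<partial>\<nu>) \<longlonglongrightarrow>
    (\<integral>\<^sup>+f. thin_limit \<eta> (occ 1 (ball_cube reach) (amp f)) (peak (amp f)) \<partial>\<nu>)"
proof (rule nu_dominated[where B = 1])
  note [measurable] = peak_paths_measurable W_measurable[OF paths_process ball_cube_borel] occ_measurable[OF paths_process ball_cube_borel]
  show "(\<lambda>f. thin_limit \<eta> (W i (ball_cube reach) (amp f)) (peak (amp f))) \<in> borel_measurable paths" for i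
    unfolding thin_limit_def by measurable
  show "(\<lambda>f. thin_limit \<eta> (occ 1 (ball_cube reach) (amp f)) (peak (amp f))) \<in> borel_measurable paths"
    unfolding thin_limit_def by measurable
  show "peak (amp f) \<ge> 1" if "thin_limit \<eta> (W i (ball_cube reach) (amp f)) (peak (amp f)) \<noteq> 0" for i f
    using that by (auto simp: thin_limit_def split: if_splits)
  fix f :: "real^'l \<Rightarrow> real^'d" assume f: "f \<in> path_space T"
  have "occ 1 (ball_cube reach) (amp f) \<le> (\<integral>\<^sup>+t. indicator (ball_cube reach) t \<partial>lam)"
    unfolding occ_def by (intro nn_integral_mono) (auto simp: indicator_def)
  also have "\<dots> < top" using lam_bounded[OF bounded_ball_cube, of reach] by (subst nn_integral_indicator) auto
  finally have fin: "occ 1 (ball_cube reach) (amp f) < top" .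
  have lim: "(\<lambda>i. enn2real (W i (ball_cube reach) (amp f))) \<longlonglongrightarrow> enn2real (occ 1 (ball_cube reach) (amp f))"
    by (rule tendsto_enn2real) (use fin W_tendsto_occ[OF f ball_cube_borel] in simp_all)
  show "(\<lambda>i. thin_limit \<eta> (W i (ball_cube reach) (amp f)) (peak (amp f))) \<longlonglongrightarrow> thin_limit \<eta> (occ 1 (ball_cube reach) (amp f)) (peak (amp f))"
  proof (cases "peak (amp f) > 1")
    case True
    have "(\<lambda>i. max 0 (min 1 (2 - enn2real (W i (ball_cube reach) (amp f)) / \<eta>))) \<longlonglongrightarrow>
      max 0 (min 1 (2 - enn2real (occ 1 (ball_cube reach) (amp f)) / \<eta>))"
      using \<eta> by (intro tendsto_max tendsto_min tendsto_diff tendsto_divide tendsto_const lim) simp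
    then show ?thesis unfolding thin_limit_def if_P[OF True] by (rule tendsto_ennrealI)
  qed (simp add: thin_limit_def)
qed (rule thin_limit_le)

text \<open>
  The bump vanishes outside the cube of radius \<open>reach\<close>, so a peak above \<open>1\<close> is due to an exceedance inside it.
\<close>

lemma occ_ball_pos:
  assumes f: "f \<in> path_space T" and p: "peak (amp f) > 1"
  shows "occ 1 (ball_cube reach) (amp f) > 0"
proof -
  obtain t where t: "norm t < real CARD('l) + 2" "amp f t > 1" "bump t > 1" 
    by (rule peak_high[where v = "amp f", OF p]) simp
  have "t \<in> T" using t(2) amp_off[OF f, of t] by (cases "t \<in> T") auto
  define \<delta> where "\<delta> = real CARD('l) + 2 - norm t"
  have "\<delta> > 0" using t(1) by (simp add: \<delta>_def)
  moreover have "corner t \<delta> \<subseteq> ball_cube reach"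
  proof
    fix s assume "s \<in> corner t \<delta>"
    then have s: "t $ i \<le> s $ i \<and> s $ i \<le> t $ i + \<delta>" for i unfolding mem_corner by blast
    have "real reach = real CARD('l) + 2" by (simp add: reach_def)
    then have "- real reach \<le> s $ i \<and> s $ i \<le> real reach" for i
      using s[of i] component_le_norm_cart[of t i] t(1) unfolding \<delta>_def by linarith
    then show "s \<in> ball_cube reach" unfolding ball_cube_def mem_cube by blast
  qed
  ultimately show ?thesis by (intro occ_pos[OF f \<open>t \<in> T\<close> t(2)] ball_cube_borel)
qed

text \<open>
  A path with peak above \<open>1\<close> has positive occupation, so its contribution is \<open>0\<close> as soon as \<open>2\<eta>\<close> is smaller than that.
\<close>

lemma thin_limit_vanishes:
  "(\<lambda>k. \<integral>\<^sup>+f. thin_limit (1 / real (Suc k)) (occ 1 (ball_cube reach) (amp f)) (peak (amp f)) \<partial>\<nu>) \<longlonglongrightarrow> 0"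
proof -
  have "(\<lambda>k. \<integral>\<^sup>+f. thin_limit (1 / real (Suc k)) (occ 1 (ball_cube reach) (amp f)) (peak (amp f)) \<partial>\<nu>) \<longlonglongrightarrow> (\<integral>\<^sup>+f. 0 \<partial>\<nu>)"
  proof (rule nu_dominated[where B = 1])
    note [measurable] = peak_paths_measurable occ_measurable[OF paths_process ball_cube_borel]
    show "(\<lambda>f. thin_limit (1 / real (Suc k)) (occ 1 (ball_cube reach) (amp f)) (peak (amp f))) \<in> borel_measurable paths" for k
      unfolding thin_limit_def by measurable
    show "peak (amp f) \<ge> 1" if "thin_limit (1 / real (Suc k)) (occ 1 (ball_cube reach) (amp f)) (peak (amp f)) \<noteq> 0" for k f
      using that by (auto simp: thin_limit_def split: if_splits)
    fix f :: "real^'l \<Rightarrow> real^'d" assume f: "f \<in> path_space T"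
    show "(\<lambda>k. thin_limit (1 / real (Suc k)) (occ 1 (ball_cube reach) (amp f)) (peak (amp f))) \<longlonglongrightarrow> 0"
    proof (cases "peak (amp f) > 1")
      case True
      let ?o = "enn2real (occ 1 (ball_cube reach) (amp f))"
      have "occ 1 (ball_cube reach) (amp f) \<le> (\<integral>\<^sup>+t. indicator (ball_cube reach) t \<partial>lam)"
        unfolding occ_def by (intro nn_integral_mono) (auto simp: indicator_def)
      also have "\<dots> < top" using lam_bounded[OF bounded_ball_cube, of reach] by (subst nn_integral_indicator) auto
      finally have "?o > 0" using occ_ball_pos[OF f True] by (simp add: enn2real_positive_iff)
      then obtain n where n: "2 < real n * ?o" using reals_Archimedean3 by blast
      have "thin_limit (1 / real (Suc k)) (occ 1 (ball_cube reach) (amp f)) (peak (amp f)) = 0" if "k \<ge> n" for k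
      proof -
        have "real n * ?o \<le> real (Suc k) * ?o" using that by (intro mult_right_mono) auto
        then have "2 - ?o / (1 / real (Suc k)) \<le> 0" using n by (simp add: mult.commute)
        then have "max 0 (min 1 (2 - ?o / (1 / real (Suc k)))) = 0" by linarith
        then show ?thesis by (simp only: thin_limit_def ennreal_0 if_cancel)
      qed
      then have "\<forall>\<^sub>F k in sequentially. 0 = thin_limit (1 / real (Suc k)) (occ 1 (ball_cube reach) (amp f)) (peak (amp f))"
        by (intro eventually_sequentiallyI[of n]) simp
      then show ?thesis by (rule Lim_transform_eventually[OF tendsto_const])
    qed (simp add: thin_limit_def)
  qed (simp, rule thin_limit_le)
  then show ?thesis by simp
qed

text \<open>
  The extremal index \<open>\<theta>\<^sub>Y\<close>, expressed through the tail measure.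
\<close>

definition cluster :: ennreal where
  "cluster = (\<integral>\<^sup>+f. (if amp f 0 > 1 then 1 else 0) / occ 1 UNIV (amp f) \<partial>\<nu>)"

lemma sharp_ratio_le_cluster: "(\<integral>\<^sup>+f. sharp_ratio \<eta> UNIV (amp f) \<partial>\<nu>) \<le> cluster"
  unfolding cluster_def sharp_ratio_def by (intro nn_integral_mono divide_left_mono_ennreal) simp

end

section \<open>The asymptotic bound\<close>

lemma small_ennreal:
  assumes "b > (0 :: ennreal)" obtains n where "ennreal (1 / real (Suc n)) < b"
proof (cases b rule: ennreal_cases)
  case (real r)
  then have "r > 0" using assms by simp
  then obtain n where "1 / real (Suc n) < r" by (rule nat_approx_posE)
  then have "ennreal (1 / real (Suc n)) < b" using real by (simp add: ennreal_less_iff)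
  then show ?thesis by (rule that)
next
  case top
  then have "ennreal (1 / real (Suc 0)) < b" by simp
  then show ?thesis by (rule that)
qed

context path_setting begin

lemma emeasure_window:
  "emeasure lam (window n) = ennreal ((real n + (2 * real reach + (if T = UNIV then 0 else 1))) ^ CARD('l))"
proof -
  have "window n = cube (of_int (- int reach)) (of_int (int n + int reach))" by (simp add: window_def)
  moreover have "of_int (int n + int reach - (- int reach)) + (if T = UNIV then 0 else 1) =
    real n + (2 * real reach + (if T = UNIV then 0 else 1))" by simp
  moreover have "- int reach \<le> int n + int reach" by simp
  ultimately show ?thesis by (simp only: emeasure_lam_cube)
qed

end

context stationary_rv_setting begin

lemma emeasure_inner:
  assumes "n \<ge> 2 * j"
  shows "emeasure lam (inner j n) = ennreal ((real n + (2 * real reach - 2 * real j + (if T = UNIV then 0 else 1))) ^ CARD('l))"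
proof -
  have "inner j n = cube (of_int (int j - int reach)) (of_int (int n + int reach - int j))" by (simp add: inner_def)
  moreover have "of_int (int n + int reach - int j - (int j - int reach)) + (if T = UNIV then 0 else 1) =
    real n + (2 * real reach - 2 * real j + (if T = UNIV then 0 else 1))" by simp
  moreover have "int j - int reach \<le> int n + int reach - int j" using assms by linarith
  ultimately show ?thesis by (simp only: emeasure_lam_cube)
qed

end

context limit_setting begin

text \<open>
  The choice of \<open>m\<close>: since \<open>a\<^sub>m\<close> is \<open>m\<close> to the power \<open>1/\<alpha>\<close>, the hypothesis on \<open>m\<close> says that \<open>level i\<close> times \<open>a\<^sub>m\<close> is at most
  \<open>a\<^sub>n\<^sup>l x\<close>.
\<close>

lemma sup_event_sub:
  assumes x: "x > 0" and m: "m > 0" "real m \<le> real n ^ CARD('l) * (x / level i) powr \<alpha>"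
  shows "{\<omega> \<in> space M. path_max nrm T n (X \<omega>) > ennreal (a n ^ CARD('l) * x)}
    \<subseteq> {\<omega> \<in> space M. \<exists>t\<in>T \<inter> cube 0 (real n). amp (Xs m \<omega>) t > level i}"
proof
  fix \<omega> assume "\<omega> \<in> {\<omega> \<in> space M. path_max nrm T n (X \<omega>) > ennreal (a n ^ CARD('l) * x)}"
  then have \<omega>: "\<omega> \<in> space M" and "path_max nrm T n (X \<omega>) > ennreal (a n ^ CARD('l) * x)" by auto
  then obtain t where t: "t \<in> cbox 0 (\<chi> i. real n)" "t \<in> T" "ennreal (a n ^ CARD('l) * x) < ennreal (nrm (X \<omega> t))"
    unfolding path_max_def less_SUP_iff by blast
  have an: "a n \<ge> 0" by (simp add: a)
  then have gt: "a n ^ CARD('l) * x < amp (X \<omega>) t"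
    using t(3) x by (simp add: amp_def ennreal_less_iff)
  have am: "a m > 0" using m(1) by (simp add: a)
  have lv: "level i > 0" by (simp add: level_def add_pos_pos)
  have "a m \<le> (real n ^ CARD('l) * (x / level i) powr \<alpha>) powr (1 / \<alpha>)"
    unfolding a using m \<alpha> by (intro powr_mono2) auto
  also have "\<dots> = (real n ^ CARD('l)) powr (1 / \<alpha>) * (x / level i)"
    using x lv \<alpha> by (simp add: powr_mult powr_powr)
  also have "(real n ^ CARD('l)) powr (1 / \<alpha>) = a n ^ CARD('l)"
  proof (cases "n = 0")
    case False
    then show ?thesis by (simp add: a powr_power powr_realpow[symmetric] powr_powr mult.commute)
  next
    case True
    have z: "(0::real) ^ CARD('l) = 0" by (intro zero_power) simp
    have an0: "a 0 = 0" unfolding a by simp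
    show ?thesis unfolding True of_nat_0 an0 z by simp
  qed
  finally have "level i * a m \<le> a n ^ CARD('l) * x" using lv by (simp add: field_simps)
  then have "level i * a m < amp (X \<omega>) t" using gt by linarith
  moreover have "amp (Xs m \<omega>) t = amp (X \<omega>) t / a m"
    unfolding Xs_def[abs_def] amp_scaleR using am by (simp add: field_simps)
  ultimately have "amp (Xs m \<omega>) t > level i" using am by (simp add: pos_less_divide_eq)
  moreover have "t \<in> cube 0 (real n)" using t(1) by (simp add: cube_def zero_vec_def)
  ultimately show "\<omega> \<in> {\<omega> \<in> space M. \<exists>t\<in>T \<inter> cube 0 (real n). amp (Xs m \<omega>) t > level i}"
    using \<omega> t(2) by blast
qed

text \<open>
  The limit in \<open>n\<close>, with all smoothing parameters fixed. The three terms come from the cells, from the inner part of the window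
  and from its boundary; the last one vanishes because the boundary has volume of smaller order than \<open>m\<close>.
\<close>

lemma limsup_le_avg_ratio:
  assumes x: "x > 0" and \<eta>: "\<eta> > 0"
  shows "limsup (\<lambda>n. emeasure M {\<omega> \<in> space M. path_max nrm T n (X \<omega>) > ennreal (a n ^ CARD('l) * x)})
    \<le> ennreal ((level i / x) powr \<alpha>) *
      ((\<integral>\<^sup>+f. ennreal (thin_bound i \<eta> f) \<partial>\<nu>) + (\<integral>\<^sup>+f. ennreal (avg_ratio i \<eta> j k f) \<partial>\<nu>))"
proof -
  define l where "l = CARD('l)"
  have l: "l > 0" by (simp add: l_def)
  define \<kappa> where "\<kappa> = (x / level i) powr \<alpha>"
  have lv: "level i > 0" by (simp add: level_def add_pos_pos)
  have \<kappa>: "\<kappa> > 0" using x lv by (simp add: \<kappa>_def)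
  have inv: "1 / \<kappa> = (level i / x) powr \<alpha>"
  proof -
    have "(level i / x) powr \<alpha> * \<kappa> = 1" unfolding \<kappa>_def using x lv by (simp flip: powr_mult)
    then show ?thesis using \<kappa> by (simp add: field_simps)
  qed
  define m where "m n = nat \<lfloor>real n ^ l * \<kappa>\<rfloor>" for n
  have "filterlim (\<lambda>n. real n ^ l) at_top sequentially"
    by (rule filterlim_pow_at_top[OF l filterlim_real_sequentially])
  then have "filterlim (\<lambda>n. \<kappa> * real n ^ l) at_top sequentially"
    by (rule filterlim_tendsto_pos_mult_at_top[OF tendsto_const \<kappa>])
  then have top: "filterlim (\<lambda>n. real n ^ l * \<kappa>) at_top sequentially" by (simp only: mult.commute)
  have m_top: "filterlim m at_top sequentially"
    unfolding m_def[abs_def]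
    by (rule filterlim_compose[OF filterlim_nat_sequentially filterlim_compose[OF filterlim_floor_sequentially top]])
  define d :: real where "d = (if T = UNIV then 0 else 1)"
  define c2 where "c2 = 2 * real reach + d"
  define c3 where "c3 = 2 * real reach - 2 * real (Suc j) + d"
  define E1 where "E1 m = of_nat m * (\<integral>\<^sup>+\<omega>. ennreal (thin_bound i \<eta> (Xs m \<omega>)) \<partial>M)" for m
  define E2 where "E2 m = of_nat m * (\<integral>\<^sup>+\<omega>. ennreal (avg_ratio i \<eta> j k (Xs m \<omega>)) \<partial>M)" for m
  let ?H = "\<integral>\<^sup>+f. ennreal (thin_bound i \<eta> f) \<partial>\<nu>"
  let ?V = "\<integral>\<^sup>+f. ennreal (avg_ratio i \<eta> j k f) \<partial>\<nu>"
  have E1: "(\<lambda>n. E1 (m n)) \<longlonglongrightarrow> ?H"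
    unfolding E1_def by (rule filterlim_compose[OF thin_bound_vague[OF \<eta>] m_top])
  have E2: "(\<lambda>n. E2 (m n)) \<longlonglongrightarrow> ?V"
    unfolding E2_def by (rule filterlim_compose[OF avg_ratio_vague[OF \<eta>] m_top])
  define r where "r c n = (real n + c) ^ l / real (m n)" for c n
  have r: "(\<lambda>n. r c n) \<longlonglongrightarrow> 1 / \<kappa>" for c
    unfolding r_def m_def by (rule power_ratio_tendsto[OF \<kappa> l])
  have re: "(\<lambda>n. ennreal (r c n)) \<longlonglongrightarrow> ennreal (1 / \<kappa>)" for c by (intro tendsto_ennrealI r)
  have fin: "ennreal (1 / \<kappa>) \<noteq> 0" "ennreal (1 / \<kappa>) \<noteq> top" using \<kappa> by auto
  have r3: "(\<lambda>n. ennreal ((r c2 n - r c3 n) / \<eta>)) \<longlonglongrightarrow> ennreal ((1 / \<kappa> - 1 / \<kappa>) / \<eta>)"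
    by (intro tendsto_ennrealI tendsto_divide tendsto_diff r tendsto_const) (use \<eta> in simp)
  let ?R = "\<lambda>n. ennreal (r 1 n) * E1 (m n) + (ennreal (r c2 n) * E2 (m n) + ennreal ((r c2 n - r c3 n) / \<eta>))"
  have "(\<lambda>n. ?R n) \<longlonglongrightarrow> ennreal (1 / \<kappa>) * ?H + (ennreal (1 / \<kappa>) * ?V + ennreal ((1 / \<kappa> - 1 / \<kappa>) / \<eta>))"
    using fin by (intro tendsto_add tendsto_mult_ennreal re E1 E2 r3) auto
  then have R: "(\<lambda>n. ?R n) \<longlonglongrightarrow> ennreal (1 / \<kappa>) * (?H + ?V)" by (simp add: distrib_left)
  have ev: "\<forall>\<^sub>F n in sequentially. emeasure M {\<omega> \<in> space M. path_max nrm T n (X \<omega>) > ennreal (a n ^ CARD('l) * x)} \<le> ?R n"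
    using eventually_ge_at_top[of "2 * Suc j"] filterlim_at_top[THEN iffD1, OF m_top, rule_format, of 1]
  proof eventually_elim
    case (elim n)
    then have mpos: "m n > 0" by simp
    have "real (m n) \<le> real n ^ CARD('l) * (x / level i) powr \<alpha>"
      unfolding m_def l_def[symmetric] \<kappa>_def[symmetric] using \<kappa> by simp
    from sup_prob_le[OF \<eta> sup_event_sub[OF x mpos this], of "Suc j"]
    have "emeasure M {\<omega> \<in> space M. path_max nrm T n (X \<omega>) > ennreal (a n ^ CARD('l) * x)}
      \<le> of_nat ((n + 1) ^ l) * (\<integral>\<^sup>+\<omega>. ennreal (thin_bound i \<eta> (Xs (m n) \<omega>)) \<partial>M) +
      (emeasure lam (inner (Suc j) n) * mean_ratio i \<eta> (Suc j) (m n) + emeasure lam (window n - inner (Suc j) n) * (mean_ramp i (m n) / ennreal \<eta>))"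
      by (simp only: l_def)
    also have "\<dots> \<le> ?R n"
    proof (intro add_mono)
      have split: "ennreal A = ennreal (A / real (m n)) * of_nat (m n)" if "A \<ge> 0" for A
        using mpos that by (simp add: ennreal_of_nat_eq_real_of_nat ennreal_mult'[symmetric] flip: ennreal_mult)
      have "of_nat ((n + 1) ^ l) = ennreal ((real n + 1) ^ l)"
        by (simp add: ennreal_of_nat_eq_real_of_nat add.commute)
      also have "\<dots> = ennreal (r 1 n) * of_nat (m n)" unfolding r_def by (rule split) simp
      finally show "of_nat ((n + 1) ^ l) * (\<integral>\<^sup>+\<omega>. ennreal (thin_bound i \<eta> (Xs (m n) \<omega>)) \<partial>M) \<le> ennreal (r 1 n) * E1 (m n)"
        by (simp add: E1_def mult.assoc)
      have win: "emeasure lam (window n) = ennreal ((real n + c2) ^ l)"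
        unfolding emeasure_window c2_def d_def l_def ..
      have c2: "c2 \<ge> 0" by (simp add: c2_def d_def)
      have inn: "emeasure lam (inner (Suc j) n) = ennreal ((real n + c3) ^ l)"
        using emeasure_inner[OF elim(1)] unfolding c3_def d_def l_def .
      have c3: "real n + c3 \<ge> 0" "c3 \<le> c2" using elim(1) by (auto simp: c3_def c2_def d_def)
      have "emeasure lam (inner (Suc j) n) * mean_ratio i \<eta> (Suc j) (m n)
        \<le> emeasure lam (window n) * (\<integral>\<^sup>+\<omega>. ennreal (avg_ratio i \<eta> j k (Xs (m n) \<omega>)) \<partial>M)"
        by (intro mult_mono emeasure_mono inner_sub mean_ratio_bounds_by_avg(1)[OF \<eta>]) simp_all
      also have "emeasure lam (window n) = ennreal (r c2 n) * of_nat (m n)"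
        unfolding win r_def using c2 by (intro split) simp
      finally show "emeasure lam (inner (Suc j) n) * mean_ratio i \<eta> (Suc j) (m n) \<le> ennreal (r c2 n) * E2 (m n)"
        by (simp add: E2_def mult.assoc)
      have pw: "(real n + c3) ^ l \<le> (real n + c2) ^ l" using c3 by (intro power_mono) auto
      have "emeasure lam (window n - inner (Suc j) n) = ennreal ((real n + c2) ^ l) - ennreal ((real n + c3) ^ l)"
        using emeasure_Diff[of lam "inner (Suc j) n" "window n"] inner_sub[of "Suc j" n] by (simp add: win inn)
      also have "\<dots> = ennreal ((real n + c2) ^ l - (real n + c3) ^ l)" using c3 by (intro ennreal_minus) simp
      finally have "emeasure lam (window n - inner (Suc j) n) * (mean_ramp i (m n) / ennreal \<eta>)
        \<le> ennreal ((real n + c2) ^ l - (real n + c3) ^ l) * (ennreal (1 / real (m n)) / ennreal \<eta>)"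
        by (simp add: mult_left_mono divide_right_mono_ennreal mean_ramp_le[OF mpos])
      also have "\<dots> = ennreal ((real n + c2) ^ l - (real n + c3) ^ l) * ennreal (1 / real (m n) / \<eta>)"
        using \<eta> by (subst divide_ennreal) auto
      also have "\<dots> = ennreal (((real n + c2) ^ l - (real n + c3) ^ l) * (1 / real (m n) / \<eta>))"
        using pw by (intro ennreal_mult'[symmetric]) simp
      also have "((real n + c2) ^ l - (real n + c3) ^ l) * (1 / real (m n) / \<eta>) = (r c2 n - r c3 n) / \<eta>"
        by (simp add: r_def diff_divide_distrib)
      finally show "emeasure lam (window n - inner (Suc j) n) * (mean_ramp i (m n) / ennreal \<eta>) \<le> ennreal ((r c2 n - r c3 n) / \<eta>)" .
    qed
    finally show ?case .
  qed
  have "limsup (\<lambda>n. emeasure M {\<omega> \<in> space M. path_max nrm T n (X \<omega>) > ennreal (a n ^ CARD('l) * x)}) \<le> limsup ?R"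
    by (rule Limsup_mono[OF ev])
  also have "\<dots> = ennreal (1 / \<kappa>) * (?H + ?V)" by (rule lim_imp_Limsup[OF _ R]) simp
  finally show ?thesis unfolding inv .
qed

text \<open>
  The smoothing parameters are removed in the order \<open>k \<rightarrow> \<infinity>\<close>, \<open>i \<rightarrow> \<infinity>\<close>, \<open>j \<rightarrow> \<infinity>\<close>, \<open>\<eta> \<rightarrow> 0\<close>. The cap \<open>\<eta>\<close> goes last, since it
  provides the domination for the limits in \<open>i\<close> and \<open>j\<close>; in the quotient it is then simply dropped.
\<close>

lemma limsup_le_cluster:
  assumes x: "x > 0"
  shows "limsup (\<lambda>n. emeasure M {\<omega> \<in> space M. path_max nrm T n (X \<omega>) > ennreal (a n ^ CARD('l) * x)})
    \<le> ennreal (x powr (- \<alpha>)) * cluster" (is "?P \<le> _")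
proof -
  let ?S = "\<lambda>\<eta>. \<integral>\<^sup>+f. thin_limit \<eta> (occ 1 (ball_cube reach) (amp f)) (peak (amp f)) \<partial>\<nu>"
  have xp: "ennreal (x powr (- \<alpha>)) \<noteq> 0" "ennreal (x powr (- \<alpha>)) \<noteq> top" using x by auto
  have step1: "?P \<le> ennreal ((level i / x) powr \<alpha>) *
      ((\<integral>\<^sup>+f. thin_limit \<eta> (W i (ball_cube reach) (amp f)) (peak (amp f)) \<partial>\<nu>) + (\<integral>\<^sup>+f. ratio i \<eta> j (amp f) \<partial>\<nu>))"
    if \<eta>: "\<eta> > 0" for \<eta> i j
  proof -
    have nz: "ennreal ((level i / x) powr \<alpha>) \<noteq> 0" "ennreal ((level i / x) powr \<alpha>) \<noteq> top"
      using x by (auto simp: level_def add_pos_pos add_nonneg_eq_0_iff)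
    have "?P \<le> ennreal ((level i / x) powr \<alpha>) *
      ((\<integral>\<^sup>+f. ennreal (thin_bound i \<eta> f) \<partial>\<nu>) + (\<integral>\<^sup>+f. ratio i \<eta> j (amp f) \<partial>\<nu>))"
    proof (rule LIMSEQ_le_const)
      show "(\<lambda>k. ennreal ((level i / x) powr \<alpha>) *
        ((\<integral>\<^sup>+f. ennreal (thin_bound i \<eta> f) \<partial>\<nu>) + (\<integral>\<^sup>+f. ennreal (avg_ratio i \<eta> j k f) \<partial>\<nu>)))
        \<longlonglongrightarrow> ennreal ((level i / x) powr \<alpha>) *
        ((\<integral>\<^sup>+f. ennreal (thin_bound i \<eta> f) \<partial>\<nu>) + (\<integral>\<^sup>+f. ratio i \<eta> j (amp f) \<partial>\<nu>))"
        using nz by (intro tendsto_mult_ennreal tendsto_add tendsto_const avg_ratio_limit[OF \<eta>]) auto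
    qed (use limsup_le_avg_ratio[OF x \<eta>] in blast)
    also have "\<dots> \<le> ennreal ((level i / x) powr \<alpha>) *
      ((\<integral>\<^sup>+f. thin_limit \<eta> (W i (ball_cube reach) (amp f)) (peak (amp f)) \<partial>\<nu>) + (\<integral>\<^sup>+f. ratio i \<eta> j (amp f) \<partial>\<nu>))"
      by (intro mult_left_mono add_right_mono nn_integral_mono thin_bound_le_limit) (auto simp: space_nu)
    finally show ?thesis .
  qed
  have step2: "?P \<le> ennreal (x powr (- \<alpha>)) * (?S \<eta> + (\<integral>\<^sup>+f. sharp_ratio \<eta> (ball_cube j) (amp f) \<partial>\<nu>))"
    if \<eta>: "\<eta> > 0" for \<eta> j
  proof (rule LIMSEQ_le_const)
    have "(\<lambda>i. 1 + 1 / (real i + 1)) \<longlonglongrightarrow> 1 + 0"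
      using lim_const_over_n[of "1::real", THEN LIMSEQ_Suc] by (intro tendsto_add tendsto_const) (simp add: add.commute)
    then have "(\<lambda>i. (level i / x) powr \<alpha>) \<longlonglongrightarrow> (1 / x) powr \<alpha>"
      unfolding level_def using x by (intro tendsto_powr tendsto_divide tendsto_const) auto
    moreover have "(1 / x) powr \<alpha> = x powr (- \<alpha>)" using x by (simp add: powr_minus_divide powr_divide)
    ultimately have "(\<lambda>i. ennreal ((level i / x) powr \<alpha>)) \<longlonglongrightarrow> ennreal (x powr (- \<alpha>))" by (simp add: tendsto_ennrealI)
    then show "(\<lambda>i. ennreal ((level i / x) powr \<alpha>) *
      ((\<integral>\<^sup>+f. thin_limit \<eta> (W i (ball_cube reach) (amp f)) (peak (amp f)) \<partial>\<nu>) + (\<integral>\<^sup>+f. ratio i \<eta> j (amp f) \<partial>\<nu>)))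
      \<longlonglongrightarrow> ennreal (x powr (- \<alpha>)) * (?S \<eta> + (\<integral>\<^sup>+f. sharp_ratio \<eta> (ball_cube j) (amp f) \<partial>\<nu>))"
      using xp by (intro tendsto_mult_ennreal tendsto_add thin_tendsto[OF \<eta>] ratio_limit[OF \<eta>]) auto
  qed (use step1[OF \<eta>] in blast)
  have step3: "?P \<le> ennreal (x powr (- \<alpha>)) * (?S \<eta> + cluster)" if \<eta>: "\<eta> > 0" for \<eta>
  proof -
    have "?P \<le> ennreal (x powr (- \<alpha>)) * (?S \<eta> + (\<integral>\<^sup>+f. sharp_ratio \<eta> UNIV (amp f) \<partial>\<nu>))"
    proof (rule LIMSEQ_le_const)
      show "(\<lambda>j. ennreal (x powr (- \<alpha>)) * (?S \<eta> + (\<integral>\<^sup>+f. sharp_ratio \<eta> (ball_cube j) (amp f) \<partial>\<nu>)))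
        \<longlonglongrightarrow> ennreal (x powr (- \<alpha>)) * (?S \<eta> + (\<integral>\<^sup>+f. sharp_ratio \<eta> UNIV (amp f) \<partial>\<nu>))"
        using xp by (intro tendsto_mult_ennreal tendsto_add tendsto_const sharp_ratio_limit[OF \<eta>]) auto
    qed (use step2[OF \<eta>] in blast)
    also have "\<dots> \<le> ennreal (x powr (- \<alpha>)) * (?S \<eta> + cluster)"
      by (intro mult_left_mono add_left_mono sharp_ratio_le_cluster) simp
    finally show ?thesis .
  qed
  have "?P \<le> ennreal (x powr (- \<alpha>)) * (0 + cluster)"
  proof (rule LIMSEQ_le_const)
    show "(\<lambda>k. ennreal (x powr (- \<alpha>)) * (?S (1 / real (Suc k)) + cluster)) \<longlonglongrightarrow> ennreal (x powr (- \<alpha>)) * (0 + cluster)"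
      using xp by (intro tendsto_mult_ennreal tendsto_add tendsto_const thin_limit_vanishes) auto
    have "1 / real (Suc k) > 0" for k by simp
    then show "\<exists>N. \<forall>k\<ge>N. ?P \<le> ennreal (x powr (- \<alpha>)) * (?S (1 / real (Suc k)) + cluster)" using step3 by blast
  qed
  then show ?thesis by simp
qed

text \<open>
  The bound for the unit cube is uniform in \<open>i\<close> and \<open>\<eta>\<close> and passes to \<open>\<nu>\<close> with the radius \<open>2\<close> in the denominator. A larger
  denominator only decreases the quotient, and Fatou's lemma removes the cap.
\<close>

lemma cluster_finite: "cluster < \<infinity>"
proof -
  define b where "b = emeasure lam (corner 0 1)"
  have b: "b \<noteq> 0" "b \<noteq> top" unfolding b_def
    using lam_corner_pos[OF T_zero, of 1] lam_corner_finite[of 0 1] by auto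
  let ?H = "\<integral>\<^sup>+f. ennreal (high_peak f) \<partial>\<nu>"
  have P[measurable]: "{f \<in> space \<nu>. peak (amp f) \<ge> 1/2} \<in> sets \<nu>"
  proof -
    have [measurable]: "(\<lambda>f. peak (amp f)) \<in> borel_measurable \<nu>" by (rule nu_measurable[OF peak_paths_measurable])
    show ?thesis by measurable
  qed
  have "?H \<le> (\<integral>\<^sup>+f. indicator {f \<in> space \<nu>. peak (amp f) \<ge> 1/2} f \<partial>\<nu>)"
    by (intro nn_integral_mono) (auto simp: high_peak_def indicator_def ennreal_le_1 ennreal_neg)
  also have "\<dots> = emeasure \<nu> {f \<in> space \<nu>. peak (amp f) \<ge> 1/2}" by (rule nn_integral_indicator) measurable
  also have "\<dots> < \<infinity>" by (rule nu_bounded[OF P]) simp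
  finally have H: "?H < \<infinity>" .
  have 1: "b * (\<integral>\<^sup>+f. ennreal (avg_ratio i \<eta> 2 k f) \<partial>\<nu>) \<le> ?H" if \<eta>: "\<eta> > 0" for i \<eta> k
  proof (rule LIMSEQ_le)
    show "(\<lambda>m. b * (of_nat m * (\<integral>\<^sup>+\<omega>. ennreal (avg_ratio i \<eta> 2 k (Xs m \<omega>)) \<partial>M))) \<longlonglongrightarrow> b * (\<integral>\<^sup>+f. ennreal (avg_ratio i \<eta> 2 k f) \<partial>\<nu>)"
      using b by (intro tendsto_mult_ennreal tendsto_const avg_ratio_vague[OF \<eta>]) auto
    show "(\<lambda>m. of_nat m * (\<integral>\<^sup>+\<omega>. ennreal (high_peak (Xs m \<omega>)) \<partial>M)) \<longlonglongrightarrow> ?H" by (rule high_peak_vague)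
    have "b * (of_nat m * (\<integral>\<^sup>+\<omega>. ennreal (avg_ratio i \<eta> 2 k (Xs m \<omega>)) \<partial>M)) \<le> of_nat m * (\<integral>\<^sup>+\<omega>. ennreal (high_peak (Xs m \<omega>)) \<partial>M)" for m
    proof -
      have "b * (of_nat m * (\<integral>\<^sup>+\<omega>. ennreal (avg_ratio i \<eta> 2 k (Xs m \<omega>)) \<partial>M)) \<le> b * (of_nat m * mean_ratio i \<eta> 1 m)"
        using mean_ratio_bounds_by_avg(2)[OF \<eta>, of i 1 k m] by (intro mult_left_mono) (simp_all add: numeral_2_eq_2)
      also have "\<dots> = of_nat m * (b * mean_ratio i \<eta> 1 m)" by (simp only: mult.left_commute)
      also have "\<dots> \<le> of_nat m * (\<integral>\<^sup>+\<omega>. ennreal (high_peak (Xs m \<omega>)) \<partial>M)"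
        unfolding b_def by (intro mult_left_mono unit_corner_mean_ratio_le[OF \<eta>]) simp
      finally show ?thesis .
    qed
    then show "\<exists>N. \<forall>m\<ge>N. b * (of_nat m * (\<integral>\<^sup>+\<omega>. ennreal (avg_ratio i \<eta> 2 k (Xs m \<omega>)) \<partial>M)) \<le> of_nat m * (\<integral>\<^sup>+\<omega>. ennreal (high_peak (Xs m \<omega>)) \<partial>M)" by blast
  qed
  have 2: "b * (\<integral>\<^sup>+f. ratio i \<eta> 2 (amp f) \<partial>\<nu>) \<le> ?H" if \<eta>: "\<eta> > 0" for i \<eta>
  proof (rule LIMSEQ_le_const2)
    show "(\<lambda>k. b * (\<integral>\<^sup>+f. ennreal (avg_ratio i \<eta> 2 k f) \<partial>\<nu>)) \<longlonglongrightarrow> b * (\<integral>\<^sup>+f. ratio i \<eta> 2 (amp f) \<partial>\<nu>)"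
      using b by (intro tendsto_mult_ennreal tendsto_const avg_ratio_limit[OF \<eta>]) auto
  qed (use 1[OF \<eta>] in blast)
  have 3: "b * (\<integral>\<^sup>+f. sharp_ratio \<eta> (ball_cube 2) (amp f) \<partial>\<nu>) \<le> ?H" if \<eta>: "\<eta> > 0" for \<eta>
  proof (rule LIMSEQ_le_const2)
    show "(\<lambda>i. b * (\<integral>\<^sup>+f. ratio i \<eta> 2 (amp f) \<partial>\<nu>)) \<longlonglongrightarrow> b * (\<integral>\<^sup>+f. sharp_ratio \<eta> (ball_cube 2) (amp f) \<partial>\<nu>)"
      using b by (intro tendsto_mult_ennreal tendsto_const ratio_limit[OF \<eta>]) auto
  qed (use 2[OF \<eta>] in blast)
  let ?u = "\<lambda>k f. sharp_ratio (1 / real (Suc k)) UNIV (amp f)"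
  have um: "?u k \<in> borel_measurable \<nu>" for k
    by (intro nu_measurable sharp_ratio_measurable[OF paths_process]) simp
  have "b * cluster \<le> b * (\<integral>\<^sup>+f. liminf (\<lambda>k. ?u k f) \<partial>\<nu>)" unfolding cluster_def
  proof (intro mult_left_mono nn_integral_mono)
    fix f assume "f \<in> space \<nu>"
    then have f: "f \<in> path_space T" by (simp add: space_nu)
    show "(if amp f 0 > 1 then 1 else 0) / occ 1 UNIV (amp f) \<le> liminf (\<lambda>k. ?u k f)"
    proof (cases "amp f 0 > 1")
      case True
      have "occ 1 UNIV (amp f) > 0" by (rule occ_pos[OF f T_zero True, of 1]) auto
      then obtain n where n: "ennreal (1 / real (Suc n)) < occ 1 UNIV (amp f)"
        by (rule small_ennreal)
      have "\<forall>\<^sub>F k in sequentially. (if amp f 0 > 1 then 1 else 0) / occ 1 UNIV (amp f) \<le> ?u k f"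
      proof (rule eventually_sequentiallyI[of n])
        fix k assume "n \<le> k"
        then have "ennreal (1 / real (Suc k)) \<le> ennreal (1 / real (Suc n))" by (intro ennreal_leI) (simp add: field_simps)
        then have "ennreal (1 / real (Suc k)) \<le> occ 1 UNIV (amp f)" by (rule order_trans[OF _ less_imp_le[OF n]])
        then show "(if amp f 0 > 1 then 1 else 0) / occ 1 UNIV (amp f) \<le> ?u k f"
          by (simp add: sharp_ratio_def max_absorb2)
      qed
      then show ?thesis by (rule Liminf_bounded)
    qed simp
  qed simp
  also have "\<dots> \<le> b * liminf (\<lambda>k. \<integral>\<^sup>+f. ?u k f \<partial>\<nu>)"
    by (intro mult_left_mono nn_integral_liminf um) simp
  also have "\<dots> \<le> b * (?H / b)"
  proof (intro mult_left_mono)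
    have "(\<integral>\<^sup>+f. ?u k f \<partial>\<nu>) \<le> ?H / b" for k
    proof -
      have "b * (\<integral>\<^sup>+f. ?u k f \<partial>\<nu>) \<le> b * (\<integral>\<^sup>+f. sharp_ratio (1 / real (Suc k)) (ball_cube 2) (amp f) \<partial>\<nu>)"
        unfolding sharp_ratio_def
        by (intro mult_left_mono nn_integral_mono divide_left_mono_ennreal max.mono order_refl occ_mono) auto
      also have "\<dots> \<le> ?H" by (rule 3) simp
      finally have "(\<integral>\<^sup>+f. ?u k f \<partial>\<nu>) * b / b \<le> ?H / b"
        by (intro divide_right_mono_ennreal) (simp add: mult.commute)
      then show ?thesis using b by (simp add: ennreal_mult_divide_eq)
    qed
    then have "liminf (\<lambda>k. \<integral>\<^sup>+f. ?u k f \<partial>\<nu>) \<le> liminf (\<lambda>k::nat. ?H / b)"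
      by (intro Liminf_mono) simp
    then show "liminf (\<lambda>k. \<integral>\<^sup>+f. ?u k f \<partial>\<nu>) \<le> ?H / b" by (simp add: Liminf_const)
  qed simp
  also have "\<dots> = ?H" using b by (simp add: ennreal_times_divide ennreal_mult_divide_eq mult.commute[of b])
  finally have "b * cluster < \<infinity>" using H by (rule le_less_trans)
  then show ?thesis using b by (auto simp: ennreal_mult_less_top less_top)
qed

text \<open>
  The law of \<open>Y\<close> is \<open>\<nu>\<close> restricted to the paths that exceed \<open>1\<close> at the origin.
\<close>

lemma theta_eq_cluster:
  fixes N :: "'y measure" and Y :: "'y \<Rightarrow> real^'l \<Rightarrow> real^'d"
  assumes "local_tail_process nrm T \<nu> N Y"
  shows "theta nrm T N Y = cluster"
proof -
  have Y: "Y \<in> N \<rightarrow>\<^sub>M paths" and law: "\<And>A. A \<in> sets paths \<Longrightarrow> emeasure N (Y -` A \<inter> space N) = emeasure \<nu> {f \<in> A. nrm (f 0) > 1}"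
    using assms by (auto simp: local_tail_process_def path_random_element_def)
  have a0[measurable]: "(\<lambda>f. amp f 0) \<in> borel_measurable paths" by (rule amp_eval_measurable[OF T_zero])
  have a0\<nu>[measurable]: "(\<lambda>f. amp f 0) \<in> borel_measurable \<nu>" by (rule nu_measurable[OF a0])
  have om[measurable]: "(\<lambda>f. occ 1 UNIV (amp f)) \<in> borel_measurable paths" by (rule occ_measurable[OF paths_process]) simp
  let ?w = "\<lambda>f. if amp f 0 > 1 then 1 else 0 :: ennreal"
  let ?D = "density \<nu> ?w"
  have emb: "(\<lambda>f. f) \<in> ?D \<rightarrow>\<^sub>M paths" using nu_embedding by simp
  have "distr N paths Y = distr ?D paths (\<lambda>f. f)"
  proof (rule measure_eqI)
    fix A assume "A \<in> sets (distr N paths Y)"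
    then have A: "A \<in> sets paths" by simp
    then have A\<nu>: "A \<inter> space \<nu> \<in> sets \<nu>" using measurable_sets[OF nu_embedding A] by simp
    have "emeasure (distr ?D paths (\<lambda>f. f)) A = emeasure ?D (A \<inter> space \<nu>)"
      using emeasure_distr[OF emb A] by simp
    also have "\<dots> = (\<integral>\<^sup>+f. ?w f * indicator (A \<inter> space \<nu>) f \<partial>\<nu>)" by (rule emeasure_density[OF _ A\<nu>]) measurable
    also have "\<dots> = (\<integral>\<^sup>+f. indicator {f \<in> A \<inter> space \<nu>. amp f 0 > 1} f \<partial>\<nu>)"
      by (intro nn_integral_cong) (auto simp: indicator_def)
    also have "\<dots> = emeasure \<nu> {f \<in> A \<inter> space \<nu>. amp f 0 > 1}"
    proof (rule nn_integral_indicator)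
      have "{f \<in> A \<inter> space \<nu>. amp f 0 > 1} = (A \<inter> space \<nu>) \<inter> {f \<in> space \<nu>. amp f 0 > 1}" by auto
      moreover have "{f \<in> space \<nu>. amp f 0 > 1} \<in> sets \<nu>" by measurable
      ultimately show "{f \<in> A \<inter> space \<nu>. amp f 0 > 1} \<in> sets \<nu>" using A\<nu> by simp
    qed
    also have "{f \<in> A \<inter> space \<nu>. amp f 0 > 1} = {f \<in> A. nrm (f 0) > 1}"
      using sets.sets_into_space[OF A] is_norm_zero[OF nrm] by (auto simp: amp_def space_nu space_paths)
    also have "emeasure \<nu> \<dots> = emeasure (distr N paths Y) A" using emeasure_distr[OF Y A] law[OF A] by simp
    finally show "emeasure (distr N paths Y) A = emeasure (distr ?D paths (\<lambda>f. f)) A" by simp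
  qed simp
  have Tm: "occ 1 T (amp f) = occ 1 UNIV (amp f)" for f
    unfolding occ_def by (rule nn_integral_cong_AE) (use AE_lam_T in \<open>auto elim!: eventually_mono\<close>)
  have "theta nrm T N Y = (\<integral>\<^sup>+\<omega>. 1 / occ 1 UNIV (amp (Y \<omega>)) \<partial>N)"
    unfolding theta_def
    by (intro nn_integral_cong) (use measurable_space[OF Y] in \<open>simp add: space_paths occupation_eq Tm\<close>)
  also have "\<dots> = (\<integral>\<^sup>+f. 1 / occ 1 UNIV (amp f) \<partial>distr N paths Y)"
    by (rule nn_integral_distr[symmetric, OF Y]) measurable
  also have "\<dots> = (\<integral>\<^sup>+f. 1 / occ 1 UNIV (amp f) \<partial>distr ?D paths (\<lambda>f. f))"
    by (simp only: \<open>distr N paths Y = distr ?D paths (\<lambda>f. f)\<close>)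
  also have "\<dots> = (\<integral>\<^sup>+f. 1 / occ 1 UNIV (amp f) \<partial>?D)"
    by (rule nn_integral_distr[OF emb]) measurable
  also have "\<dots> = (\<integral>\<^sup>+f. ?w f * (1 / occ 1 UNIV (amp f)) \<partial>\<nu>)"
  proof (rule nn_integral_density)
    have "(\<lambda>f. occ 1 UNIV (amp f)) \<in> borel_measurable \<nu>" by (rule nu_measurable[OF om])
    then show "(\<lambda>f. 1 / occ 1 UNIV (amp f)) \<in> borel_measurable \<nu>" by measurable
  qed measurable
  also have "\<dots> = cluster" unfolding cluster_def by (intro nn_integral_cong) simp
  finally show ?thesis .
qed

end

theorem proposition6p3:
  fixes nrm :: "real^'d \<Rightarrow> real"
    and T :: "(real^'l) set"
    and M :: "'w measure" and X :: "'w \<Rightarrow> real^'l \<Rightarrow> real^'d"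
    and P :: "'z measure" and Z :: "'z \<Rightarrow> real^'l \<Rightarrow> real^'d"
    and N :: "'y measure" and Y :: "'y \<Rightarrow> real^'l \<Rightarrow> real^'d"
    and \<nu> :: "(real^'l \<Rightarrow> real^'d) measure"
    and \<alpha> :: real and a :: "nat \<Rightarrow> real"
  assumes "is_norm nrm"
    and "T = int_lattice \<or> T = UNIV"
    and "\<alpha> > 0"
    and "a = (\<lambda>n. real n powr (1 / \<alpha>))"
    and "stationary_process T M X"
    and "regularly_varying nrm T M X a \<nu>"
    and "tail_measure_representer nrm T \<alpha> \<nu> P Z"
    and "(\<integral>\<^sup>+\<omega>. ennreal (nrm (Z \<omega> 0) powr \<alpha>) \<partial>P) = 1"
    and "local_tail_process nrm T \<nu> N Y"
    and "\<And>x. x > 0 \<Longrightarrow> measure M {\<omega> \<in> space M. nrm (X \<omega> 0) \<le> x} = exp (- (x powr (- \<alpha>)))"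
    and "T = UNIV \<Longrightarrow>
      \<exists>k>0. \<exists>C::real. \<forall>\<^sub>F n in sequentially. I_cond nrm T M X a k n \<le> ennreal C"
  shows "theta nrm T N Y < \<infinity> \<and>
    (\<forall>x::real. x > 0 \<longrightarrow>
      limsup (\<lambda>n. emeasure M {\<omega> \<in> space M. path_max nrm T n (X \<omega>) > ennreal (a n ^ CARD('l) * x)})
        \<le> theta nrm T N Y * ennreal (x powr (- \<alpha>)))"
proof -
  interpret limit_setting nrm T M X \<nu> a \<alpha>
    by unfold_locales (fact assms)+
  have th: "theta nrm T N Y = cluster" by (rule theta_eq_cluster) (fact assms)
  show ?thesis unfolding th
    using cluster_finite limsup_le_cluster by (simp add: mult.commute)
qed

end
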